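(* Let $n\ge2$. The fixed points $v_n^+$ and $v_n^-$ are unstable in $L^2(0,1)$.
   Context: Consider $u_t-u_{xx}\in H_0(u)$ for $x\in(0,1)$, $t>0$, with $u(0,t)=u(1,t)=0$, $u(x,0)=u_0(x)$, where $H_0(u)=\{-1\}$ if $u<0$, $H_0(0)=[-1,1]$, $H_0(u)=\{1\}$ if $u>0$. A strong solution with initial datum $u_0\in L^2(0,1)$ is $u\in C([0,\infty),L^2(0,1))$ with $u(0)=u_0$, absolutely continuous on every $[T_1,T_2]\subset(0,\infty)$, with $u(t)\in H^2(0,1)\cap H_0^1(0,1)$ for a.a. $t$, and such that there is $g\in L^2_{loc}(0,\infty;L^2(0,1))$ (square integrable on $(0,T)$ for each $T>0$) with $g(t)(x)\in H_0(u(t)(x))$ for a.a. $x\in(0,1)$, for a.a. $t$, and $\frac{du}{dt}(t)-u_{xx}(t)=g(t)$ for a.a. $t>0$. For $n\ge1$, $v_n^+(x)=(-1)^k\left(-\frac{(x-k/n)^2}{2}+\frac{x-k/n}{2n}\right)$ for $x\in[\frac kn,\frac{k+1}n]$, $k=0,\dots,n-1$, and $v_n^-=-v_n^+$; these are fixed points (constant-in-time strong solutions). A fixed point $v$ is stable in $L^2(0,1)$ if for every $\varepsilon>0$ there is $\gamma>0$ such that every strong solution $u$ with $\|u(0)-v\|_{L^2}<\gamma$ satisfies $\|u(t)-v\|_{L^2}<\varepsilon$ for all $t\ge0$; it is unstable if it is not stable. *)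

theory Defs
  imports "HOL-Analysis.Analysis"
begin

text \<open>
  Elements of \<open>L\<^sup>2(0,1)\<close> are represented by functions \<open>real \<Rightarrow> real\<close>; values outside \<open>(0,1)\<close> are
  irrelevant, and every notion below is invariant under changing a representative on a null set.
\<close>

abbreviation I01 :: "real measure" where
  "I01 \<equiv> lebesgue_on {0<..<1}"

definition L2 :: "(real \<Rightarrow> real) set" where
  "L2 = {f. f \<in> borel_measurable I01 \<and> integrable I01 (\<lambda>x. (f x)\<^sup>2)}"

text \<open>Meaningful only on \<open>L2\<close>: for a function that is not square integrable the value is the default \<open>0\<close>.\<close>
definition L2_norm :: "(real \<Rightarrow> real) \<Rightarrow> real" where
  "L2_norm f = sqrt (LINT x|I01. (f x)\<^sup>2)"

definition L2_dist :: "(real \<Rightarrow> real) \<Rightarrow> (real \<Rightarrow> real) \<Rightarrow> real" where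
  "L2_dist f h = L2_norm (\<lambda>x. f x - h x)"

definition test_functions :: "(real \<Rightarrow> real) set" where
  "test_functions = {\<phi>. (\<forall>k x. (deriv ^^ k) \<phi> differentiable at x) \<and>
     compact (closure {x. \<phi> x \<noteq> 0}) \<and> closure {x. \<phi> x \<noteq> 0} \<subseteq> {0<..<1}}"

definition weak_deriv :: "(real \<Rightarrow> real) \<Rightarrow> (real \<Rightarrow> real) \<Rightarrow> bool" where
  "weak_deriv f f' \<longleftrightarrow> f \<in> L2 \<and> f' \<in> L2 \<and>
     (\<forall>\<phi>\<in>test_functions. (LINT x|I01. f x * deriv \<phi> x) = - (LINT x|I01. f' x * \<phi> x))"

definition weak_deriv2 :: "(real \<Rightarrow> real) \<Rightarrow> (real \<Rightarrow> real) \<Rightarrow> bool" where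
  "weak_deriv2 f f'' \<longleftrightarrow> (\<exists>f'. weak_deriv f f' \<and> weak_deriv f' f'')"

definition H2 :: "(real \<Rightarrow> real) set" where
  "H2 = {f. \<exists>f''. weak_deriv2 f f''}"

text \<open>\<open>H\<^sub>0\<^sup>1(0,1)\<close> is the closure of the test functions in the \<open>H\<^sup>1\<close> norm.\<close>
definition H10 :: "(real \<Rightarrow> real) set" where
  "H10 = {f. \<exists>f'. weak_deriv f f' \<and>
     (\<exists>\<phi>. (\<forall>n::nat. \<phi> n \<in> test_functions) \<and>
        (\<lambda>n. L2_dist (\<phi> n) f) \<longlonglongrightarrow> 0 \<and> (\<lambda>n. L2_dist (deriv (\<phi> n)) f') \<longlonglongrightarrow> 0)}"

definition L2_continuous_on :: "real set \<Rightarrow> (real \<Rightarrow> real \<Rightarrow> real) \<Rightarrow> bool" where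
  "L2_continuous_on S u \<longleftrightarrow> (\<forall>t\<in>S. u t \<in> L2) \<and>
     (\<forall>t\<in>S. ((\<lambda>s. L2_dist (u s) (u t)) \<longlongrightarrow> 0) (at t within S))"

text \<open>A finite family of non-overlapping subintervals is a finite set of pairs of end points.\<close>
definition L2_absolutely_continuous_on :: "real \<Rightarrow> real \<Rightarrow> (real \<Rightarrow> real \<Rightarrow> real) \<Rightarrow> bool" where
  "L2_absolutely_continuous_on T1 T2 u \<longleftrightarrow> (\<forall>t\<in>{T1..T2}. u t \<in> L2) \<and>
     (\<forall>\<epsilon>>0. \<exists>\<delta>>0. \<forall>D. finite D \<longrightarrow>
        (\<forall>(a, b)\<in>D. T1 \<le> a \<and> a < b \<and> b \<le> T2) \<longrightarrow>
        disjoint_family_on (\<lambda>(a, b). {a<..<b}) D \<longrightarrow>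
        (\<Sum>(a, b)\<in>D. b - a) < \<delta> \<longrightarrow> (\<Sum>(a, b)\<in>D. L2_dist (u b) (u a)) < \<epsilon>)"

definition has_L2_derivative_at :: "(real \<Rightarrow> real \<Rightarrow> real) \<Rightarrow> (real \<Rightarrow> real) \<Rightarrow> real \<Rightarrow> bool" where
  "has_L2_derivative_at u w t \<longleftrightarrow> w \<in> L2 \<and>
     ((\<lambda>s. L2_dist (\<lambda>x. (u s x - u t x) / (s - t)) w) \<longlongrightarrow> 0) (at t)"

definition L2_strongly_measurable_on :: "real set \<Rightarrow> (real \<Rightarrow> real \<Rightarrow> real) \<Rightarrow> bool" where
  "L2_strongly_measurable_on S g \<longleftrightarrow>
     (\<exists>s. (\<forall>n::nat. simple_function (lebesgue_on S) (s n) \<and> (\<forall>t\<in>S. s n t \<in> L2)) \<and>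
          (AE t in lebesgue_on S. (\<lambda>n. L2_dist (s n t) (g t)) \<longlonglongrightarrow> 0))"

definition L2_Bochner :: "real set \<Rightarrow> (real \<Rightarrow> real \<Rightarrow> real) set" where
  "L2_Bochner S = {g. (AE t in lebesgue_on S. g t \<in> L2) \<and> L2_strongly_measurable_on S g \<and>
     integrable (lebesgue_on S) (\<lambda>t. (L2_norm (g t))\<^sup>2)}"

definition H0 :: "real \<Rightarrow> real set" where
  "H0 r = (if r < 0 then {-1} else if r = 0 then {-1..1} else {1})"

definition strong_solution :: "(real \<Rightarrow> real) \<Rightarrow> (real \<Rightarrow> real \<Rightarrow> real) \<Rightarrow> bool" where
  "strong_solution u0 u \<longleftrightarrow>
     u0 \<in> L2 \<and> L2_continuous_on {0..} u \<and> (AE x in I01. u 0 x = u0 x) \<and>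
     (\<forall>T1 T2. 0 < T1 \<and> T1 \<le> T2 \<longrightarrow> L2_absolutely_continuous_on T1 T2 u) \<and>
     (AE t in lebesgue_on {0<..}. u t \<in> H2 \<inter> H10) \<and>
     (\<exists>g. (\<forall>T>0. g \<in> L2_Bochner {0<..<T}) \<and>
        (AE t in lebesgue_on {0<..}. AE x in I01. g t x \<in> H0 (u t x)) \<and>
        (AE t in lebesgue_on {0<..}. \<exists>ut uxx. has_L2_derivative_at u ut t \<and> weak_deriv2 (u t) uxx \<and>
           (AE x in I01. ut x - uxx x = g t x)))"

definition fixed_point :: "(real \<Rightarrow> real) \<Rightarrow> bool" where
  "fixed_point v \<longleftrightarrow> strong_solution v (\<lambda>t. v)"

definition stable_L2 :: "(real \<Rightarrow> real) \<Rightarrow> bool" where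
  "stable_L2 v \<longleftrightarrow> fixed_point v \<and>
     (\<forall>\<epsilon>>0. \<exists>\<gamma>>0. \<forall>u0 u. strong_solution u0 u \<and> L2_dist (u 0) v < \<gamma> \<longrightarrow>
        (\<forall>t\<ge>0. L2_dist (u t) v < \<epsilon>))"

text \<open>Both notions apply to fixed points only, so an unstable function is in particular a fixed point.\<close>
definition unstable_L2 :: "(real \<Rightarrow> real) \<Rightarrow> bool" where
  "unstable_L2 v \<longleftrightarrow> fixed_point v \<and> \<not> stable_L2 v"

text \<open>The piece containing \<open>x\<close> is selected by \<open>k = \<lfloor>n x\<rfloor>\<close>; the lemma below confirms the formula on
  the closed pieces, including common end points. Values outside \<open>[0,1]\<close> are irrelevant.\<close>
definition v_plus :: "nat \<Rightarrow> real \<Rightarrow> real" where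
  "v_plus n x = (let k = nat \<lfloor>real n * x\<rfloor> in
     (-1) ^ k * (- (x - real k / real n)\<^sup>2 / 2 + (x - real k / real n) / (2 * real n)))"

definition v_minus :: "nat \<Rightarrow> real \<Rightarrow> real" where
  "v_minus n x = - v_plus n x"

lemma v_plus_piece:
  assumes "n \<ge> 1" "k < n" "x \<in> {real k / real n .. real (k + 1) / real n}"
  shows "v_plus n x =
    (-1) ^ k * (- (x - real k / real n)\<^sup>2 / 2 + (x - real k / real n) / (2 * real n))"
proof (cases "x = real (k + 1) / real n")
  case True
  have n: "real n > 0" using assms(1) by simp
  have "real n * x = real (k + 1)" using True n by simp
  then have fl: "nat \<lfloor>real n * x\<rfloor> = k + 1" by (metis floor_of_nat nat_int)
  have d0: "x - real (k + 1) / real n = 0" using True by simp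
  have d1: "x - real k / real n = 1 / real n" using True n by (simp add: field_simps)
  show ?thesis
    unfolding v_plus_def Let_def fl d0 d1 by (simp add: power2_eq_square)
next
  case False
  have n: "real n > 0" using assms(1) by simp
  have "real k \<le> real n * x" "real n * x < real k + 1"
    using assms(3) False n by (auto simp: field_simps)
  then have "\<lfloor>real n * x\<rfloor> = int k" by (intro floor_unique) auto
  then have fl: "nat \<lfloor>real n * x\<rfloor> = k" by simp
  show ?thesis unfolding v_plus_def Let_def fl ..
qed

end

theory Submission
  imports Defs
begin

text \<open>
  Shift the first sign change of the profile \<open>v\<close> to the right by a small \<open>D > 0\<close>. The stationary solution
  for the shifted sign pattern lies above \<open>v\<close> and is still positive at the new sign change; subtracting
  a small multiple of \<open>D sin (\<pi> x)\<close> leaves a strict subsolution \<open>z\<^sub>D\<close>, at distance of order \<open>D\<close> from \<open>v\<close>.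
  Because \<open>H\<^sub>0\<close> is monotone, monotone iteration from \<open>z\<^sub>D\<close> converges to a solution \<open>u\<close> with
  \<open>u(0) = z\<^sub>D\<close> that is nondecreasing in time. If \<open>u \<ge> z\<^sub>D\<close> from some time on, then after one more unit
  of time \<open>u \<ge> z\<^bsub>(1 + \<mu>) D\<^esub>\<close> with a fixed \<open>\<mu> > 0\<close>, so \<open>u\<close> leaves a fixed neighbourhood of \<open>v\<close>
  however small the initial \<open>D\<close> was. The same argument for \<open>- u\<close> treats \<open>- v\<close>.

  The heat equation is solved by sine series, and positivity is tested against finite nonnegative
  sine polynomials, for which the maximum principle is elementary. The source of the limit solution is
  monotone in time with values \<open>\<plusminus>1\<close>, hence Hoelder continuous of exponent \<open>3/4\<close> in \<open>L\<^sup>1\<close> at almost every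
  time; at such times the series of \<open>u\<^sub>t\<close> converges absolutely, which yields the required regularity.
\<close>

section \<open>Sine expansions and the maximum principle\<close>

text \<open>The source is discontinuous and increasing in u, so a datum may have several solutions;
  instability asks for one escaping solution in each neighbourhood, and comparison is carried out
  along the construction of that solution. The size of the effect: at the node
  \<open>a = 1 / n\<close> the profile falls with slope \<open>a / 2\<close>, so at
  \<open>a + D\<close> it has lost about \<open>a * D / 2\<close>, whereas flipping the source from
  -1 to 1 on \<open>(a, a + D]\<close> raises the stationary solution there by about
  \<open>2 * a * (1 - a) * D\<close>. For \<open>n \<ge> 2\<close> one has
  \<open>a \<le> 1/2\<close>, so the gain is about \<open>a * D\<close> or more and beats the loss:
  a displaced node is pushed further in the same direction. Gain and loss are linear in
  \<open>D\<close> up to quadratic terms, which the recurring bound \<open>D \<le> a / 8\<close>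
  keeps small; hence the growth factor per unit of time does not depend on \<open>D\<close>. In the
  regularity part, monotonicity in time takes the place of maximal regularity, and all estimates are
  made coefficient by coefficient.\<close>

definition sine :: "nat \<Rightarrow> real \<Rightarrow> real" where
  "sine k x = sin (pi * (real k + 1) * x)"

text \<open>The Dirichlet eigenvalues of minus the second derivative, counted from 0; with this
  shift every index belongs to a genuine eigenfunction.\<close>

definition eigenval :: "nat \<Rightarrow> real" where
  "eigenval k = (pi * (real k + 1))\<^sup>2"

text \<open>The factor 2 is the inverse of the squared norm of \<open>sine k\<close>, so that a sine
  series returns its own coefficients.\<close>

definition sine_coeff :: "(real \<Rightarrow> real) \<Rightarrow> nat \<Rightarrow> real" where
  "sine_coeff h k = 2 * (LINT x|I01. h x * sine k x)"

lemma eigenval_ge_1: "eigenval k \<ge> 1"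
proof -
  have "pi * (real k + 1) \<ge> 3 * 1"
    using pi_gt3 by (intro mult_mono) auto
  then show ?thesis unfolding eigenval_def by (simp add: one_le_power)
qed

lemma eigenval_pos [simp]: "eigenval k > 0"
  using eigenval_ge_1[of k] by linarith

lemma abs_sine_le_1 [simp]: "\<bar>sine k x\<bar> \<le> 1"
  by (simp add: sine_def)

lemma continuous_on_sine [continuous_intros]:
  fixes f :: "'a::t2_space \<Rightarrow> real"
  shows "continuous_on S f \<Longrightarrow> continuous_on S (\<lambda>x. sine k (f x))"
  unfolding sine_def by (intro continuous_on_sin continuous_on_mult continuous_on_const)

lemma sine_measurable [measurable]: "sine k \<in> borel_measurable borel"
  unfolding sine_def by measurable

lemma sine_0 [simp]: "sine k 0 = 0" and sine_1 [simp]: "sine k 1 = 0"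
  using sin_npi2[of "Suc k"] by (simp_all add: sine_def algebra_simps)

section \<open>Integration over the unit interval and orthogonality of the sines\<close>

lemma space_I01 [simp]: "space I01 = {0<..<1}"
  by simp

lemma measure_I01: "emeasure I01 {0<..<1} = 1"
  by (simp add: emeasure_restrict_space)

interpretation I01: finite_measure I01
  by standard (simp add: measure_I01 del: space_restrict_space)

lemma measurable_ident_I01: "(\<lambda>x. x) \<in> I01 \<rightarrow>\<^sub>M borel"
  by (intro measurable_restrict_space1 measurable_completion) simp

lemma borel_imp_I01: "h \<in> borel_measurable borel \<Longrightarrow> h \<in> borel_measurable I01"
  using measurable_compose[OF measurable_ident_I01] by blast

lemma integrable_I01_bounded:
  fixes h :: "real \<Rightarrow> real"
  assumes "h \<in> borel_measurable I01" "\<And>x. x \<in> {0<..<1} \<Longrightarrow> \<bar>h x\<bar> \<le> B"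
  shows "integrable I01 h"
  using assms by (intro I01.integrable_const_bound[of _ B] AE_I2) auto

lemma measure_I01_eq_1 [simp]: "measure I01 {0<..<1} = 1"
  using measure_I01 by (simp add: measure_def)

lemma continuous_on_imp_I01:
  fixes h :: "real \<Rightarrow> real"
  assumes "continuous_on {0<..<1} h"
  shows "h \<in> borel_measurable I01"
  using assms by (intro continuous_imp_measurable_on_sets_lebesgue) auto

lemma integrable_I01_continuous:
  fixes h :: "real \<Rightarrow> real"
  assumes "continuous_on {0..1} h"
  shows "integrable I01 h"
proof -
  have "bounded (h ` {0..1})"
    using assms by (intro compact_imp_bounded compact_continuous_image) auto
  then obtain B where "\<forall>x\<in>{0..1}. \<bar>h x\<bar> \<le> B"
    by (auto simp: bounded_iff)
  moreover have "h \<in> borel_measurable I01"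
    using assms by (intro continuous_on_imp_I01) (auto intro: continuous_on_subset)
  ultimately show ?thesis
    by (intro integrable_I01_bounded[of _ B]) auto
qed

lemma integral_I01_FTC:
  fixes F f :: "real \<Rightarrow> real"
  assumes S: "finite S" and F: "continuous_on {0..1} F"
    and d: "\<And>x. x \<in> {0<..<1} - S \<Longrightarrow> (F has_real_derivative f x) (at x)"
    and f: "integrable I01 f"
  shows "(LINT x|I01. f x) = F 1 - F 0"
proof -
  have "(f has_integral (F 1 - F 0)) {0..1}"
    using d by (intro fundamental_theorem_of_calculus_interior_strong[OF S _ _ F])
      (auto simp: has_real_derivative_iff_has_vector_derivative)
  then have "(f has_integral (F 1 - F 0)) {0<..<1}"
    using has_integral_open_interval[of f "F 1 - F 0" 0 1] by (simp add: box_real cbox_interval)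
  then show ?thesis
    using lebesgue_integral_eq_integral[OF f] by (simp add: integral_unique)
qed

lemma integral_I01_cos: 
  "(LINT x|I01. cos (pi * real_of_int m * x)) = (if m = 0 then 1 else 0)"
proof (cases "m = 0")
  case False
  have "(LINT x|I01. cos (pi * real_of_int m * x)) =
      sin (pi * real_of_int m * 1) / (pi * real_of_int m) - sin (pi * real_of_int m * 0) / (pi * real_of_int m)"
    using False
    by (intro integral_I01_FTC[of "{}"] integrable_I01_continuous)
       (auto intro!: continuous_intros derivative_eq_intros)
  also have "\<dots> = 0"
    using sin_zero_iff_int2[of "pi * real_of_int m"] by (simp add: mult.commute)
  finally show ?thesis using False by simp
qed simp

lemma integral_sine_sine:
  "(LINT x|I01. sine j x * sine k x) = (if j = k then 1 / 2 else 0)"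
proof -
  \<comment> \<open>The summand 2 stems from the index shift; it keeps the second frequency away
    from 0, so only the first cosine can have a nonzero mean.\<close>
  have eq: "sine j x * sine k x = (cos (pi * real_of_int (int j - int k) * x) -
      cos (pi * real_of_int (int j + int k + 2) * x)) / 2" for x
    unfolding sine_def sin_times_sin by (simp add: algebra_simps)
  have "(LINT x|I01. sine j x * sine k x) =
     ((LINT x|I01. cos (pi * real_of_int (int j - int k) * x)) -
      (LINT x|I01. cos (pi * real_of_int (int j + int k + 2) * x))) / 2"
    unfolding eq
    by (subst integral_divide_zero, subst Bochner_Integration.integral_diff)
       (auto intro!: integrable_I01_continuous continuous_intros)
  then show ?thesis unfolding integral_I01_cos by auto
qed

lemma integrable_times_sine:
  assumes "integrable I01 h"
  shows "integrable I01 (\<lambda>x. h x * sine k x)"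
proof (rule Bochner_Integration.integrable_bound[OF assms])
  show "(\<lambda>x. h x * sine k x) \<in> borel_measurable I01"
    using assms borel_imp_I01[OF sine_measurable] by measurable
  have "\<bar>h x\<bar> * \<bar>sine k x\<bar> \<le> \<bar>h x\<bar> * 1" for x
    by (intro mult_left_mono) auto
  then show "AE x in I01. norm (h x * sine k x) \<le> norm (h x)"
    by (auto simp: abs_mult)
qed

lemma sine_coeff_diff:
  "integrable I01 f \<Longrightarrow> integrable I01 h \<Longrightarrow>
    sine_coeff (\<lambda>x. f x - h x) k = sine_coeff f k - sine_coeff h k"
  unfolding sine_coeff_def left_diff_distrib
  by (subst Bochner_Integration.integral_diff) (auto intro: integrable_times_sine)

lemma sine_coeff_cmult: "sine_coeff (\<lambda>x. c * h x) k = c * sine_coeff h k"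
  unfolding sine_coeff_def mult.assoc by simp

lemma sine_coeff_sine: "sine_coeff (sine j) k = (if j = k then 1 else 0)"
  unfolding sine_coeff_def integral_sine_sine by simp

lemma sine_coeff_cong:
  "(\<And>x. x \<in> {0<..<1} \<Longrightarrow> f x = h x) \<Longrightarrow> sine_coeff f k = sine_coeff h k"
  unfolding sine_coeff_def by (intro arg_cong[where f = "\<lambda>y. 2 * y"] Bochner_Integration.integral_cong) auto

lemma integral_times_sine_sum:
  assumes "integrable I01 h"
  shows "(LINT x|I01. h x * (\<Sum>k<N. c k * sine k x)) = (\<Sum>k<N. c k * sine_coeff h k) / 2"
proof -
  have "(LINT x|I01. h x * (\<Sum>k<N. c k * sine k x)) = (LINT x|I01. (\<Sum>k<N. c k * (h x * sine k x)))"
    by (simp add: sum_distrib_left mult_ac)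
  also have "\<dots> = (\<Sum>k<N. c k * sine_coeff h k) / 2"
    using integrable_times_sine[OF assms]
    by (subst Bochner_Integration.integral_sum) (auto simp: sine_coeff_def sum_divide_distrib)
  finally show ?thesis .
qed

section \<open>Sine polynomials as tests for positivity\<close>

definition sine_poly :: "(real \<Rightarrow> real) \<Rightarrow> bool" where
  "sine_poly p \<longleftrightarrow> (\<exists>c N. p = (\<lambda>x. \<Sum>k<N. c k * sine k x))"

lemma sine_poly_0: "sine_poly (\<lambda>x. 0)"
  unfolding sine_poly_def by (intro exI[of _ "\<lambda>_. 0"] exI[of _ 0]) simp

lemma sine_poly_sine: "sine_poly (sine k)"
  unfolding sine_poly_def
  by (intro exI[of _ "\<lambda>j. if j = k then 1 else 0"] exI[of _ "Suc k"])
     (auto simp: fun_eq_iff if_distrib[of "\<lambda>z. z * _"] cong: if_cong)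

lemma sine_poly_cmult: "sine_poly p \<Longrightarrow> sine_poly (\<lambda>x. a * p x)"
  unfolding sine_poly_def
  by (elim exE, rule_tac x = "\<lambda>k. a * c k" in exI, rule_tac x = N in exI)
     (auto simp: sum_distrib_left mult_ac)

lemma sine_poly_add:
  assumes "sine_poly p" "sine_poly q"
  shows "sine_poly (\<lambda>x. p x + q x)"
proof -
  obtain c N d M where p: "p = (\<lambda>x. \<Sum>k<N. c k * sine k x)" and q: "q = (\<lambda>x. \<Sum>k<M. d k * sine k x)"
    using assms unfolding sine_poly_def by blast
  define K where "K = max N M"
  have ext: "(\<Sum>k<n. b k * sine k x) = (\<Sum>k<K. (if k < n then b k else 0) * sine k x)" 
    if "n \<le> K" for b x n
    using that by (intro sum.mono_neutral_cong_left) auto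
  show ?thesis unfolding sine_poly_def
    by (intro exI[of _ "\<lambda>k. (if k < N then c k else 0) + (if k < M then d k else 0)"] exI[of _ K])
       (auto simp: p q ext[of N] ext[of M] distrib_right sum.distrib K_def)
qed

lemma sine_poly_sum: "finite A \<Longrightarrow> (\<And>i. i \<in> A \<Longrightarrow> sine_poly (p i)) \<Longrightarrow> sine_poly (\<lambda>x. \<Sum>i\<in>A. p i x)"
  by (induction rule: finite_induct) (auto intro: sine_poly_0 sine_poly_add)

text \<open>Product-to-sum formulas shift the frequency by one in both directions; the lowest
  frequency is a case of its own because its lower neighbour is the vanishing sine of frequency
  0.\<close>

lemma sine_poly_times_cos:
  assumes "sine_poly p" shows "sine_poly (\<lambda>x. p x * cos (pi * x))"
proof -
  have basis: "sine_poly (\<lambda>x. sine k x * cos (pi * x))" for k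
  proof (cases k)
    case 0
    have "(\<lambda>x. sine k x * cos (pi * x)) = (\<lambda>x. (1/2) * sine 1 x)"
      using 0 sin_double[of "pi * x" for x] by (simp add: fun_eq_iff sine_def mult_ac)
    then show ?thesis by (simp only: sine_poly_cmult sine_poly_sine)
  next
    case (Suc m)
    have "(\<lambda>x. sine k x * cos (pi * x)) = (\<lambda>x. (1/2) * sine (Suc k) x + (1/2) * sine m x)"
      using Suc sin_times_cos[of "pi * (real k + 1) * x" "pi * x" for x]
      by (simp add: fun_eq_iff sine_def algebra_simps add_divide_distrib)
    then show ?thesis by (simp only: sine_poly_add sine_poly_cmult sine_poly_sine)
  qed
  obtain c N where p: "p = (\<lambda>x. \<Sum>k<N. c k * sine k x)"
    using assms unfolding sine_poly_def by blast
  have "sine_poly (\<lambda>x. \<Sum>k<N. c k * (sine k x * cos (pi * x)))"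
    by (intro sine_poly_sum sine_poly_cmult basis) auto
  then show ?thesis by (simp add: p sum_distrib_right mult.assoc)
qed

text \<open>These sine polynomials are dense enough to test for nonnegativity: \<open>P\<close> may approximate
  the square root of any nonnegative continuous function of \<open>cos (pi * x)\<close>.\<close>

lemma sine_poly_times_poly_cos:
  assumes "real_polynomial_function P"
  shows "sine_poly (\<lambda>x. sin (pi * x) * P (cos (pi * x)))"
proof -
  obtain a n where P: "P = (\<lambda>x. \<Sum>i\<le>n. a i * x ^ i)"
    using assms real_polynomial_function_iff_sum by blast
  have pow: "sine_poly (\<lambda>x. sin (pi * x) * cos (pi * x) ^ i)" for i :: nat
  proof (induction i)
    case 0
    have "sine 0 = (\<lambda>x. sin (pi * x))" by (simp add: fun_eq_iff sine_def)
    then show ?case using sine_poly_sine[of 0] by simp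
  next
    case (Suc i)
    then show ?case using sine_poly_times_cos[OF Suc] by (simp add: mult_ac)
  qed
  have "sine_poly (\<lambda>x. \<Sum>i\<le>n. a i * (sin (pi * x) * cos (pi * x) ^ i))"
    by (intro sine_poly_sum sine_poly_cmult pow) auto
  then show ?thesis by (simp add: P sum_distrib_left mult_ac)
qed

text \<open>The map \<open>cos (pi * x)\<close> is a homeomorphism of \<open>[0,1]\<close> onto
  \<open>[-1,1]\<close>, so Weierstrass approximation in the variable
  \<open>y = cos (pi * x)\<close> reaches every continuous function.\<close>

lemma cos_approx:
  fixes F :: "real \<Rightarrow> real"
  assumes "continuous_on {0..1} F" "e > 0"
  obtains P where "real_polynomial_function P" "\<And>x. x \<in> {0..1} \<Longrightarrow> \<bar>F x - P (cos (pi * x))\<bar> < e"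
proof -
  have "continuous_on {-1..1} (\<lambda>y. F (arccos y / pi))"
  proof (rule continuous_on_compose2[OF assms(1)])
    show "continuous_on {-1..1} (\<lambda>y. arccos y / pi)" by (intro continuous_intros) auto
    show "(\<lambda>y. arccos y / pi) ` {-1..1} \<subseteq> {0..1}"
      using arccos_lbound arccos_ubound by (auto simp: field_simps)
  qed
  then obtain P where P: "real_polynomial_function P"
    "\<And>y. y \<in> {-1..1} \<Longrightarrow> \<bar>F (arccos y / pi) - P y\<bar> < e"
    using Stone_Weierstrass_real_polynomial_function[of "{-1..1}" _ e] assms(2) by auto
  have "\<bar>F x - P (cos (pi * x))\<bar> < e" if "x \<in> {0..1}" for x
  proof -
    have "arccos (cos (pi * x)) = pi * x" using that by (intro arccos_cos) auto
    then show ?thesis using P(2)[of "cos (pi * x)"] by simp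
  qed
  then show ?thesis using P(1) that by blast
qed

lemma integral_I01_tendsto:
  fixes s :: "nat \<Rightarrow> real \<Rightarrow> real"
  assumes "\<And>n. s n \<in> borel_measurable I01" "f \<in> borel_measurable I01"
    and "AE x in I01. (\<lambda>n. s n x) \<longlonglongrightarrow> f x"
    and "integrable I01 w" "\<And>n x. x \<in> {0<..<1} \<Longrightarrow> \<bar>s n x\<bar> \<le> w x"
  shows "(\<lambda>n. LINT x|I01. s n x) \<longlonglongrightarrow> (LINT x|I01. f x)"
  using assms by (intro integral_dominated_convergence[of f I01 s w]) auto

text \<open>Approximating \<open>sqrt (F x)\<close> and squaring keeps every approximant
  nonnegative, which approximating \<open>F\<close> itself would not; each
  \<open>sin (pi * x)\<close> times a square is then a nonnegative sine polynomial, to which the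
  hypothesis applies.\<close>

lemma integral_sine_test_continuous:
  assumes h: "integrable I01 h"
    and pos: "\<And>c N. (\<And>x. x \<in> {0..1} \<Longrightarrow> 0 \<le> (\<Sum>k<N. c k * sine k x)) \<Longrightarrow>
        0 \<le> (\<Sum>k<N. c k * sine_coeff h k)"
    and F: "continuous_on {0..1} F" "\<And>x. x \<in> {0..1} \<Longrightarrow> 0 \<le> F x"
  shows "0 \<le> (LINT x|I01. h x * sin (pi * x) * F x)"
proof -
  have sq: "continuous_on {0..1} (\<lambda>x. sqrt (F x))"
    by (intro continuous_intros F)
  have "\<exists>P. real_polynomial_function P \<and> (\<forall>x\<in>{0..1}. \<bar>sqrt (F x) - P (cos (pi * x))\<bar> < inverse (real (Suc n)))" for n
    using cos_approx[OF sq, of "inverse (real (Suc n))"] by (metis inverse_positive_iff_positive of_nat_0_less_iff zero_less_Suc)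
  then obtain P where P: "\<And>n. real_polynomial_function (P n)"
      "\<And>n x. x \<in> {0..1} \<Longrightarrow> \<bar>sqrt (F x) - P n (cos (pi * x))\<bar> < inverse (real (Suc n))"
    by metis
  have cP: "continuous_on {0..1} (\<lambda>x. P n (cos (pi * x)))" for n
  proof -
    have "continuous_on UNIV (P n)"
      using P(1)[of n] by (simp add: continuous_on_polymonial_function real_polynomial_function_eq)
    then show ?thesis
      by (rule continuous_on_compose2) (auto intro!: continuous_intros)
  qed
  obtain B where B: "\<And>x. x \<in> {0..1} \<Longrightarrow> \<bar>sqrt (F x)\<bar> \<le> B"
    using compact_imp_bounded[OF compact_continuous_image[OF sq]] by (force simp: bounded_iff)
  have Pb: "\<bar>P n (cos (pi * x))\<bar> \<le> B + 1" if "x \<in> {0..1}" for n x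
  proof -
    have "inverse (real (Suc n)) \<le> 1" by (simp add: field_simps)
    then show ?thesis using P(2)[OF that, of n] B[OF that] by linarith
  qed
  have [measurable]: "h \<in> borel_measurable I01" using h by simp
  have [measurable]: "(\<lambda>x. P n (cos (pi * x))) \<in> borel_measurable I01" for n
    by (intro continuous_on_imp_I01 continuous_on_subset[OF cP]) auto
  have [measurable]: "F \<in> borel_measurable I01"
    by (intro continuous_on_imp_I01 continuous_on_subset[OF F(1)]) auto
  have [measurable]: "(\<lambda>x. sin (pi * x)) \<in> borel_measurable I01"
    by (intro continuous_on_imp_I01 continuous_intros)
  have "0 \<le> (LINT x|I01. h x * sin (pi * x) * (P n (cos (pi * x)))\<^sup>2)" for n
  proof -
    have "real_polynomial_function (\<lambda>y. P n y * P n y)"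
      by (intro real_polynomial_function.intros P)
    from sine_poly_times_poly_cos[OF this] obtain c N where
      c: "(\<lambda>x. sin (pi * x) * (P n (cos (pi * x)))\<^sup>2) = (\<lambda>x. \<Sum>k<N. c k * sine k x)"
      unfolding sine_poly_def power2_eq_square by blast
    have "0 \<le> (\<Sum>k<N. c k * sine_coeff h k)"
    proof (rule pos)
      fix x :: real assume "x \<in> {0..1}"
      then have "0 \<le> sin (pi * x)" by (intro sin_ge_zero) auto
      then show "0 \<le> (\<Sum>k<N. c k * sine k x)" using fun_cong[OF c, of x] by (metis zero_le_mult_iff zero_le_power2)
    qed
    then show ?thesis
      using integral_times_sine_sum[OF h, of c N] by (simp add: c[THEN fun_cong, symmetric] mult.assoc)
  qed
  moreover have "(\<lambda>n. LINT x|I01. h x * sin (pi * x) * (P n (cos (pi * x)))\<^sup>2) \<longlonglongrightarrow>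
     (LINT x|I01. h x * sin (pi * x) * F x)"
  proof (rule integral_I01_tendsto)
    show "integrable I01 (\<lambda>x. \<bar>h x\<bar> * (B + 1)\<^sup>2)" using h by auto
    show "\<bar>h x * sin (pi * x) * (P n (cos (pi * x)))\<^sup>2\<bar> \<le> \<bar>h x\<bar> * (B + 1)\<^sup>2" if "x \<in> {0<..<1}" for n x
    proof -
      have "\<bar>P n (cos (pi * x))\<bar>\<^sup>2 \<le> (B + 1)\<^sup>2" using Pb[of x n] that by (intro power_mono) auto
      moreover have "\<bar>h x\<bar> * \<bar>sin (pi * x)\<bar> \<le> \<bar>h x\<bar> * 1" by (intro mult_left_mono) auto
      ultimately show ?thesis by (simp add: abs_mult mult_mono)
    qed
    have "(\<lambda>n. h x * sin (pi * x) * (P n (cos (pi * x)))\<^sup>2) \<longlonglongrightarrow> h x * sin (pi * x) * F x"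
      if x: "x \<in> {0<..<1}" for x
    proof -
      have "(\<lambda>n. P n (cos (pi * x))) \<longlonglongrightarrow> sqrt (F x)"
      proof (rule Lim_null[THEN iffD2])
        show "(\<lambda>n. P n (cos (pi * x)) - sqrt (F x)) \<longlonglongrightarrow> 0"
          by (rule Lim_null_comparison[OF _ LIMSEQ_inverse_real_of_nat])
             (use P(2)[of x] x in \<open>auto simp: abs_minus_commute less_imp_le simp del: of_nat_Suc\<close>)
      qed
      then have "(\<lambda>n. h x * sin (pi * x) * (P n (cos (pi * x)))\<^sup>2) \<longlonglongrightarrow> h x * sin (pi * x) * (sqrt (F x))\<^sup>2"
        by (intro tendsto_intros)
      then show ?thesis using F(2)[of x] x by simp
    qed
    then show "AE x in I01. (\<lambda>n. h x * sin (pi * x) * (P n (cos (pi * x)))\<^sup>2) \<longlonglongrightarrow> h x * sin (pi * x) * F x"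
      by auto
  qed measurable
  ultimately show ?thesis using LIMSEQ_le_const by blast
qed

text \<open>The test function is the indicator \<open>ch\<close> of the set where \<open>h\<close>
  is negative, reached as an almost everywhere limit of continuous functions. The resulting integral
  is nonnegative while its integrand is nowhere positive, so the integrand vanishes almost
  everywhere.\<close>

lemma sine_coeff_nonneg_AE:
  assumes h: "integrable I01 h"
    and pos: "\<And>c N. (\<And>x. x \<in> {0..1} \<Longrightarrow> 0 \<le> (\<Sum>k<N. c k * sine k x)) \<Longrightarrow>
        0 \<le> (\<Sum>k<N. c k * sine_coeff h k)"
  shows "AE x in I01. 0 \<le> h x"
proof -
  define ch :: "real \<Rightarrow> real" where "ch x = (if h x < 0 then 1 else 0)" for x
  have [measurable]: "h \<in> borel_measurable I01" using h by simp
  have [measurable]: "(\<lambda>x. sin (pi * x)) \<in> borel_measurable I01"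
    by (intro continuous_on_imp_I01 continuous_intros)
  have ch[measurable]: "ch \<in> borel_measurable I01" unfolding ch_def by measurable
  then obtain N s where N: "negligible N" and s: "\<And>n. continuous_on UNIV (s n)"
    and lim: "\<And>x. x \<notin> N \<Longrightarrow> (\<lambda>n. s n x) \<longlonglongrightarrow> (if x \<in> {0<..<1} then ch x else 0)"
    using measurable_on_iff_borel_measurable[of "{0<..<1::real}" ch] unfolding measurable_on_def by auto
  \<comment> \<open>Clamping makes the approximants nonnegative, as the tests require, and dominated
    by 1, without moving the limit \<open>ch\<close>.\<close>
  define s' where "s' n x = max 0 (min 1 (s n x))" for n :: nat and x :: real
  have s': "continuous_on A (s' n)" for n A
    unfolding s'_def using s[of n] by (intro continuous_intros) (auto intro: continuous_on_subset)
  have [measurable]: "s' n \<in> borel_measurable I01" for n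
    by (intro continuous_on_imp_I01 s')
  have "0 \<le> (LINT x|I01. h x * sin (pi * x) * s' n x)" for n
    by (rule integral_sine_test_continuous[OF h pos s']) (auto simp: s'_def)
  moreover have "(\<lambda>n. LINT x|I01. h x * sin (pi * x) * s' n x) \<longlonglongrightarrow> (LINT x|I01. h x * sin (pi * x) * ch x)"
  proof (rule integral_I01_tendsto)
    show "integrable I01 (\<lambda>x. \<bar>h x\<bar>)" using h by auto
    show "\<bar>h x * sin (pi * x) * s' n x\<bar> \<le> \<bar>h x\<bar>" for n x
    proof -
      have "\<bar>h x\<bar> * \<bar>sin (pi * x)\<bar> * \<bar>s' n x\<bar> \<le> \<bar>h x\<bar> * 1 * 1"
        by (intro mult_mono) (auto simp: s'_def)
      then show ?thesis by (simp add: abs_mult)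
    qed
    have "(\<lambda>n. h x * sin (pi * x) * s' n x) \<longlonglongrightarrow> h x * sin (pi * x) * ch x" if "x \<in> {0<..<1}" "x \<notin> N" for x
    proof -
      have "(\<lambda>n. max 0 (min 1 (s n x))) \<longlonglongrightarrow> max 0 (min 1 (ch x))"
        using lim[of x] that by (intro tendsto_intros) auto
      then show ?thesis unfolding s'_def by (intro tendsto_intros) (auto simp: ch_def)
    qed
    moreover have "AE x in I01. x \<notin> N"
      using N by (auto simp: AE_restrict_space_iff negligible_iff_null_sets dest!: AE_not_in)
    ultimately show "AE x in I01. (\<lambda>n. h x * sin (pi * x) * s' n x) \<longlonglongrightarrow> h x * sin (pi * x) * ch x"
      by (auto simp: AE_restrict_space_iff elim!: eventually_mono)
  qed measurable
  ultimately have *: "0 \<le> (LINT x|I01. h x * sin (pi * x) * ch x)" using LIMSEQ_le_const by blast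
  have sinpos: "0 < sin (pi * x)" if "x \<in> {0<..<1}" for x using that by (intro sin_gt_zero) auto
  have int: "integrable I01 (\<lambda>x. - (h x * sin (pi * x) * ch x))"
  proof (rule Bochner_Integration.integrable_bound[OF h])
    have "\<bar>h x\<bar> * \<bar>sin (pi * x)\<bar> * \<bar>ch x\<bar> \<le> \<bar>h x\<bar> * 1 * 1" for x
      by (intro mult_mono) (auto simp: ch_def)
    then show "AE x in I01. norm (- (h x * sin (pi * x) * ch x)) \<le> norm (h x)"
      by (simp add: abs_mult)
  qed measurable
  have nn: "AE x in I01. 0 \<le> - (h x * sin (pi * x) * ch x)"
    using sinpos by (intro AE_I2) (auto simp: ch_def mult_le_0_iff less_imp_le)
  have "(LINT x|I01. - (h x * sin (pi * x) * ch x)) = 0"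
    using * integral_nonneg_AE[OF nn] by simp
  then have "AE x in I01. - (h x * sin (pi * x) * ch x) = 0"
    using integral_nonneg_eq_0_iff_AE[OF int nn] by simp
  moreover have "AE x in I01. x \<in> {0<..<1}" by (intro AE_I2) simp
  ultimately show ?thesis
  proof eventually_elim
    case (elim x)
    then show ?case using sinpos[of x] by (auto simp: ch_def split: if_splits)
  qed
qed

lemma sine_coeff_unique_AE:
  assumes "integrable I01 f" "integrable I01 h" "\<And>k. sine_coeff f k = sine_coeff h k"
  shows "AE x in I01. f x = h x"
proof -
  have "AE x in I01. 0 \<le> f x - h x"
    using assms by (intro sine_coeff_nonneg_AE) (auto simp: sine_coeff_diff)
  moreover have "AE x in I01. 0 \<le> h x - f x"
    using assms by (intro sine_coeff_nonneg_AE) (auto simp: sine_coeff_diff)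
  ultimately show ?thesis by eventually_elim auto
qed

lemma AE_nonneg_continuous:
  fixes h :: "real \<Rightarrow> real"
  assumes "continuous_on {0<..<1} h" "AE x in I01. 0 \<le> h x" "x \<in> {0<..<1}"
  shows "0 \<le> h x"
proof (rule ccontr)
  assume "\<not> 0 \<le> h x"
  define U where "U = {0<..<1} \<inter> h -` {..<0}"
  have U: "open U" unfolding U_def using assms(1) by (intro continuous_open_preimage) auto
  have "AE y in lebesgue. y \<notin> U"
    using assms(2) unfolding U_def
    by (simp add: AE_restrict_space_iff) (auto elim!: eventually_mono)
  then have "negligible U"
    using U by (simp add: negligible_iff_null_sets AE_iff_null_sets)
  then show False
    using open_not_negligible[OF U] assms(3) \<open>\<not> 0 \<le> h x\<close> unfolding U_def by fastforce
qed

text \<open>The classical minimum principle: adding \<open>\<delta> * t\<close> turns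
  \<open>U_t = U_xx\<close> into \<open>V_t - V_xx = \<delta> > 0\<close>, which contradicts a
  negative minimum of \<open>V\<close>, because there \<open>V_t \<le> 0\<close> and
  \<open>V_xx \<ge> 0\<close>. Initial and boundary values exclude the other locations of such a
  minimum.\<close>

lemma sine_heat_nonneg:
  assumes pos: "\<And>x. x \<in> {0..1} \<Longrightarrow> 0 \<le> (\<Sum>k<N. c k * sine k x)"
    and r: "0 \<le> r" and x: "x \<in> {0..1}"
  shows "0 \<le> (\<Sum>k<N. c k * exp (- eigenval k * r) * sine k x)"
proof (rule ccontr)
  define U where "U t x = (\<Sum>k<N. c k * exp (- eigenval k * t) * sine k x)" for t x
  assume "\<not> 0 \<le> (\<Sum>k<N. c k * exp (- eigenval k * r) * sine k x)"
  then have neg: "U r x < 0" by (simp add: U_def)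
  \<comment> \<open>Small enough to leave \<open>V\<close> negative at \<open>(r, x)\<close>;
    \<open>r + 1\<close> prevents a division by zero when \<open>r = 0\<close>.\<close>
  define \<delta> where "\<delta> = - U r x / (2 * (r + 1))"
  have \<delta>: "\<delta> > 0" using neg r by (simp add: \<delta>_def field_simps)
  define V where "V z = U (fst z) (snd z) + \<delta> * fst z" for z
  have "U r x + \<delta> * r < 0"
  proof -
    have "\<delta> * (2 * (r + 1)) = - U r x" using r by (simp add: \<delta>_def)
    then have "U r x + \<delta> * r = - \<delta> * (r + 2)" by (simp add: algebra_simps)
    then show ?thesis using \<delta> r by (simp add: mult_neg_pos)
  qed
  then have Vneg: "V (r, x) < 0" by (simp add: V_def)
  have "continuous_on ({0..r} \<times> {0..1}) V"
    unfolding V_def U_def by (intro continuous_intros)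
  then obtain t0 x0 where min: "t0 \<in> {0..r}" "x0 \<in> {0..1}"
      "\<And>t y. t \<in> {0..r} \<Longrightarrow> y \<in> {0..1} \<Longrightarrow> V (t0, x0) \<le> V (t, y)"
    using continuous_attains_inf[of "{0..r} \<times> {0..1}" V] x r compact_Times[of "{0..r}" "{0..1::real}"]
    by force
  have V0: "V (t0, x0) < 0" using min(3)[of r x] Vneg r x by simp
  have x0: "x0 \<in> {0<..<1}"
  proof -
    have "x0 \<noteq> 0" "x0 \<noteq> 1" using V0 \<delta> min(1) by (auto simp: V_def U_def mult_less_0_iff)
    then show ?thesis using min(2) by auto
  qed
  have t0: "t0 > 0"
  proof -
    have "t0 \<noteq> 0" using V0 pos[OF min(2)] by (auto simp: V_def U_def)
    then show ?thesis using min(1) by auto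
  qed
  define L where "L = (\<Sum>k<N. c k * exp (- eigenval k * t0) * (- eigenval k) * sine k x0)"
  have dt: "((\<lambda>t. V (t, x0)) has_real_derivative L + \<delta>) (at t0)"
    unfolding V_def U_def L_def by (auto intro!: derivative_eq_intros sum.cong simp: mult_ac)
  define W where "W y = (\<Sum>k<N. c k * exp (- eigenval k * t0) * (pi * (real k + 1) * cos (pi * (real k + 1) * y)))" for y
  have dx: "((\<lambda>y. V (t0, y)) has_real_derivative W y) (at y)" for y
    unfolding V_def U_def W_def sine_def by (auto intro!: derivative_eq_intros sum.cong simp: mult_ac)
  have dxx: "(W has_real_derivative L) (at x0)"
    unfolding W_def L_def sine_def eigenval_def
    by (auto intro!: derivative_eq_intros sum.cong simp: mult_ac power2_eq_square)
  \<comment> \<open>Only earlier times are compared, since the minimum may lie on the final line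
    \<open>t0 = r\<close>.\<close>
  have "L + \<delta> \<le> 0"
  proof (rule ccontr)
    assume "\<not> L + \<delta> \<le> 0"
    then obtain d where d: "d > 0" "\<And>h. 0 < h \<Longrightarrow> h < d \<Longrightarrow> V (t0 - h, x0) < V (t0, x0)"
      using DERIV_pos_inc_left[OF dt] by auto
    define h where "h = Min {d, t0} / 2"
    have "0 < h" "h < d" "h \<le> t0" using d t0 by (auto simp: h_def)
    then show False using d(2)[of h] min(1,2) min(3)[of "t0 - h" x0] by auto
  qed
  have W0: "W x0 = 0"
  proof (rule DERIV_local_min[OF dx])
    show "0 < Min {x0, 1 - x0}" using x0 by auto
    show "\<forall>y. \<bar>x0 - y\<bar> < Min {x0, 1 - x0} \<longrightarrow> V (t0, x0) \<le> V (t0, y)"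
      using min(1) by (auto intro!: min(3))
  qed
  \<comment> \<open>A negative second derivative would make \<open>W\<close> negative just to the
    right of its zero \<open>x0\<close>, and the mean value theorem would then produce a value of
    \<open>V\<close> below the minimum.\<close>
  have "L \<ge> 0"
  proof (rule ccontr)
    assume "\<not> L \<ge> 0"
    then obtain d where d: "d > 0" "\<And>h. 0 < h \<Longrightarrow> h < d \<Longrightarrow> W (x0 + h) < W x0"
      using DERIV_neg_dec_right[OF dxx] by auto
    define h where "h = Min {d, 1 - x0} / 2"
    have "h \<le> 1 - x0" using d x0 by (auto simp: h_def min_def)
    then have h: "0 < h" "h < d" "x0 + h \<le> 1" using d x0 by (auto simp: h_def)
    obtain \<xi> where \<xi>: "x0 < \<xi>" "\<xi> < x0 + h" "V (t0, x0 + h) - V (t0, x0) = (x0 + h - x0) * W \<xi>"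
      using MVT2[of x0 "x0 + h" "\<lambda>y. V (t0, y)" W] dx h by auto
    have "W \<xi> < 0" using d(2)[of "\<xi> - x0"] \<xi> h W0 by auto
    then have "h * W \<xi> < 0" using h by (simp add: mult_pos_neg)
    then have "V (t0, x0 + h) < V (t0, x0)" using \<xi>(3) by simp
    then show False using min(3)[of t0 "x0 + h"] min(1) h x0 by auto
  qed
  with \<open>L + \<delta> \<le> 0\<close> \<delta> show False by linarith
qed

section \<open>The heat equation with a bounded source\<close>

text \<open>For bounded \<open>\<gamma>\<close> and \<open>l > 0\<close> this is the bounded
  solution on the whole line of \<open>y' = \<gamma> - l * y\<close>, that is, Duhamel's formula
  started at minus infinity.\<close>

definition exp_conv :: "real \<Rightarrow> (real \<Rightarrow> real) \<Rightarrow> real \<Rightarrow> real" where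
  "exp_conv l \<gamma> t = (LINT r|lborel. indicator {0..} r * exp (- l * r) * \<gamma> (t - r))"

lemma exp_halfline:
  fixes l c :: real
  assumes "l > 0"
  shows "integrable lborel (\<lambda>r. indicator {c..} r * exp (- l * r))"
    and "(LINT r|lborel. indicator {c..} r * exp (- l * r)) = exp (- l * c) / l"
proof -
  have m: "(\<lambda>r. indicator {c..} r * exp (- l * r)) \<in> borel_measurable lborel" by measurable
  have abs: "set_integrable lebesgue {c..} (\<lambda>r. exp (- l * r))"
    using integrable_on_exp_minus_to_infinity[OF assms] by (intro nonnegative_absolutely_integrable_1) auto
  then show "integrable lborel (\<lambda>r. indicator {c..} r * exp (- l * r))"
    using integrable_completion[OF m] by (simp add: set_integrable_def)
  show "(LINT r|lborel. indicator {c..} r * exp (- l * r)) = exp (- l * c) / l"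
    using set_lebesgue_integral_eq_integral(2)[OF abs] integral_completion[OF m]
      integral_unique[OF has_integral_exp_minus_to_infinity[OF assms, of c]]
    by (simp add: set_lebesgue_integral_def)
qed

lemma integrable_exp_weight:
  fixes \<gamma> :: "real \<Rightarrow> real"
  assumes l: "l > 0" and A: "A \<in> sets borel" "A \<subseteq> {0..}"
    and \<gamma>: "\<gamma> \<in> borel_measurable borel" "\<And>r. \<bar>\<gamma> r\<bar> \<le> B"
  shows "integrable lborel (\<lambda>r. indicator A r * exp (- l * r) * \<gamma> r)"
proof (rule Bochner_Integration.integrable_bound)
  show "integrable lborel (\<lambda>r. (indicator {0..} r * exp (- l * r)) * B)"
    using exp_halfline(1)[OF l] by (intro integrable_mult_left)
  show "(\<lambda>r. indicator A r * exp (- l * r) * \<gamma> r) \<in> borel_measurable lborel"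
    using \<gamma> A by measurable
  have "\<bar>\<gamma> r\<bar> \<le> \<bar>B\<bar>" for r using \<gamma>(2)[of r] by linarith
  then show "AE r in lborel. norm (indicator A r * exp (- l * r) * \<gamma> r) \<le> norm (indicator {0..} r * exp (- l * r) * B)"
    using A(2) by (auto simp: abs_mult indicator_def intro!: AE_I2)
qed

lemma integrable_exp_conv:
  fixes \<gamma> :: "real \<Rightarrow> real"
  assumes "l > 0" "A \<in> sets borel" "A \<subseteq> {0..}" "\<gamma> \<in> borel_measurable borel" "\<And>r. \<bar>\<gamma> r\<bar> \<le> B"
  shows "integrable lborel (\<lambda>r. indicator A r * exp (- l * r) * \<gamma> (t - r))"
  using assms(4,5) by (intro integrable_exp_weight[OF assms(1-3), where B = B]) auto

lemma exp_conv_const: "l > 0 \<Longrightarrow> exp_conv l (\<lambda>_. c) t = c / l"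
  unfolding exp_conv_def using exp_halfline(2)[of l 0] by simp

lemma exp_conv_cmult: "exp_conv l (\<lambda>s. c * \<gamma> s) t = c * exp_conv l \<gamma> t"
  unfolding exp_conv_def by (simp add: mult_ac flip: integral_mult_right_zero)

lemma exp_conv_diff:
  fixes \<gamma> \<eta> :: "real \<Rightarrow> real"
  assumes "l > 0" "\<gamma> \<in> borel_measurable borel" "\<And>r. \<bar>\<gamma> r\<bar> \<le> B"
    "\<eta> \<in> borel_measurable borel" "\<And>r. \<bar>\<eta> r\<bar> \<le> C"
  shows "exp_conv l (\<lambda>s. \<gamma> s - \<eta> s) t = exp_conv l \<gamma> t - exp_conv l \<eta> t"
  unfolding exp_conv_def right_diff_distrib using assms
  by (intro Bochner_Integration.integral_diff integrable_exp_conv) auto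

lemma exp_conv_mono:
  fixes \<gamma> \<eta> :: "real \<Rightarrow> real"
  assumes "l > 0" "\<gamma> \<in> borel_measurable borel" "\<And>r. \<bar>\<gamma> r\<bar> \<le> B"
    "\<eta> \<in> borel_measurable borel" "\<And>r. \<bar>\<eta> r\<bar> \<le> C"
    and le: "\<And>r. r \<ge> 0 \<Longrightarrow> \<gamma> (t - r) \<le> \<eta> (t' - r)"
  shows "exp_conv l \<gamma> t \<le> exp_conv l \<eta> t'"
  unfolding exp_conv_def
proof (rule integral_mono)
  show "integrable lborel (\<lambda>r. indicator {0..} r * exp (- l * r) * \<gamma> (t - r))"
    by (rule integrable_exp_conv[OF assms(1) _ _ assms(2,3)]) auto
  show "integrable lborel (\<lambda>r. indicator {0..} r * exp (- l * r) * \<eta> (t' - r))"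
    by (rule integrable_exp_conv[OF assms(1) _ _ assms(4,5)]) auto
  show "indicator {0..} r * exp (- l * r) * \<gamma> (t - r) \<le> indicator {0..} r * exp (- l * r) * \<eta> (t' - r)" for r
    using le[of r] by (auto simp: indicator_def)
qed

lemma exp_conv_abs_le:
  fixes \<gamma> \<eta> :: "real \<Rightarrow> real"
  assumes "l > 0" "\<gamma> \<in> borel_measurable borel" "\<And>r. \<bar>\<gamma> r\<bar> \<le> B"
    "\<eta> \<in> borel_measurable borel" "\<And>r. \<bar>\<eta> r\<bar> \<le> C"
    and le: "\<And>r. r \<ge> 0 \<Longrightarrow> \<bar>\<gamma> (t - r)\<bar> \<le> \<eta> (t' - r)"
  shows "\<bar>exp_conv l \<gamma> t\<bar> \<le> exp_conv l \<eta> t'"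
proof -
  have "exp_conv l \<gamma> t \<le> exp_conv l \<eta> t'"
    using assms by (intro exp_conv_mono[where B = B and C = C]) (auto intro: order_trans[OF abs_ge_self])
  moreover have "exp_conv l (\<lambda>s. (-1) * \<gamma> s) t \<le> exp_conv l \<eta> t'"
    using assms by (intro exp_conv_mono[where B = B and C = C]) (auto intro: order_trans[OF abs_ge_minus_self])
  ultimately show ?thesis by (simp only: exp_conv_cmult)
qed

lemma exp_conv_bound:
  fixes \<gamma> :: "real \<Rightarrow> real"
  assumes "l > 0" "\<gamma> \<in> borel_measurable borel" "\<And>r. \<bar>\<gamma> r\<bar> \<le> B"
  shows "\<bar>exp_conv l \<gamma> t\<bar> \<le> B / l"
  using exp_conv_abs_le[OF assms, of "\<lambda>_. B" "\<bar>B\<bar>" t t] assms exp_conv_const[of l B] by auto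

text \<open>Variation of constants from \<open>t\<close> to \<open>t + h\<close>: the history is
  split at \<open>r = h\<close>, and translating its older part by \<open>h\<close> produces the
  factor \<open>exp (- l * h)\<close>.\<close>

lemma exp_conv_restart:
  fixes \<gamma> :: "real \<Rightarrow> real"
  assumes l: "l > 0" and \<gamma>: "\<gamma> \<in> borel_measurable borel" "\<And>r. \<bar>\<gamma> r\<bar> \<le> B" and h: "h \<ge> 0"
  shows "exp_conv l \<gamma> (t + h) =
    exp (- l * h) * exp_conv l \<gamma> t + (LINT r|lborel. indicator {0..<h} r * exp (- l * r) * \<gamma> (t + h - r))"
proof -
  have split: "indicator {0..} r * exp (- l * r) * \<gamma> (t + h - r) =
     indicator {h..} r * exp (- l * r) * \<gamma> (t + h - r) + indicator {0..<h} r * exp (- l * r) * \<gamma> (t + h - r)" for r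
    using h by (auto simp: indicator_def)
  have "exp_conv l \<gamma> (t + h) = (LINT r|lborel. indicator {h..} r * exp (- l * r) * \<gamma> (t + h - r)) +
     (LINT r|lborel. indicator {0..<h} r * exp (- l * r) * \<gamma> (t + h - r))"
    unfolding exp_conv_def split using h
    by (intro Bochner_Integration.integral_add integrable_exp_conv[OF l _ _ \<gamma>]) auto
  also have "(LINT r|lborel. indicator {h..} r * exp (- l * r) * \<gamma> (t + h - r)) =
     (LINT r|lborel. exp (- l * h) * (indicator {0..} r * exp (- l * r) * \<gamma> (t - r)))"
    by (subst lborel_integral_real_affine[of 1 _ h])
       (auto intro!: Bochner_Integration.integral_cong simp: indicator_def exp_add[symmetric] algebra_simps)
  finally show ?thesis by (simp add: exp_conv_def)
qed

lemma integral_exp_window_bound: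
  fixes \<gamma> :: "real \<Rightarrow> real"
  assumes l: "l > 0" and \<gamma>: "\<gamma> \<in> borel_measurable borel" "\<And>r. \<bar>\<gamma> r\<bar> \<le> B" and h: "h \<ge> 0"
    and C: "\<And>s. t - h \<le> s \<Longrightarrow> s \<le> t \<Longrightarrow> \<bar>\<gamma> s\<bar> \<le> C"
  shows "\<bar>LINT r|lborel. indicator {0..<h} r * exp (- l * r) * \<gamma> (t - r)\<bar> \<le> C * h"
proof -
  have "C \<ge> 0" using C[of t] h by force
  have "\<bar>LINT r|lborel. indicator {0..<h} r * exp (- l * r) * \<gamma> (t - r)\<bar> \<le>
      (LINT r|lborel. indicator {0..<h} r * C)"
  proof (rule integral_abs_bound[THEN order_trans], rule integral_mono)
    show "integrable lborel (\<lambda>r. \<bar>indicator {0..<h} r * exp (- l * r) * \<gamma> (t - r)\<bar>)"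
      by (intro integrable_abs integrable_exp_conv[OF l _ _ \<gamma>]) auto
    show "integrable lborel (\<lambda>r. indicator {0..<h} r * C)"
      by (intro integrable_mult_left) (simp add: h)
    show "\<bar>indicator {0..<h} r * exp (- l * r) * \<gamma> (t - r)\<bar> \<le> indicator {0..<h} r * C" for r
    proof (cases "r \<in> {0..<h}")
      case True
      have "exp (- l * r) * \<bar>\<gamma> (t - r)\<bar> \<le> 1 * C"
        using True l C[of "t - r"] \<open>C \<ge> 0\<close> by (intro mult_mono) auto
      then show ?thesis using True by (simp add: abs_mult)
    qed auto
  qed
  also have "\<dots> = C * h" using h by simp
  finally show ?thesis .
qed

text \<open>The loss of the old part, at most \<open>(l * h) * (B / l)\<close>, and the new part
  each contribute at most \<open>B * h\<close>; since \<open>l\<close> cancels, the Lipschitz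
  constant is the same for all modes.\<close>

lemma exp_conv_Lipschitz_aux:
  fixes \<gamma> :: "real \<Rightarrow> real"
  assumes l: "l > 0" and \<gamma>: "\<gamma> \<in> borel_measurable borel" "\<And>r. \<bar>\<gamma> r\<bar> \<le> B" and h: "h \<ge> 0"
  shows "\<bar>exp_conv l \<gamma> (t + h) - exp_conv l \<gamma> t\<bar> \<le> 2 * B * h"
proof -
  have "B \<ge> 0" using \<gamma>(2)[of 0] by linarith
  have e: "1 - exp (- l * h) \<le> l * h" "exp (- l * h) \<le> 1"
    using exp_ge_add_one_self[of "- l * h"] l h by auto
  have "\<bar>LINT r|lborel. indicator {0..<h} r * exp (- l * r) * \<gamma> (t + h - r)\<bar> \<le> B * h"
    using \<gamma>(2) by (intro integral_exp_window_bound[OF l \<gamma> h])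
  moreover have "\<bar>(1 - exp (- l * h)) * exp_conv l \<gamma> t\<bar> \<le> (l * h) * (B / l)"
    unfolding abs_mult using e l h \<open>B \<ge> 0\<close> exp_conv_bound[OF l \<gamma>] by (intro mult_mono) auto
  moreover have "exp_conv l \<gamma> (t + h) - exp_conv l \<gamma> t = - ((1 - exp (- l * h)) * exp_conv l \<gamma> t) +
     (LINT r|lborel. indicator {0..<h} r * exp (- l * r) * \<gamma> (t + h - r))"
    unfolding exp_conv_restart[OF l \<gamma> h] by (simp add: algebra_simps)
  moreover have "(l * h) * (B / l) = B * h" using l by simp
  ultimately show ?thesis by linarith
qed

lemma exp_conv_Lipschitz:
  fixes \<gamma> :: "real \<Rightarrow> real"
  assumes l: "l > 0" and \<gamma>: "\<gamma> \<in> borel_measurable borel" "\<And>r. \<bar>\<gamma> r\<bar> \<le> B"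
  shows "\<bar>exp_conv l \<gamma> t - exp_conv l \<gamma> s\<bar> \<le> 2 * B * \<bar>t - s\<bar>"
proof (cases "s \<le> t")
  case True
  then show ?thesis using exp_conv_Lipschitz_aux[OF assms, of "t - s" s] by simp
next
  case False
  then show ?thesis using exp_conv_Lipschitz_aux[OF assms, of "s - t" t] by (simp add: abs_minus_commute)
qed

lemma exp_conv_continuous:
  fixes \<gamma> :: "real \<Rightarrow> real"
  assumes l: "l > 0" and \<gamma>: "\<gamma> \<in> borel_measurable borel" "\<And>r. \<bar>\<gamma> r\<bar> \<le> B"
  shows "isCont (exp_conv l \<gamma>) t"
proof -
  have "((\<lambda>s. 2 * B * \<bar>s - t\<bar>) \<longlongrightarrow> 2 * B * \<bar>t - t\<bar>) (at t)"
    by (intro tendsto_intros)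
  then have lim: "((\<lambda>s. 2 * B * \<bar>s - t\<bar>) \<longlongrightarrow> 0) (at t)" by simp
  have "((\<lambda>s. exp_conv l \<gamma> s - exp_conv l \<gamma> t) \<longlongrightarrow> 0) (at t)"
    by (rule Lim_null_comparison[OF always_eventually lim]) (simp add: exp_conv_Lipschitz[OF assms])
  then show ?thesis unfolding isCont_def by (rule Lim_null[THEN iffD2])
qed

section \<open>Absolutely convergent sine series\<close>

lemma summable_inverse_eigenval: "summable (\<lambda>k. c / eigenval k)"
proof -
  have "summable (\<lambda>k. c / pi\<^sup>2 * inverse (real (Suc k) ^ 2))"
    using inverse_power_summable[of 2, where 'a = real] summable_Suc_iff[of "\<lambda>k. inverse (real k ^ 2)"]
    by (intro summable_mult) (simp del: of_nat_Suc)
  moreover have "c / pi\<^sup>2 * inverse (real (Suc k) ^ 2) = c / eigenval k" for k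
    by (simp add: eigenval_def power_mult_distrib divide_simps add.commute)
  ultimately show ?thesis by (simp only: )
qed

lemma
  assumes c: "summable (\<lambda>k. \<bar>c k\<bar>)"
  shows sine_series_summable: "summable (\<lambda>k. c k * sine k x)"
    and sine_series_continuous: "continuous_on A (\<lambda>x. \<Sum>k. c k * sine k x)"
    and sine_series_bound: "\<bar>\<Sum>k. c k * sine k x\<bar> \<le> (\<Sum>k. \<bar>c k\<bar>)"
    and sine_series_coeff: "sine_coeff (\<lambda>x. \<Sum>k. c k * sine k x) j = c j"
proof -
  have le: "\<bar>c k * sine k x\<bar> \<le> \<bar>c k\<bar>" for k x
    using mult_left_mono[OF abs_sine_le_1[of k x], of "\<bar>c k\<bar>"] by (simp add: abs_mult)
  have sa: "summable (\<lambda>k. \<bar>c k * sine k x\<bar>)" for x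
    by (rule summable_comparison_test'[OF c]) (use le in auto)
  then show s: "summable (\<lambda>k. c k * sine k x)" for x by (rule summable_rabs_cancel)
  show "\<bar>\<Sum>k. c k * sine k x\<bar> \<le> (\<Sum>k. \<bar>c k\<bar>)"
    using summable_rabs[OF sa] suminf_le[OF le sa c] by (rule order_trans)
  have "uniform_limit A (\<lambda>n x. \<Sum>k<n. c k * sine k x) (\<lambda>x. \<Sum>k. c k * sine k x) sequentially"
    using le by (intro Weierstrass_m_test[OF _ c]) auto
  then show "continuous_on A (\<lambda>x. \<Sum>k. c k * sine k x)"
    by (rule uniform_limit_theorem[rotated]) (auto intro!: always_eventually continuous_intros)
  have int: "integrable I01 (\<lambda>x. c k * sine k x * sine j x)" for k
    by (intro integrable_I01_continuous continuous_intros)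
  have le2: "\<bar>c k * sine k x * sine j x\<bar> \<le> \<bar>c k\<bar>" for k x
    using mult_mono[OF le[of k x] abs_sine_le_1[of j x]] by (simp add: abs_mult)
  have "(LINT x|I01. (\<Sum>k. c k * sine k x) * sine j x) = (LINT x|I01. (\<Sum>k. c k * sine k x * sine j x))"
    using suminf_mult2[OF s] by simp
  also have "\<dots> = (\<Sum>k. LINT x|I01. c k * sine k x * sine j x)"
  proof (rule integral_suminf[OF int])
    show "AE x in I01. summable (\<lambda>k. norm (c k * sine k x * sine j x))"
      by (intro AE_I2 summable_comparison_test'[OF c]) (use le2 in auto)
    show "summable (\<lambda>k. LINT x|I01. norm (c k * sine k x * sine j x))"
    proof (rule summable_comparison_test'[OF c])
      fix k
      have "(LINT x|I01. norm (c k * sine k x * sine j x)) \<le> (LINT x|I01. \<bar>c k\<bar>)"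
        using int le2 by (intro integral_mono) auto
      then show "norm (LINT x|I01. norm (c k * sine k x * sine j x)) \<le> \<bar>c k\<bar>"
        by simp
    qed
  qed
  also have "\<dots> = (\<Sum>k. if k = j then c j / 2 else 0)"
    by (auto simp: mult.assoc integral_sine_sine intro!: suminf_cong)
  also have "\<dots> = c j / 2"
    using sums_If_finite_set[of "{j}" "\<lambda>_. c j / 2"] by (simp add: sums_iff)
  finally show "sine_coeff (\<lambda>x. \<Sum>k. c k * sine k x) j = c j"
    by (simp add: sine_coeff_def)
qed

section \<open>Bounded sources, the solutions they drive, and comparison\<close>

definition source :: "real \<Rightarrow> (real \<Rightarrow> real \<Rightarrow> real) \<Rightarrow> bool" where
  "source B g \<longleftrightarrow> (\<lambda>(t, x). g t x) \<in> borel_measurable (borel \<Otimes>\<^sub>M borel) \<and> (\<forall>t x. \<bar>g t x\<bar> \<le> B)"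

definition heat_coeff :: "(real \<Rightarrow> real \<Rightarrow> real) \<Rightarrow> nat \<Rightarrow> real \<Rightarrow> real" where
  "heat_coeff g k = exp_conv (eigenval k) (\<lambda>s. sine_coeff (g s) k)"

text \<open>The solution is driven by the source over the whole past. An initial datum \<open>z\<close> at time \<open>0\<close> is
  prescribed by the stationary source \<open>- z''\<close> for negative times, so no initial-value term is needed.\<close>

definition heat_sol :: "(real \<Rightarrow> real \<Rightarrow> real) \<Rightarrow> real \<Rightarrow> real \<Rightarrow> real" where
  "heat_sol g t x = (\<Sum>k. heat_coeff g k t * sine k x)"

context
  fixes B :: real and g :: "real \<Rightarrow> real \<Rightarrow> real"
  assumes g: "source B g"
begin

lemma source_bound: "\<bar>g t x\<bar> \<le> B" and source_nonneg: "B \<ge> 0"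
  using g by (auto simp: source_def) (meson abs_ge_zero order_trans)

lemma source_measurable: "(\<lambda>(t, x). g t x) \<in> borel_measurable (borel \<Otimes>\<^sub>M borel)"
  using g by (simp add: source_def)

lemma source_slice: "g t \<in> borel_measurable borel"
  using measurable_compose[OF measurable_Pair1' source_measurable, of t] by simp

lemma source_slice_I01: "g t \<in> borel_measurable I01"
  by (intro borel_imp_I01 source_slice)

lemma source_integrable: "integrable I01 (g t)"
  by (rule integrable_I01_bounded[OF source_slice_I01 source_bound])

lemma source_coeff_bound: "\<bar>sine_coeff (g t) k\<bar> \<le> 2 * B"
proof -
  have "\<bar>LINT x|I01. g t x * sine k x\<bar> \<le> (LINT x|I01. B)"
  proof (rule integral_abs_bound[THEN order_trans], rule integral_mono)
    show "\<bar>g t x * sine k x\<bar> \<le> B" for x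
      using mult_mono[OF source_bound[of t x] abs_sine_le_1[of k x]] source_nonneg by (simp add: abs_mult)
  qed (auto intro!: integrable_times_sine source_integrable integrable_abs)
  then show ?thesis by (simp add: sine_coeff_def)
qed

lemma source_coeff_measurable: "(\<lambda>t. sine_coeff (g t) k) \<in> borel_measurable borel"
proof -
  have "(\<lambda>(t, x). g t x) \<circ> (\<lambda>z. (fst z, snd z)) \<in> borel_measurable (borel \<Otimes>\<^sub>M I01)"
  proof (rule measurable_comp[OF _ source_measurable])
    show "(\<lambda>z. (fst z, snd z)) \<in> borel \<Otimes>\<^sub>M I01 \<rightarrow>\<^sub>M borel \<Otimes>\<^sub>M borel"
      using measurable_compose[OF measurable_snd measurable_ident_I01] by (intro measurable_Pair) auto
  qed
  then have [measurable]: "(\<lambda>z. g (fst z) (snd z)) \<in> borel_measurable (borel \<Otimes>\<^sub>M I01)"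
    by (simp add: comp_def case_prod_beta)
  have [measurable]: "(\<lambda>z. sine k (snd z)) \<in> borel_measurable (borel \<Otimes>\<^sub>M I01)"
    by (rule measurable_compose[OF measurable_snd borel_imp_I01[OF sine_measurable]])
  show ?thesis unfolding sine_coeff_def
    by (intro borel_measurable_times I01.borel_measurable_lebesgue_integral) (simp_all add: case_prod_beta)
qed

lemma heat_coeff_bound: "\<bar>heat_coeff g k t\<bar> \<le> 2 * B / eigenval k"
  unfolding heat_coeff_def by (intro exp_conv_bound source_coeff_bound source_coeff_measurable) simp

lemma heat_coeff_Lipschitz: "\<bar>heat_coeff g k t - heat_coeff g k s\<bar> \<le> 4 * B * \<bar>t - s\<bar>"
  unfolding heat_coeff_def
  using exp_conv_Lipschitz[of "eigenval k" "\<lambda>s. sine_coeff (g s) k" "2 * B" t s] source_coeff_bound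
    source_coeff_measurable by simp

lemma heat_coeff_summable: "summable (\<lambda>k. \<bar>heat_coeff g k t\<bar>)"
  by (rule summable_comparison_test'[OF summable_inverse_eigenval[of "2 * B"]])
     (use heat_coeff_bound in auto)

lemma heat_sol_continuous: "continuous_on A (heat_sol g t)"
  unfolding heat_sol_def by (intro sine_series_continuous heat_coeff_summable)

lemma heat_sol_coeff: "sine_coeff (heat_sol g t) k = heat_coeff g k t"
  unfolding heat_sol_def by (intro sine_series_coeff heat_coeff_summable)

lemma heat_sol_bound: "\<bar>heat_sol g t x\<bar> \<le> (\<Sum>k. 2 * B / eigenval k)"
  unfolding heat_sol_def
  by (rule order_trans[OF sine_series_bound[OF heat_coeff_summable]])
     (intro suminf_le heat_coeff_bound heat_coeff_summable summable_inverse_eigenval)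

lemma heat_sol_integrable: "integrable I01 (heat_sol g t)"
  by (intro integrable_I01_continuous heat_sol_continuous)

lemma heat_sol_measurable: "(\<lambda>(t, x). heat_sol g t x) \<in> borel_measurable (borel \<Otimes>\<^sub>M borel)"
proof -
  have [measurable]: "heat_coeff g k \<in> borel_measurable borel" for k
    unfolding heat_coeff_def
    using exp_conv_continuous[OF eigenval_pos source_coeff_measurable source_coeff_bound]
    by (intro borel_measurable_continuous_onI continuous_at_imp_continuous_on ballI)
  show ?thesis unfolding heat_sol_def by measurable
qed

lemma heat_sol_shift: "heat_sol (\<lambda>s. g (s + h)) t x = heat_sol g (t + h) x"
  by (simp add: heat_sol_def heat_coeff_def exp_conv_def algebra_simps)

lemma source_shift: "source B (\<lambda>s. g (s + h))"
proof -
  note [measurable] = source_measurable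
  show ?thesis unfolding source_def using source_bound by simp
qed

end

text \<open>Positivity is tested against nonnegative sine polynomials, on which the heat semigroup acts by
  an explicit finite sum.\<close>

lemma heat_nonneg:
  assumes h: "continuous_on {0<..<1} h" "integrable I01 h"
    and h0: "integrable I01 h0" "\<And>x. x \<in> {0<..<1} \<Longrightarrow> 0 \<le> h0 x"
    and G: "source B G" "\<And>r x. r \<in> A \<Longrightarrow> x \<in> {0<..<1} \<Longrightarrow> 0 \<le> G r x"
    and A: "A \<in> sets borel" "A \<subseteq> {0..}" and \<tau>: "\<tau> \<ge> 0"
    and coeff: "\<And>k. sine_coeff h k =
       (LINT r|lborel. indicator A r * exp (- eigenval k * r) * sine_coeff (G r) k) +
       exp (- eigenval k * \<tau>) * sine_coeff h0 k"
    and x: "x \<in> {0<..<1}"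
  shows "0 \<le> h x"
proof (rule AE_nonneg_continuous[OF h(1) sine_coeff_nonneg_AE[OF h(2)] x])
  fix c :: "nat \<Rightarrow> real" and N :: nat
  assume pos: "\<And>x. x \<in> {0..1} \<Longrightarrow> 0 \<le> (\<Sum>k<N. c k * sine k x)"
  \<comment> \<open>The heat semigroup is symmetric, so it is moved from \<open>f\<close> onto the
    nonnegative test polynomial, where \<open>sine_heat_nonneg\<close> applies.\<close>
  have semi: "0 \<le> (\<Sum>k<N. c k * exp (- eigenval k * r) * sine_coeff f k)"
    if f: "integrable I01 f" "\<And>x. x \<in> {0<..<1} \<Longrightarrow> 0 \<le> f x" and r: "r \<ge> 0" for f r
  proof -
    have "0 \<le> (LINT x|I01. f x * (\<Sum>k<N. (c k * exp (- eigenval k * r)) * sine k x))"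
      using f(2) sine_heat_nonneg[OF pos r] by (intro integral_nonneg_AE AE_I2) auto
    then show ?thesis unfolding integral_times_sine_sum[OF f(1)] by simp
  qed
  have int: "integrable lborel (\<lambda>r. c k * (indicator A r * exp (- eigenval k * r) * sine_coeff (G r) k))" for k
    by (intro integrable_mult_right integrable_exp_weight[OF _ A, where B = "2 * B"]
        source_coeff_measurable[OF G(1)] source_coeff_bound[OF G(1)]) auto
  have "(\<Sum>k<N. c k * sine_coeff h k) =
     (LINT r|lborel. (\<Sum>k<N. c k * (indicator A r * exp (- eigenval k * r) * sine_coeff (G r) k))) +
     (\<Sum>k<N. c k * exp (- eigenval k * \<tau>) * sine_coeff h0 k)"
    unfolding coeff distrib_left sum.distrib
    by (subst Bochner_Integration.integral_sum) (use int in \<open>auto simp: mult.assoc\<close>)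
  moreover have "0 \<le> (LINT r|lborel. (\<Sum>k<N. c k * (indicator A r * exp (- eigenval k * r) * sine_coeff (G r) k)))"
  proof (intro integral_nonneg_AE AE_I2)
    fix r
    show "0 \<le> (\<Sum>k<N. c k * (indicator A r * exp (- eigenval k * r) * sine_coeff (G r) k))"
    proof (cases "r \<in> A")
      case True
      then have "0 \<le> (\<Sum>k<N. c k * exp (- eigenval k * r) * sine_coeff (G r) k)"
        using G(2) A(2) by (intro semi source_integrable[OF G(1)]) auto
      then show ?thesis using True by (simp add: mult.assoc)
    qed simp
  qed
  ultimately show "0 \<le> (\<Sum>k<N. c k * sine_coeff h k)"
    using semi[OF h0 \<tau>] by simp
qed

text \<open>The affine time arguments accommodate the reversal of time in the history integrals,
  where the source is read at \<open>t - r\<close>.\<close>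

lemma source_diff:
  assumes "source B g" "source C k"
  shows "source (B + C) (\<lambda>r. \<lambda>x. g (t + c * r) x - k (s + d * r) x)"
proof -
  have [measurable]: "(\<lambda>(t, x). g t x) \<in> borel_measurable (borel \<Otimes>\<^sub>M borel)"
      "(\<lambda>(t, x). k t x) \<in> borel_measurable (borel \<Otimes>\<^sub>M borel)"
    using assms unfolding source_def by blast+
  have "\<bar>g (t + c * r) x - k (s + d * r) x\<bar> \<le> B + C" for r x
    using source_bound[OF assms(1), of "t + c * r" x] source_bound[OF assms(2), of "s + d * r" x] by linarith
  then show ?thesis by (auto simp: source_def)
qed

text \<open>The difference of the solutions is the history integral of a nonnegative source over all
  of \<open>{0..}\<close>, so the initial part of \<open>heat_nonneg\<close> is taken to be
  0.\<close>

lemma heat_sol_mono: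
  assumes g: "source B g" "source C g'"
    and le: "\<And>s x. s \<le> t \<Longrightarrow> x \<in> {0<..<1} \<Longrightarrow> g s x \<le> g' s x" and x: "x \<in> {0<..<1}"
  shows "heat_sol g t x \<le> heat_sol g' t x"
proof -
  have "0 \<le> heat_sol g' t x - heat_sol g t x"
  proof (rule heat_nonneg[where A = "{0..}" and \<tau> = 0 and ?h0.0 = "\<lambda>_. 0" and x = x])
    show "continuous_on {0<..<1} (\<lambda>x. heat_sol g' t x - heat_sol g t x)"
      by (intro continuous_on_diff heat_sol_continuous[OF g(1)] heat_sol_continuous[OF g(2)])
    show "integrable I01 (\<lambda>x. heat_sol g' t x - heat_sol g t x)"
      by (intro Bochner_Integration.integrable_diff heat_sol_integrable[OF g(1)] heat_sol_integrable[OF g(2)])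
    show "source (C + B) (\<lambda>r x. g' (t + (-1) * r) x - g (t + (-1) * r) x)"
      by (rule source_diff[OF g(2,1)])
    fix k
    have i: "integrable lborel (\<lambda>r. indicator {0..} r * exp (- eigenval k * r) * sine_coeff (g (t - r)) k)"
            "integrable lborel (\<lambda>r. indicator {0..} r * exp (- eigenval k * r) * sine_coeff (g' (t - r)) k)"
      using integrable_exp_conv[OF eigenval_pos _ _ source_coeff_measurable[OF g(1)] source_coeff_bound[OF g(1)], of "{0..}"]
        integrable_exp_conv[OF eigenval_pos _ _ source_coeff_measurable[OF g(2)] source_coeff_bound[OF g(2)], of "{0..}"]
      by auto
    show "sine_coeff (\<lambda>x. heat_sol g' t x - heat_sol g t x) k =
       (LINT r|lborel. indicator {0..} r * exp (- eigenval k * r) * sine_coeff (\<lambda>x. g' (t + (-1) * r) x - g (t + (-1) * r) x) k) +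
       exp (- eigenval k * 0) * sine_coeff (\<lambda>_. 0) k"
      using Bochner_Integration.integral_diff[OF i(2,1)]
      by (simp add: sine_coeff_diff heat_sol_integrable[OF g(1)] heat_sol_integrable[OF g(2)]
        source_integrable[OF g(1)] source_integrable[OF g(2)] heat_sol_coeff[OF g(1)] heat_sol_coeff[OF g(2)]
        heat_coeff_def exp_conv_def right_diff_distrib) (simp add: sine_coeff_def)
  qed (use le x in auto)
  then show ?thesis by simp
qed

lemma heat_coeff_stationary: "heat_coeff (\<lambda>_. p) k t = sine_coeff p k / eigenval k"
  by (simp add: heat_coeff_def exp_conv_const)

text \<open>This is how explicit profiles enter: if \<open>z\<close> solves the stationary problem
  with source \<open>p\<close>, tested on sine coefficients, then the constant history
  \<open>p\<close> holds the solution at \<open>z\<close>. Equality of coefficients gives equality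
  almost everywhere, and continuity removes the null set.\<close>

lemma heat_sol_stationary:
  assumes p: "source B (\<lambda>_. p)" and z: "continuous_on {0..1} z"
    and c: "\<And>k. sine_coeff z k = sine_coeff p k / eigenval k" and x: "x \<in> {0<..<1}"
  shows "heat_sol (\<lambda>_. p) t x = z x"
proof -
  have i: "integrable I01 z" by (rule integrable_I01_continuous[OF z])
  have co: "continuous_on {0<..<1} z" by (rule continuous_on_subset[OF z]) auto
  have ae: "AE x in I01. heat_sol (\<lambda>_. p) t x = z x"
    by (rule sine_coeff_unique_AE[OF heat_sol_integrable[OF p] i])
       (simp add: heat_sol_coeff[OF p] heat_coeff_stationary c)
  have "0 \<le> heat_sol (\<lambda>_. p) t x - z x"
    by (rule AE_nonneg_continuous[OF _ _ x])
       (auto intro!: continuous_on_diff heat_sol_continuous[OF p] co intro: eventually_mono[OF ae])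
  moreover have "0 \<le> z x - heat_sol (\<lambda>_. p) t x"
    by (rule AE_nonneg_continuous[OF _ _ x])
       (auto intro!: continuous_on_diff heat_sol_continuous[OF p] co intro: eventually_mono[OF ae])
  ultimately show ?thesis by linarith
qed

lemma suminf_tendsto_dominated:
  fixes a :: "nat \<Rightarrow> 'b \<Rightarrow> real"
  assumes "\<And>k. ((\<lambda>n. a k n) \<longlongrightarrow> b k) F" "\<forall>\<^sub>F n in F. \<forall>k. \<bar>a k n\<bar> \<le> M k" "summable M"
  shows "((\<lambda>n. \<Sum>k. a k n) \<longlongrightarrow> (\<Sum>k. b k)) F"
proof (cases "F = bot")
  case False
  have "\<forall>\<^sub>F (k, n) in sequentially \<times>\<^sub>F F. norm (a k n) \<le> M k"
    using eventually_prodI[OF always_eventually[of "\<lambda>_. True" sequentially] assms(2)]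
    by (auto elim!: eventually_mono)
  from tannerys_theorem[OF assms(1) this assms(3) False] show ?thesis by simp
qed simp

text \<open>Three nested dominated limits, in space, along the history and over the modes, with
  majorants that depend on \<open>B\<close> only.\<close>

lemma heat_sol_tendsto:
  assumes gj: "\<And>j. source B (gj j)" and g: "source B g"
    and lim: "\<And>s x. s \<le> t \<Longrightarrow> x \<in> {0<..<1} \<Longrightarrow> (\<lambda>j. gj j s x) \<longlonglongrightarrow> g s x"
  shows "(\<lambda>j. heat_sol (gj j) t x) \<longlonglongrightarrow> heat_sol g t x"
proof -
  have sc: "(\<lambda>j. sine_coeff (gj j s) k) \<longlonglongrightarrow> sine_coeff (g s) k" if "s \<le> t" for s k
    unfolding sine_coeff_def
  proof (intro tendsto_mult tendsto_const integral_I01_tendsto[where w = "\<lambda>_. B"])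
    show "(\<lambda>x. gj j s x * sine k x) \<in> borel_measurable I01" for j
      using integrable_times_sine[OF source_integrable[OF gj]] by (rule borel_measurable_integrable)
    show "(\<lambda>x. g s x * sine k x) \<in> borel_measurable I01"
      using integrable_times_sine[OF source_integrable[OF g]] by (rule borel_measurable_integrable)
    show "AE x in I01. (\<lambda>j. gj j s x * sine k x) \<longlonglongrightarrow> g s x * sine k x"
      using lim[OF that] by (intro AE_I2 tendsto_intros) auto
    show "\<bar>gj j s x * sine k x\<bar> \<le> B" for j x
      using mult_mono[OF source_bound[OF gj, of j s x] abs_sine_le_1[of k x]] source_nonneg[OF g]
      by (simp add: abs_mult)
  qed simp
  have hc: "(\<lambda>j. heat_coeff (gj j) k t) \<longlonglongrightarrow> heat_coeff g k t" for k
    unfolding heat_coeff_def exp_conv_def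
  proof (rule integral_dominated_convergence[where w = "\<lambda>r. indicator {0..} r * exp (- eigenval k * r) * (2 * B)"
        and s = "\<lambda>j r. indicator {0..} r * exp (- eigenval k * r) * sine_coeff (gj j (t - r)) k"
        and f = "\<lambda>r. indicator {0..} r * exp (- eigenval k * r) * sine_coeff (g (t - r)) k"])
    show "(\<lambda>r. indicator {0..} r * exp (- eigenval k * r) * sine_coeff (g (t - r)) k) \<in> borel_measurable lborel"
      using measurable_compose[OF _ source_coeff_measurable[OF g], of "\<lambda>r. t - r" lborel k] by simp
    show "(\<lambda>r. indicator {0..} r * exp (- eigenval k * r) * sine_coeff (gj j (t - r)) k) \<in> borel_measurable lborel" for j
      using measurable_compose[OF _ source_coeff_measurable[OF gj[of j]], of "\<lambda>r. t - r" lborel k] by simp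
    show "integrable lborel (\<lambda>r. indicator {0..} r * exp (- eigenval k * r) * (2 * B))"
      by (intro integrable_mult_left exp_halfline) simp
    show "AE r in lborel. (\<lambda>j. indicator {0..} r * exp (- eigenval k * r) * sine_coeff (gj j (t - r)) k)
        \<longlonglongrightarrow> indicator {0..} r * exp (- eigenval k * r) * sine_coeff (g (t - r)) k"
    proof (intro AE_I2)
      fix r :: real
      show "(\<lambda>j. indicator {0..} r * exp (- eigenval k * r) * sine_coeff (gj j (t - r)) k)
        \<longlonglongrightarrow> indicator {0..} r * exp (- eigenval k * r) * sine_coeff (g (t - r)) k"
        by (cases "r \<ge> 0") (auto intro!: tendsto_intros sc)
    qed
    show "AE r in lborel. norm (indicator {0..} r * exp (- eigenval k * r) * sine_coeff (gj j (t - r)) k)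
        \<le> indicator {0..} r * exp (- eigenval k * r) * (2 * B)" for j
      using source_coeff_bound[OF gj, of j] by (auto simp: abs_mult indicator_def intro!: AE_I2 mult_left_mono)
  qed
  show ?thesis unfolding heat_sol_def
  proof (rule suminf_tendsto_dominated[OF _ _ summable_inverse_eigenval[of "2 * B"]])
    show "(\<lambda>j. heat_coeff (gj j) k t * sine k x) \<longlonglongrightarrow> heat_coeff g k t * sine k x" for k
      by (intro tendsto_intros hc)
    have "\<bar>heat_coeff (gj j) k t * sine k x\<bar> \<le> 2 * B / eigenval k" for j k
      using mult_mono[OF heat_coeff_bound[OF gj, of j k t] abs_sine_le_1[of k x]]
      by (simp add: abs_mult source_nonneg[OF g] less_imp_le)
    then show "\<forall>\<^sub>F j in sequentially. \<forall>k. \<bar>heat_coeff (gj j) k t * sine k x\<bar> \<le> 2 * B / eigenval k" by simp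
  qed
qed

lemma exp_conv_alt:
  "exp_conv l \<gamma> t = (LINT s|lborel. indicator {..t} s * exp (- l * (t - s)) * \<gamma> s)"
  unfolding exp_conv_def
  by (subst (2) lborel_integral_real_affine[of "-1" _ t])
     (auto intro!: Bochner_Integration.integral_cong simp: indicator_def)

section \<open>Regularity in time\<close>

text \<open>The increments over \<open>[t - 2\<^sup>-\<^sup>j, t + 2\<^sup>-\<^sup>j]\<close>, weighted by \<open>2\<^bsup>3j/4\<^esup>\<close>, have a summable integral.\<close>

lemma mono_AE_Hoelder_below:
  fixes m :: "real \<Rightarrow> real"
  assumes m: "mono m" "\<And>t. \<bar>m t\<bar> \<le> M"
  shows "AE t in lborel. t < N \<longrightarrow> (\<exists>C. \<forall>j. m (t + 2 powr - real j) - m (t - 2 powr - real j) \<le> C * 2 powr (- (3/4) * real j))"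
proof -
  define d where "d j = 2 powr - real j" for j
  have d: "d j > 0" for j by (simp add: d_def)
  have mb [measurable]: "m \<in> borel_measurable borel"
    using m(1) by (rule borel_measurable_mono)
  \<comment> \<open>The exponential weight turns the integral over \<open>t\<close> into a
    difference of two values of \<open>exp_conv 1 m\<close>, whose Lipschitz bound supplies the
    factor \<open>d j = 2 powr - real j\<close>; against the weight
    \<open>2 powr ((3/4) * real j)\<close> a geometric term of ratio \<open>2 powr - (1/4)\<close>
    remains.\<close>
  define f where "f j t = indicator {..N} t * exp (- 1 * (N - t)) * (2 powr ((3/4) * real j) * (m (t + d j) - m (t - d j)))" for j t
  have f0: "0 \<le> f j t" for j t
    unfolding f_def using m(1) d[of j] by (auto intro!: mult_nonneg_nonneg simp: mono_def less_imp_le)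
  have inc: "m (t + d j) - m (t - d j) \<le> 2 * M" for j t
    using m(2)[of "t + d j"] m(2)[of "t - d j"] by linarith
  have inc': "\<bar>m (t + d j) - m (t - d j)\<bar> \<le> 2 * M" for j t
    using m(2)[of "t + d j"] m(2)[of "t - d j"] by linarith
  have int: "integrable lborel (f j)" and le: "(LINT t|lborel. f j t) \<le> 4 * M * (2 powr - (1/4)) ^ j" for j
  proof -
    define \<gamma> where "\<gamma> s = 2 powr ((3/4) * real j) * (m (s + d j) - m (s - d j))" for s
    have [measurable]: "\<gamma> \<in> borel_measurable borel" unfolding \<gamma>_def by measurable
    have gb: "\<bar>\<gamma> s\<bar> \<le> 2 powr ((3/4) * real j) * (2 * M)" for s
      unfolding \<gamma>_def abs_mult using inc' by (intro mult_mono) auto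
    have eq: "(\<lambda>r. f j (N + (-1) * r)) = (\<lambda>r. indicator {0..} r * exp (- 1 * r) * \<gamma> (N - r))"
      by (auto simp: f_def \<gamma>_def indicator_def fun_eq_iff)
    have "integrable lborel (\<lambda>r. f j (N + (-1) * r))"
      unfolding eq using integrable_exp_conv[of 1 "{0..}" \<gamma> "2 powr ((3/4) * real j) * (2 * M)" N] gb by simp
    then show "integrable lborel (f j)"
      using lborel_integrable_real_affine_iff[of "-1" "f j" N] by simp
    have "(LINT t|lborel. f j t) = exp_conv 1 \<gamma> N"
      unfolding exp_conv_alt f_def \<gamma>_def by simp
    also have "\<dots> = 2 powr ((3/4) * real j) * (exp_conv 1 (\<lambda>s. m (s + d j)) N - exp_conv 1 (\<lambda>s. m (s - d j)) N)"
      unfolding \<gamma>_def exp_conv_cmult using m(2) by (subst exp_conv_diff[where B = M and C = M]) auto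
    also have "exp_conv 1 (\<lambda>s. m (s + d j)) N = exp_conv 1 m (N + d j)"
      unfolding exp_conv_def by (simp add: algebra_simps)
    also have "exp_conv 1 (\<lambda>s. m (s - d j)) N = exp_conv 1 m (N - d j)"
      unfolding exp_conv_def by (simp add: algebra_simps)
    also have "exp_conv 1 m (N + d j) - exp_conv 1 m (N - d j) \<le> 4 * M * d j"
      using exp_conv_Lipschitz[of 1 m M "N + d j" "N - d j"] m(2) d[of j] by simp
    also have "2 powr ((3/4) * real j) * (4 * M * d j) = 4 * M * (2 powr ((3/4) * real j) * 2 powr (- real j))"
      by (simp add: d_def)
    also have "2 powr ((3/4) * real j) * 2 powr (- real j) = (2 powr - (1/4)) ^ j"
      by (simp add: powr_add[symmetric] powr_realpow[symmetric] powr_powr)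
    finally show "(LINT t|lborel. f j t) \<le> 4 * M * (2 powr - (1/4)) ^ j"
      by (simp add: mult_left_mono)
  qed
  have sum: "summable (\<lambda>j. 4 * M * (2 powr - (1/4)) ^ j)"
    by (intro summable_mult summable_geometric) (use powr_less_mono[of "- (1/4)" 0 "2::real"] in simp)
  have "(\<integral>\<^sup>+t. (\<Sum>j. ennreal (f j t)) \<partial>lborel) = (\<Sum>j. \<integral>\<^sup>+t. ennreal (f j t) \<partial>lborel)"
    using int by (intro nn_integral_suminf) auto
  also have "\<dots> \<le> (\<Sum>j. ennreal (4 * M * (2 powr - (1/4)) ^ j))"
  proof (intro suminf_le summableI)
    show "(\<integral>\<^sup>+t. ennreal (f j t) \<partial>lborel) \<le> ennreal (4 * M * (2 powr - (1/4)) ^ j)" for j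
      using nn_integral_eq_integral[OF int[of j]] f0 le[of j] by (simp add: ennreal_leI)
  qed
  also have "\<dots> < \<infinity>"
  proof -
    have "0 \<le> M" using m(2)[of 0] by linarith
    then have "(\<Sum>j. ennreal (4 * M * (2 powr - (1/4)) ^ j)) = ennreal (\<Sum>j. 4 * M * (2 powr - (1/4)) ^ j)"
      by (intro suminf_ennreal2 sum mult_nonneg_nonneg zero_le_power) auto
    then show ?thesis by (simp only: ennreal_less_top infinity_ennreal_def)
  qed
  finally have fin: "(\<integral>\<^sup>+t. (\<Sum>j. ennreal (f j t)) \<partial>lborel) < \<infinity>" .
  have [measurable]: "f j \<in> borel_measurable lborel" for j using int by (rule borel_measurable_integrable)
  have "(\<lambda>t. \<Sum>j. ennreal (f j t)) \<in> borel_measurable lborel" by measurable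
  then have "AE t in lborel. (\<Sum>j. ennreal (f j t)) \<noteq> \<infinity>"
    using fin by (intro nn_integral_noteq_infinite) simp_all
  then show ?thesis
  proof eventually_elim
    case (elim t)
    then obtain C where C: "(\<Sum>j. ennreal (f j t)) = ennreal C" "0 \<le> C"
      by (cases "\<Sum>j. ennreal (f j t)") auto
    show ?case
    proof (intro impI exI[of _ "C * exp (N - t)"] allI)
      fix j assume "t < N"
      have "ennreal (f j t) \<le> (\<Sum>i. ennreal (f i t))"
        using sum_le_suminf[of "\<lambda>i. ennreal (f i t)" "{j}"] by simp
      then have "f j t \<le> C" using C by simp
      then have "exp (- (N - t)) * (2 powr ((3/4) * real j) * (m (t + d j) - m (t - d j))) \<le> C"
        using \<open>t < N\<close> by (simp add: f_def)
      then have "2 powr ((3/4) * real j) * (m (t + d j) - m (t - d j)) \<le> C * exp (N - t)"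
        by (simp only: exp_minus divide_inverse[symmetric]) (simp add: field_simps)
      then show "m (t + 2 powr - real j) - m (t - 2 powr - real j) \<le> C * exp (N - t) * 2 powr (- (3/4) * real j)"
        unfolding d_def by (simp add: powr_minus field_simps)
    qed
  qed
qed

lemma mono_AE_Hoelder:
  fixes m :: "real \<Rightarrow> real"
  assumes m: "mono m" "\<And>t. \<bar>m t\<bar> \<le> M"
  shows "AE t in lebesgue. \<exists>C. \<forall>s. \<bar>m s - m t\<bar> \<le> C * \<bar>s - t\<bar> powr (3/4)"
proof -
  have "AE t in lborel. \<forall>n::nat. t < real n \<longrightarrow> (\<exists>C. \<forall>j. m (t + 2 powr - real j) - m (t - 2 powr - real j) \<le> C * 2 powr (- (3/4) * real j))"
    unfolding AE_all_countable using mono_AE_Hoelder_below[OF m] by blast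
  then have "AE t in lborel. \<exists>C. \<forall>s. \<bar>m s - m t\<bar> \<le> C * \<bar>s - t\<bar> powr (3/4)"
  proof eventually_elim
    case (elim t)
    obtain n :: nat where "t < real n" using reals_Archimedean2 by blast
    with elim obtain C where C: "\<And>j. m (t + 2 powr - real j) - m (t - 2 powr - real j) \<le> C * 2 powr (- (3/4) * real j)"
      by blast
    have M0: "0 \<le> M" using m(2)[of 0] by linarith
    have C0: "0 \<le> C"
    proof -
      have "m (t - 1) \<le> m (t + 1)" using m(1) by (simp add: mono_def)
      then show ?thesis using C[of 0] by simp
    qed
    \<comment> \<open>The share \<open>2 * M\<close> serves distances of at least 1, the share
      \<open>2 * C\<close> the smaller ones.\<close>
    show ?case
    proof (intro exI[of _ "2 * M + 2 * C"] allI)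
      fix s
      define d where "d = \<bar>s - t\<bar>"
      consider "d = 0" | "d \<ge> 1" | "0 < d" "d < 1" unfolding d_def by linarith
      then have "\<bar>m s - m t\<bar> \<le> (2 * M + 2 * C) * d powr (3/4)"
      proof cases
        case 1
        then show ?thesis by (simp add: d_def)
      next
        case 2
        have "\<bar>m s - m t\<bar> \<le> 2 * M" using m(2)[of s] m(2)[of t] by linarith
        also have "\<dots> \<le> (2 * M + 2 * C) * 1" using C0 by simp
        also have "\<dots> \<le> (2 * M + 2 * C) * d powr (3/4)"
          using 2 M0 C0 by (intro mult_left_mono ge_one_powr_ge_zero) auto
        finally show ?thesis .
      next
        case 3
        \<comment> \<open>The finest dyadic scale that still reaches \<open>s\<close>:
          \<open>d\<close> lies between \<open>2 powr - (j + 1)\<close> and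
          \<open>2 powr - j\<close>, and rounding up to the scale costs less than the factor 2 in
          the \<open>3/4\<close>-th power.\<close>
        define j where "j = nat \<lfloor>- log 2 d\<rfloor>"
        have "0 \<le> - log 2 d" using 3 by simp
        then have j: "real j \<le> - log 2 d" "- log 2 d < real j + 1"
          unfolding j_def by linarith+
        have dl: "d = 2 powr (log 2 d)" using 3 by simp
        have "d \<le> 2 powr - real j" using j by (subst dl) (simp add: powr_mono)
        then have "\<bar>m s - m t\<bar> \<le> m (t + 2 powr - real j) - m (t - 2 powr - real j)"
          using monoD[OF m(1), of "t - 2 powr - real j" s] monoD[OF m(1), of "t - 2 powr - real j" t]
            monoD[OF m(1), of s "t + 2 powr - real j"] monoD[OF m(1), of t "t + 2 powr - real j"]
          unfolding d_def by (simp add: abs_le_iff)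
        also have "\<dots> \<le> C * 2 powr (- (3/4) * real j)" by (rule C)
        also have "\<dots> \<le> C * (2 * d powr (3/4))"
        proof (rule mult_left_mono[OF _ C0])
          have "2 powr (- (3/4) * real j) \<le> 2 powr (1 + (3/4) * log 2 d)"
            using j by (intro powr_mono) auto
          also have "\<dots> = 2 * d powr (3/4)"
            by (subst (2) dl) (simp add: powr_add powr_powr mult.commute)
          finally show "2 powr (- (3/4) * real j) \<le> 2 * d powr (3/4)" .
        qed
        also have "\<dots> \<le> (2 * M + 2 * C) * d powr (3/4)"
          using mult_nonneg_nonneg[OF M0 powr_ge_zero[of d "3/4"]] by (simp add: algebra_simps)
        finally show ?thesis .
      qed
      then show "\<bar>m s - m t\<bar> \<le> (2 * M + 2 * C) * \<bar>s - t\<bar> powr (3/4)" by (simp add: d_def)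
    qed
  qed
  then show ?thesis by (rule AE_completion)
qed

lemma powr_add_le_double:
  fixes x y :: real
  assumes "0 \<le> x" "0 \<le> y"
  shows "(x + y) powr (3/4) \<le> 2 * (x powr (3/4) + y powr (3/4))"
proof -
  have "(x + y) powr (3/4) \<le> (2 * max x y) powr (3/4)"
    using assms by (intro powr_mono2) auto
  also have "\<dots> = 2 powr (3/4) * max x y powr (3/4)"
    using assms by (simp add: powr_mult)
  also have "\<dots> \<le> 2 powr 1 * max x y powr (3/4)"
    by (intro mult_right_mono powr_mono) auto
  also have "max x y powr (3/4) \<le> x powr (3/4) + y powr (3/4)"
    by (auto simp: max_def)
  finally show ?thesis by simp
qed

text \<open>Half of the decay of \<open>exp (- l * r)\<close> is spent on absorbing the growth of
  \<open>r powr (3/4)\<close>; the other half stays integrable.\<close>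

lemma powr_le_exp_half:
  fixes l r :: real
  assumes "l > 0" "r \<ge> 0"
  shows "r powr (3/4) \<le> 2 * l powr - (3/4) * exp (l * r / 2)"
proof -
  have "(l * r) powr (3/4) \<le> 1 + l * r"
  proof (cases "l * r \<le> 1")
    case True
    then have "(l * r) powr (3/4) \<le> 1" using assms by (intro powr_le1) auto
    then show ?thesis using assms by (simp add: add_increasing2)
  next
    case False
    then have "(l * r) powr (3/4) \<le> (l * r) powr 1" by (intro powr_mono) auto
    then show ?thesis using False by simp
  qed
  also have "\<dots> \<le> 2 * exp (l * r / 2)" using exp_ge_add_one_self[of "l * r / 2"] by linarith
  finally have "l powr (3/4) * r powr (3/4) \<le> 2 * exp (l * r / 2)"
    using assms by (simp add: powr_mult)
  then show ?thesis using assms by (simp add: powr_minus field_simps)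
qed

text \<open>Below, \<open>\<eta>\<close> is a Fourier coefficient of the source minus its value at time \<open>t\<close>.\<close>

context
  fixes l C D t :: real and \<eta> :: "real \<Rightarrow> real"
  assumes l: "l > 0" and \<eta>: "\<eta> \<in> borel_measurable borel" "\<And>s. \<bar>\<eta> s\<bar> \<le> D"
    and Hoelder: "\<And>s. \<bar>\<eta> s\<bar> \<le> C * \<bar>s - t\<bar> powr (3/4)"
begin

lemma Hoelder_const_nonneg: "C \<ge> 0"
  using Hoelder[of "t + 1"] by simp

text \<open>At \<open>s = t\<close> this improves the trivial bound of order \<open>1 / l\<close> by
  the factor \<open>l powr - (3/4)\<close>. The distance from \<open>s - r\<close> to
  \<open>t\<close> is split into \<open>\<bar>s - t\<bar>\<close> and \<open>r\<close>, and the part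
  in \<open>r\<close> is absorbed by half of the exponential.\<close>

lemma exp_conv_Hoelder_bound:
  "\<bar>exp_conv l \<eta> s\<bar> \<le> 2 * C / l * (\<bar>s - t\<bar> powr (3/4) + 4 * l powr - (3/4))"
proof -
  note C0 = Hoelder_const_nonneg
  define p where "p = \<bar>s - t\<bar> powr (3/4)"
  define q where "q = l powr - (3/4)"
  have i1: "integrable lborel (\<lambda>r. indicator {0..} r * exp (- l * r) * (2 * C * p))"
    by (intro integrable_mult_left exp_halfline l)
  have i2: "integrable lborel (\<lambda>r. indicator {0..} r * exp (- (l / 2) * r) * (4 * C * q))"
    using l by (intro integrable_mult_left exp_halfline) simp
  have "\<bar>exp_conv l \<eta> s\<bar> \<le> (LINT r|lborel. indicator {0..} r * exp (- l * r) * (2 * C * p) +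
     indicator {0..} r * exp (- (l / 2) * r) * (4 * C * q))"
    unfolding exp_conv_def
  proof (rule integral_abs_bound[THEN order_trans], rule integral_mono)
    show "integrable lborel (\<lambda>r. \<bar>indicator {0..} r * exp (- l * r) * \<eta> (s - r)\<bar>)"
      by (intro integrable_abs integrable_exp_conv[OF l _ _ \<eta>]) auto
    show "integrable lborel (\<lambda>r. indicator {0..} r * exp (- l * r) * (2 * C * p) +
     indicator {0..} r * exp (- (l / 2) * r) * (4 * C * q))"
      by (intro Bochner_Integration.integrable_add i1 i2)
    fix r :: real
    show "\<bar>indicator {0..} r * exp (- l * r) * \<eta> (s - r)\<bar> \<le> indicator {0..} r * exp (- l * r) * (2 * C * p) +
     indicator {0..} r * exp (- (l / 2) * r) * (4 * C * q)"
    proof (cases "r \<ge> 0")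
      case True
      have "\<bar>\<eta> (s - r)\<bar> \<le> C * \<bar>s - r - t\<bar> powr (3/4)" by (rule Hoelder)
      also have "\<dots> \<le> C * (\<bar>s - t\<bar> + r) powr (3/4)"
        using True C0 by (intro mult_left_mono powr_mono2) auto
      also have "\<dots> \<le> C * (2 * (p + r powr (3/4)))"
        unfolding p_def using True C0 by (intro mult_left_mono powr_add_le_double) auto
      also have "\<dots> \<le> C * (2 * (p + 2 * q * exp (l * r / 2)))"
        unfolding q_def using powr_le_exp_half[OF l True] C0 by (intro mult_left_mono) auto
      finally have "exp (- l * r) * \<bar>\<eta> (s - r)\<bar> \<le> exp (- l * r) * (C * (2 * (p + 2 * q * exp (l * r / 2))))"
        by (intro mult_left_mono) auto
      also have "\<dots> = exp (- l * r) * (2 * C * p) + (exp (- l * r) * exp (l * r / 2)) * (4 * C * q)"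
        by (simp add: algebra_simps)
      also have "exp (- l * r) * exp (l * r / 2) = exp (- (l / 2) * r)"
        by (simp add: exp_add[symmetric])
      finally show ?thesis using True by (simp add: abs_mult)
    qed simp
  qed
  also have "\<dots> = 1 / l * (2 * C * p) + 1 / (l / 2) * (4 * C * q)"
    using exp_halfline(2)[OF l, of 0] exp_halfline(2)[of "l / 2" 0] l
    by (subst Bochner_Integration.integral_add[OF i1 i2]) (simp add: integral_mult_left_zero)
  also have "\<dots> = 2 * C / l * (p + 4 * q)" using l by (simp add: field_simps)
  finally show ?thesis by (simp add: p_def q_def)
qed

text \<open>The Hoelder bound forces \<open>\<eta> t = 0\<close>, so
  \<open>y' = \<eta> - l * y\<close> predicts the slope \<open>- l * exp_conv l \<eta> t\<close> at
  \<open>t\<close>. The second bound measures the error of this prediction for a fixed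
  \<open>l\<close>; the first dominates all difference quotients by a power of \<open>l\<close> that
  is summable over the modes.\<close>

lemma exp_conv_Hoelder_increment:
  assumes "s1 < s2" "s1 = t \<or> s2 = t"
  shows "\<bar>exp_conv l \<eta> s2 - exp_conv l \<eta> s1\<bar> \<le> 20 * C * l powr - (3/4) * (s2 - s1)"
    and "\<bar>exp_conv l \<eta> s2 - exp_conv l \<eta> s1 + l * (s2 - s1) * exp_conv l \<eta> t\<bar> \<le>
      (4 * l * D * (s2 - s1) + C * (s2 - s1) powr (3/4)) * (s2 - s1)"
proof -
  note C0 = Hoelder_const_nonneg
  have D0: "D \<ge> 0" using \<eta>(2)[of 0] by linarith
  define h where "h = s2 - s1"
  define q where "q = l powr - (3/4)"
  have h: "h > 0" using assms by (simp add: h_def)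
  have q: "q > 0" using l by (simp add: q_def)
  define I where "I = (LINT r|lborel. indicator {0..<h} r * exp (- l * r) * \<eta> (s1 + h - r))"
  have I: "\<bar>I\<bar> \<le> C * h powr (3/4) * h"
    unfolding I_def
  proof (rule integral_exp_window_bound[OF l \<eta>])
    fix s assume "s1 + h - h \<le> s" "s \<le> s1 + h"
    then have "\<bar>s - t\<bar> \<le> h" using assms by (auto simp: h_def)
    then show "\<bar>\<eta> s\<bar> \<le> C * h powr (3/4)"
      using Hoelder[of s] C0 by (meson mult_left_mono order_trans powr_mono2 abs_ge_zero zero_le_divide_iff zero_le_numeral)
  qed (use h in simp)
  have eq: "exp_conv l \<eta> s2 - exp_conv l \<eta> s1 = - ((1 - exp (- l * h)) * exp_conv l \<eta> s1) + I"
    using exp_conv_restart[OF l \<eta>, of h s1] h by (simp add: I_def h_def algebra_simps)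
  have e: "0 \<le> 1 - exp (- l * h)" "1 - exp (- l * h) \<le> l * h"
    using exp_ge_add_one_self[of "- l * h"] l h by auto
  have e2: "l * h - (1 - exp (- l * h)) \<le> (l * h)\<^sup>2"
  proof -
    have lh: "l * h > 0" using l h by simp
    have "exp (- l * h) \<le> 1 / (1 + l * h)"
      using exp_ge_add_one_self[of "l * h"] lh by (simp add: exp_minus field_simps)
    also have "\<dots> \<le> 1 - l * h + (l * h)\<^sup>2"
    proof -
      have "1 \<le> 1 + (l * h) ^ 3" using lh by simp
      also have "\<dots> = (1 - l * h + (l * h)\<^sup>2) * (1 + l * h)" by (simp add: algebra_simps power2_eq_square power3_eq_cube)
      finally show ?thesis using lh by (simp add: divide_le_eq)
    qed
    finally show ?thesis by simp
  qed
  have bnd: "\<bar>exp_conv l \<eta> s\<bar> \<le> 2 * C / l * (h powr (3/4) + 4 * q)" if "s = s1 \<or> s = s2" for s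
  proof -
    have "\<bar>s - t\<bar> powr (3/4) \<le> h powr (3/4)" using that assms by (intro powr_mono2) (auto simp: h_def)
    then show ?thesis
      using exp_conv_Hoelder_bound[of s] C0 l unfolding q_def
      by (elim order_trans) (intro mult_left_mono add_right_mono, auto)
  qed
  \<comment> \<open>For \<open>l * h \<ge> 1\<close> the two values are estimated separately, which
    gives \<open>20 = 4 + 16\<close>; for smaller steps the restart formula gains the factor
    \<open>l * h\<close>, and 11 would suffice.\<close>
  show "\<bar>exp_conv l \<eta> s2 - exp_conv l \<eta> s1\<bar> \<le> 20 * C * l powr - (3/4) * (s2 - s1)"
  proof (cases "l * h \<ge> 1")
    case True
    have hq: "h powr (3/4) \<le> l * h * q"
    proof -
      have "1 \<le> (l * h) powr (1/4)" using True by (intro ge_one_powr_ge_zero) auto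
      then have "h powr (3/4) * 1 \<le> h powr (3/4) * (l powr (1/4) * h powr (1/4))"
        using l h by (intro mult_left_mono) (auto simp: powr_mult)
      also have "l powr (1/4) = l * q" using powr_add[of l 1 "- (3/4)"] l by (simp add: q_def)
      also have "h powr (3/4) * (l * q * h powr (1/4)) = l * q * (h powr (3/4) * h powr (1/4))" by simp
      also have "h powr (3/4) * h powr (1/4) = h" using powr_add[of h "3/4" "1/4"] h by simp
      finally have "h powr (3/4) * 1 \<le> l * q * h" .
      then show ?thesis by (simp add: mult_ac)
    qed
    have "\<bar>exp_conv l \<eta> s2 - exp_conv l \<eta> s1\<bar> \<le> 2 * (2 * C / l * (h powr (3/4) + 4 * q))"
      using bnd[of s1] bnd[of s2] by linarith
    also have "\<dots> \<le> 2 * (2 * C / l * (l * h * q + 4 * q))"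
      using hq C0 l by (intro mult_left_mono) auto
    also have "\<dots> = 4 * C * h * q + 16 * C * q / l" using l by (simp add: field_simps)
    also have "16 * C * q / l = 16 * C * q * (1 / l)" by simp
    also have "\<dots> \<le> 16 * C * q * h"
      using True l C0 q by (intro mult_left_mono) (auto simp: field_simps)
    finally show ?thesis by (simp add: h_def[symmetric] q_def[symmetric] mult_ac)
  next
    case False
    have hq: "h powr (3/4) \<le> q"
    proof -
      have "h \<le> 1 / l" using False l by (simp add: field_simps)
      then have "h powr (3/4) \<le> (1 / l) powr (3/4)" using h by (intro powr_mono2) auto
      then show ?thesis using l by (simp add: q_def powr_minus powr_divide inverse_eq_divide)
    qed
    have "\<bar>(1 - exp (- l * h)) * exp_conv l \<eta> s1\<bar> \<le> (l * h) * (2 * C / l * (h powr (3/4) + 4 * q))"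
      unfolding abs_mult using e bnd[of s1] l h by (intro mult_mono) auto
    also have "\<dots> \<le> (l * h) * (2 * C / l * (q + 4 * q))"
      using hq l h C0 by (intro mult_left_mono) auto
    also have "\<dots> = 10 * (C * h * q)" using l by simp
    finally have 1: "\<bar>(1 - exp (- l * h)) * exp_conv l \<eta> s1\<bar> \<le> 10 * (C * h * q)" .
    have "C * h powr (3/4) * h \<le> C * q * h" using hq C0 h by (intro mult_right_mono mult_left_mono) auto
    then have 2: "\<bar>I\<bar> \<le> C * h * q" using I by (simp add: mult_ac)
    have "0 \<le> C * h * q" using C0 h q by simp
    then have "\<bar>exp_conv l \<eta> s2 - exp_conv l \<eta> s1\<bar> \<le> 20 * (C * h * q)" using eq 1 2 by linarith
    then show ?thesis by (simp add: h_def[symmetric] q_def[symmetric] mult_ac)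
  qed
  have U1: "\<bar>exp_conv l \<eta> t - exp_conv l \<eta> s1\<bar> \<le> 2 * D * h"
    using exp_conv_Lipschitz[OF l \<eta>, of t s1] assms D0 h 
    by (auto simp: h_def)
  have "exp_conv l \<eta> s2 - exp_conv l \<eta> s1 + l * h * exp_conv l \<eta> t =
     l * h * (exp_conv l \<eta> t - exp_conv l \<eta> s1) + (l * h - (1 - exp (- l * h))) * exp_conv l \<eta> s1 + I"
    unfolding eq by (simp add: algebra_simps)
  moreover have "\<bar>l * h * (exp_conv l \<eta> t - exp_conv l \<eta> s1)\<bar> \<le> l * h * (2 * D * h)"
    unfolding abs_mult using U1 l h by (intro mult_mono) auto
  moreover have "\<bar>(l * h - (1 - exp (- l * h))) * exp_conv l \<eta> s1\<bar> \<le> (l * h)\<^sup>2 * (D / l)"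
    unfolding abs_mult using e e2 exp_conv_bound[OF l \<eta>, of s1] D0 l by (intro mult_mono) auto
  moreover have "(l * h)\<^sup>2 * (D / l) = l * h * (D * h)" using l by (simp add: power2_eq_square)
  moreover have "0 \<le> l * h * (D * h)" using l h D0 by simp
  ultimately have "\<bar>exp_conv l \<eta> s2 - exp_conv l \<eta> s1 + l * h * exp_conv l \<eta> t\<bar> \<le> 4 * (l * h * (D * h)) + C * h powr (3/4) * h"
    using I by linarith
  then show "\<bar>exp_conv l \<eta> s2 - exp_conv l \<eta> s1 + l * (s2 - s1) * exp_conv l \<eta> t\<bar> \<le>
      (4 * l * D * (s2 - s1) + C * (s2 - s1) powr (3/4)) * (s2 - s1)"
    by (simp add: h_def algebra_simps)
qed

lemma exp_conv_Hoelder_quotient: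
  "s \<noteq> t \<Longrightarrow> \<bar>(exp_conv l \<eta> s - exp_conv l \<eta> t) / (s - t)\<bar> \<le> 20 * C * l powr - (3/4)"
  "((\<lambda>s. (exp_conv l \<eta> s - exp_conv l \<eta> t) / (s - t)) \<longlongrightarrow> - l * exp_conv l \<eta> t) (at t)"
proof -
  have swap: "(exp_conv l \<eta> s - exp_conv l \<eta> t) / (s - t) = (exp_conv l \<eta> t - exp_conv l \<eta> s) / (t - s)" for s
    by (metis minus_diff_eq minus_divide_divide)
  show "\<bar>(exp_conv l \<eta> s - exp_conv l \<eta> t) / (s - t)\<bar> \<le> 20 * C * l powr - (3/4)" if "s \<noteq> t" for s
  proof (cases "t < s")
    case True
    then show ?thesis using exp_conv_Hoelder_increment(1)[of t s] by (simp add: abs_divide pos_divide_le_eq)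
  next
    case False
    then show ?thesis using exp_conv_Hoelder_increment(1)[of s t] that unfolding swap by (simp add: abs_divide pos_divide_le_eq)
  qed
  have err: "\<bar>(exp_conv l \<eta> s - exp_conv l \<eta> t) / (s - t) - (- l * exp_conv l \<eta> t)\<bar> \<le> 4 * l * D * \<bar>s - t\<bar> + C * \<bar>s - t\<bar> powr (3/4)"
    if "s \<noteq> t" for s
  proof -
    have gen: "\<bar>(exp_conv l \<eta> s2 - exp_conv l \<eta> s1) / (s2 - s1) - (- l * exp_conv l \<eta> t)\<bar> \<le> 4 * l * D * (s2 - s1) + C * (s2 - s1) powr (3/4)"
      if "s1 < s2" "s1 = t \<or> s2 = t" for s1 s2
    proof -
      have p: "s2 - s1 > 0" using that by simp
      define X where "X = exp_conv l \<eta> s2 - exp_conv l \<eta> s1 + l * (s2 - s1) * exp_conv l \<eta> t"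
      have "(exp_conv l \<eta> s2 - exp_conv l \<eta> s1) / (s2 - s1) - (- l * exp_conv l \<eta> t) = X / (s2 - s1)"
        using p by (simp add: X_def add_divide_distrib)
      also have "\<bar>X / (s2 - s1)\<bar> = \<bar>X\<bar> / (s2 - s1)"
        using p by (simp only: abs_divide abs_of_pos)
      also have "\<dots> \<le> 4 * l * D * (s2 - s1) + C * (s2 - s1) powr (3/4)"
        by (rule pos_divide_le_eq[OF p, THEN iffD2, OF exp_conv_Hoelder_increment(2)[OF that, folded X_def]])
      finally show ?thesis .
    qed
    show ?thesis
    proof (cases "t < s")
      case True
      then show ?thesis using gen[of t s] by simp
    next
      case False
      then show ?thesis using gen[of s t] that unfolding swap by simp
    qed
  qed
  have "((\<lambda>s. 4 * l * D * \<bar>s - t\<bar> + C * \<bar>s - t\<bar> powr (3/4)) \<longlongrightarrow> 4 * l * D * \<bar>t - t\<bar> + C * \<bar>t - t\<bar> powr (3/4)) (at t)"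
    by (intro tendsto_intros tendsto_powr2) auto
  then have lim: "((\<lambda>s. 4 * l * D * \<bar>s - t\<bar> + C * \<bar>s - t\<bar> powr (3/4)) \<longlongrightarrow> 0) (at t)" by simp
  have "((\<lambda>s. (exp_conv l \<eta> s - exp_conv l \<eta> t) / (s - t) - (- l * exp_conv l \<eta> t)) \<longlongrightarrow> 0) (at t)"
    by (rule Lim_null_comparison[OF _ lim]) (use err in \<open>auto simp: eventually_at_filter\<close>)
  then show "((\<lambda>s. (exp_conv l \<eta> s - exp_conv l \<eta> t) / (s - t)) \<longlongrightarrow> - l * exp_conv l \<eta> t) (at t)"
    by (rule Lim_null[THEN iffD2])
qed

end

lemma eigenval_neq_0 [simp]: "eigenval k \<noteq> 0"
  using eigenval_pos[of k] by linarith

section \<open>Norm estimates from pointwise bounds, and sums over disjoint intervals\<close>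

lemma L2_bounded:
  assumes "f \<in> borel_measurable I01" "\<And>x. x \<in> {0<..<1} \<Longrightarrow> \<bar>f x\<bar> \<le> B"
  shows "f \<in> L2"
proof -
  have "integrable I01 (\<lambda>x. (f x)\<^sup>2)"
  proof (rule integrable_I01_bounded[of _ "B\<^sup>2"])
    show "(\<lambda>x. (f x)\<^sup>2) \<in> borel_measurable I01" using assms(1) by measurable
    show "\<bar>(f x)\<^sup>2\<bar> \<le> B\<^sup>2" if "x \<in> {0<..<1}" for x
      using power_mono[OF assms(2)[OF that], of 2] by simp
  qed
  then show ?thesis using assms by (simp add: L2_def)
qed

lemma L2_norm_le:
  assumes "\<And>x. x \<in> {0<..<1} \<Longrightarrow> \<bar>f x\<bar> \<le> e" and "e \<ge> 0"
  shows "L2_norm f \<le> e"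
proof -
  have "(LINT x|I01. (f x)\<^sup>2) \<le> (LINT x|I01. e\<^sup>2)"
  proof (rule integral_mono_AE')
    have "(f x)\<^sup>2 \<le> e\<^sup>2" if "x \<in> {0<..<1}" for x
      using power_mono[OF assms(1)[OF that], of 2] by simp
    then show "AE x in I01. (f x)\<^sup>2 \<le> e\<^sup>2" by (intro AE_I2) auto
  qed auto
  then have "sqrt (LINT x|I01. (f x)\<^sup>2) \<le> sqrt (e\<^sup>2)" by (intro real_sqrt_le_mono) simp
  then show ?thesis using assms(2) by (simp add: L2_norm_def)
qed

lemma L2_norm_nonneg: "L2_norm f \<ge> 0"
  by (simp add: L2_norm_def)

lemma L2_dist_le:
  assumes "\<And>x. x \<in> {0<..<1} \<Longrightarrow> \<bar>f x - h x\<bar> \<le> e" and "e \<ge> 0"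
  shows "L2_dist f h \<le> e"
  unfolding L2_dist_def using assms by (rule L2_norm_le)

lemma L2_dist_nonneg: "L2_dist f h \<ge> 0"
  by (simp add: L2_dist_def L2_norm_nonneg)

lemma L2_dist_tendsto_0:
  assumes "\<forall>\<^sub>F s in F. \<forall>x\<in>{0<..<1}. \<bar>f s x - h s x\<bar> \<le> e s" "(e \<longlongrightarrow> 0) F"
    "\<forall>\<^sub>F s in F. e s \<ge> 0"
  shows "((\<lambda>s. L2_dist (f s) (h s)) \<longlongrightarrow> 0) F"
proof (rule Lim_null_comparison[OF _ assms(2)])
  show "\<forall>\<^sub>F s in F. norm (L2_dist (f s) (h s)) \<le> e s"
    using assms(1,3) by eventually_elim (auto simp: L2_dist_nonneg intro: L2_dist_le)
qed

lemma summable_eigenval_powr: "summable (\<lambda>k. c * eigenval k powr - (3/4))"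
proof -
  have "summable (\<lambda>k. real (Suc k) powr - (3/2))"
    using summable_real_powr_iff[of "- (3/2)"] summable_Suc_iff[of "\<lambda>k. real k powr - (3/2)"] by simp
  then have "summable (\<lambda>k. c * pi powr - (3/2) * real (Suc k) powr - (3/2))"
    by (rule summable_mult)
  moreover have "c * pi powr - (3/2) * real (Suc k) powr - (3/2) = c * eigenval k powr - (3/4)" for k
  proof -
    have "eigenval k = (pi * real (Suc k)) powr 2"
      unfolding eigenval_def by (subst powr_numeral) (auto simp: add.commute)
    then have "eigenval k powr - (3/4) = (pi * real (Suc k)) powr - (3/2)"
      by (simp only: powr_powr) simp
    then show ?thesis by (simp only: powr_mult mult.assoc)
  qed
  ultimately show ?thesis by (simp only:)
qed

text \<open>Induction on the number of intervals, removing the one with the largest left end point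
  \<open>a\<close>. Disjointness pushes all others to the left of \<open>a\<close>, so the induction
  hypothesis is applied with \<open>a\<close> in place of \<open>\<beta>\<close>.\<close>

lemma sum_disjoint_increments_le:
  fixes f :: "real \<Rightarrow> real"
  assumes f: "mono f" and D: "finite D" "\<And>a b. (a, b) \<in> D \<Longrightarrow> a < b"
    and disj: "disjoint_family_on (\<lambda>(a, b). {a<..<b}) D"
    and bnd: "\<And>a b. (a, b) \<in> D \<Longrightarrow> \<alpha> \<le> a \<and> b \<le> \<beta>" and "\<alpha> \<le> \<beta>"
  shows "(\<Sum>(a, b)\<in>D. f b - f a) \<le> f \<beta> - f \<alpha>"
  using D disj bnd \<open>\<alpha> \<le> \<beta>\<close>
proof (induction "card D" arbitrary: D \<beta>)
  case 0
  then show ?case using f by (simp add: monoD)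
next
  case (Suc n)
  then have "D \<noteq> {}" by auto
  define a where "a = Max (fst ` D)"
  have "a \<in> fst ` D" unfolding a_def using Suc.prems(1) \<open>D \<noteq> {}\<close> by (intro Max_in) auto
  then obtain b where ab: "(a, b) \<in> D" by auto
  have amax: "a' \<le> a" if "(a', b') \<in> D" for a' b'
    unfolding a_def using Suc.prems(1) that by (intro Max_ge) force+
  have IH: "(\<Sum>(a, b)\<in>D - {(a, b)}. f b - f a) \<le> f a - f \<alpha>"
  proof (rule Suc.hyps(1))
    show "n = card (D - {(a, b)})" using Suc.hyps(2) Suc.prems(1) ab by simp
    show "disjoint_family_on (\<lambda>(a, b). {a<..<b}) (D - {(a, b)})"
      using Suc.prems(3) by (rule disjoint_family_on_mono[rotated]) auto
    show "\<alpha> \<le> a" using Suc.prems(4) ab by blast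
    fix a' b' assume ab': "(a', b') \<in> D - {(a, b)}"
    have "b' \<le> a"
    proof (rule ccontr)
      assume "\<not> b' \<le> a"
      define y where "y = (a + min b b') / 2"
      have "a < b" using Suc.prems(2) ab by blast
      then have "a < y" "y < b" "y < b'" using \<open>\<not> b' \<le> a\<close> by (auto simp: y_def min_def)
      moreover have "a' \<le> a" using amax ab' by blast
      ultimately have "y \<in> {a<..<b}" "y \<in> {a'<..<b'}" by auto
      moreover have "{a<..<b} \<inter> {a'<..<b'} = {}"
        using disjoint_family_onD[OF Suc.prems(3) ab, of "(a', b')"] ab' by auto
      ultimately show False by blast
    qed
    then show "\<alpha> \<le> a' \<and> b' \<le> a" using Suc.prems(4) ab' by blast
  qed (use Suc.prems in auto)
  have "(\<Sum>(a, b)\<in>D. f b - f a) = (f b - f a) + (\<Sum>(a, b)\<in>D - {(a, b)}. f b - f a)"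
    using Suc.prems(1) ab by (subst sum.remove[of D "(a, b)"]) auto
  moreover have "f b \<le> f \<beta>" using Suc.prems(4) ab f by (auto intro: monoD)
  ultimately show ?case using IH by linarith
qed

section \<open>Sources of bounded variation in time, controlled in L1 by a monotone function\<close>

context
  fixes B M :: real and g :: "real \<Rightarrow> real \<Rightarrow> real" and m :: "real \<Rightarrow> real"
  assumes g: "source B g" and m: "mono m" "\<And>t. \<bar>m t\<bar> \<le> M"
    and bv: "\<And>s t. (LINT x|I01. \<bar>g s x - g t x\<bar>) \<le> \<bar>m s - m t\<bar>"
begin

lemma source_coeff_increment: "\<bar>sine_coeff (g s) k - sine_coeff (g t) k\<bar> \<le> 2 * \<bar>m s - m t\<bar>"
proof -
  have int: "integrable I01 (\<lambda>x. g s x - g t x)"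
    using source_integrable[OF g] by simp
  have "\<bar>LINT x|I01. (g s x - g t x) * sine k x\<bar> \<le> (LINT x|I01. \<bar>g s x - g t x\<bar>)"
  proof (rule integral_abs_bound[THEN order_trans], rule integral_mono)
    show "\<bar>(g s x - g t x) * sine k x\<bar> \<le> \<bar>g s x - g t x\<bar>" for x
      using mult_left_mono[OF abs_sine_le_1[of k x], of "\<bar>g s x - g t x\<bar>"] by (simp add: abs_mult)
  qed (use int in \<open>auto intro!: integrable_times_sine integrable_abs\<close>)
  also note bv[of s t]
  finally have "\<bar>sine_coeff (\<lambda>x. g s x - g t x) k\<bar> \<le> 2 * \<bar>m s - m t\<bar>"
    by (simp add: sine_coeff_def abs_mult)
  then show ?thesis using source_integrable[OF g] by (simp add: sine_coeff_diff)
qed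

lemma variation_measurable: "m \<in> borel_measurable borel"
  using m(1) by (rule borel_measurable_mono)

text \<open>The majorant is the increment of a nondecreasing function of time, so it can be summed
  over disjoint intervals, as absolute continuity requires.\<close>

lemma heat_coeff_increment:
  assumes "a \<le> b"
  shows "\<bar>heat_coeff g k b - heat_coeff g k a\<bar> \<le> 2 * (exp_conv (eigenval k) m b - exp_conv (eigenval k) m a)"
proof -
  define \<gamma> where "\<gamma> s = sine_coeff (g s) k" for s
  have \<gamma>: "\<gamma> \<in> borel_measurable borel" "\<And>s. \<bar>\<gamma> s\<bar> \<le> 2 * B"
    unfolding \<gamma>_def using source_coeff_measurable[OF g] source_coeff_bound[OF g] by auto
  have shift: "exp_conv l f b = exp_conv l (\<lambda>s. f (s + (b - a))) a" for l f
    by (simp add: exp_conv_def algebra_simps)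
  note [measurable] = \<gamma>(1) variation_measurable
  have "heat_coeff g k b - heat_coeff g k a = exp_conv (eigenval k) (\<lambda>s. \<gamma> (s + (b - a)) - \<gamma> s) a"
    unfolding heat_coeff_def \<gamma>_def[symmetric] shift[of "eigenval k"] using \<gamma>(2)
    by (subst exp_conv_diff[where B = "2 * B" and C = "2 * B"]) auto
  also have "\<bar>\<dots>\<bar> \<le> exp_conv (eigenval k) (\<lambda>s. 2 * (m (s + (b - a)) - m s)) a"
  proof (rule exp_conv_abs_le[where B = "4 * B" and C = "4 * M"])
    show "\<bar>\<gamma> (r + (b - a)) - \<gamma> r\<bar> \<le> 4 * B" for r
      using \<gamma>(2)[of r] \<gamma>(2)[of "r + (b - a)"] by linarith
    show "\<bar>2 * (m (r + (b - a)) - m r)\<bar> \<le> 4 * M" for r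
      using m(2)[of r] m(2)[of "r + (b - a)"] by (auto simp: abs_le_iff)
    show "\<bar>\<gamma> (a - r + (b - a)) - \<gamma> (a - r)\<bar> \<le> 2 * (m (a - r + (b - a)) - m (a - r))" for r
      using source_coeff_increment[of "a - r + (b - a)" k "a - r"] monoD[OF m(1), of "a - r" "a - r + (b - a)"] assms
      by (simp add: \<gamma>_def)
  qed auto
  also have "\<dots> = 2 * (exp_conv (eigenval k) m b - exp_conv (eigenval k) m a)"
    unfolding exp_conv_cmult shift[of "eigenval k" m] using m(2)
    by (subst exp_conv_diff[where B = M and C = M]) auto
  finally show ?thesis .
qed

lemma heat_sol_increment_le: "\<bar>heat_sol g s x - heat_sol g t x\<bar> \<le> (\<Sum>k. \<bar>heat_coeff g k s - heat_coeff g k t\<bar>)"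
  and heat_increment_summable: "summable (\<lambda>k. \<bar>heat_coeff g k s - heat_coeff g k t\<bar>)"
proof -
  show s: "summable (\<lambda>k. \<bar>heat_coeff g k s - heat_coeff g k t\<bar>)"
    by (rule summable_rabs_comparison_test[OF _ summable_add[OF heat_coeff_summable[OF g, of s] heat_coeff_summable[OF g, of t]], simplified])
       (auto intro!: exI[of _ 0] abs_triangle_ineq4)
  have "heat_sol g s x - heat_sol g t x = (\<Sum>k. (heat_coeff g k s - heat_coeff g k t) * sine k x)"
    unfolding heat_sol_def left_diff_distrib
    by (intro suminf_diff sine_series_summable heat_coeff_summable[OF g])
  then show "\<bar>heat_sol g s x - heat_sol g t x\<bar> \<le> (\<Sum>k. \<bar>heat_coeff g k s - heat_coeff g k t\<bar>)"
    using sine_series_bound[OF s] by simp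
qed

lemma heat_increment_tendsto_0: "((\<lambda>s. \<Sum>k. \<bar>heat_coeff g k s - heat_coeff g k t\<bar>) \<longlongrightarrow> 0) (at t within A)"
proof -
  have "((\<lambda>s. \<Sum>k. \<bar>heat_coeff g k s - heat_coeff g k t\<bar>) \<longlongrightarrow> (\<Sum>k. 0)) (at t within A)"
  proof (rule suminf_tendsto_dominated[OF _ _ summable_inverse_eigenval[of "4 * B"]])
    fix k
    have "((\<lambda>s. 4 * B * \<bar>s - t\<bar>) \<longlongrightarrow> 4 * B * \<bar>t - t\<bar>) (at t within A)"
      by (intro tendsto_intros)
    then have lim: "((\<lambda>s. 4 * B * \<bar>s - t\<bar>) \<longlongrightarrow> 0) (at t within A)" by simp
    show "((\<lambda>s. \<bar>heat_coeff g k s - heat_coeff g k t\<bar>) \<longlongrightarrow> 0) (at t within A)"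
      by (rule Lim_null_comparison[OF always_eventually lim]) (simp add: heat_coeff_Lipschitz[OF g])
  next
    have "\<bar>heat_coeff g k s - heat_coeff g k t\<bar> \<le> 4 * B / eigenval k" for k s
      using heat_coeff_bound[OF g, of k s] heat_coeff_bound[OF g, of k t] by linarith
    then show "\<forall>\<^sub>F s in at t within A. \<forall>k. \<bar>\<bar>heat_coeff g k s - heat_coeff g k t\<bar>\<bar> \<le> 4 * B / eigenval k"
      by simp
  qed
  then show ?thesis by simp
qed

lemma heat_sol_L2: "(\<And>x. x \<in> {0<..<1} \<Longrightarrow> u x = heat_sol g t x) \<Longrightarrow> u \<in> L2"
proof (rule L2_bounded[of _ "\<Sum>k. 2 * B / eigenval k"])
  assume u: "\<And>x. x \<in> {0<..<1} \<Longrightarrow> u x = heat_sol g t x"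
  have "heat_sol g t \<in> borel_measurable I01"
    using heat_sol_integrable[OF g] by (rule borel_measurable_integrable)
  then show "u \<in> borel_measurable I01" using u by (subst measurable_cong[where g = "heat_sol g t"]) auto
  show "\<bar>u x\<bar> \<le> (\<Sum>k. 2 * B / eigenval k)" if "x \<in> {0<..<1}" for x
    using u[OF that] heat_sol_bound[OF g] by simp
qed

lemma heat_sol_L2_continuous:
  assumes u: "\<And>t x. x \<in> {0<..<1} \<Longrightarrow> u t x = heat_sol g t x"
  shows "L2_continuous_on A u"
  unfolding L2_continuous_on_def
proof (intro conjI ballI)
  fix t
  show "u t \<in> L2" using u by (rule heat_sol_L2)
  show "((\<lambda>s. L2_dist (u s) (u t)) \<longlongrightarrow> 0) (at t within A)"
    by (rule L2_dist_tendsto_0[OF _ heat_increment_tendsto_0])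
       (auto simp: u intro!: always_eventually heat_sol_increment_le suminf_nonneg heat_increment_summable)
qed

text \<open>The increment of each coefficient is controlled both by the total variation of \<open>m\<close> (a bound
  of order \<open>1 / eigenval k\<close>) and by the total length of the intervals; the sum over \<open>k\<close> of the minimum of
  the two tends to \<open>0\<close> with that length.\<close>

lemma heat_sol_L2_absolutely_continuous:
  assumes u: "\<And>t x. x \<in> {0<..<1} \<Longrightarrow> u t x = heat_sol g t x" and T: "T1 \<le> T2"
  shows "L2_absolutely_continuous_on T1 T2 u"
  unfolding L2_absolutely_continuous_on_def
proof (intro conjI ballI allI impI)
  show "u t \<in> L2" for t using u by (rule heat_sol_L2)
  fix \<epsilon> :: real assume \<epsilon>: "\<epsilon> > 0"
  have M0: "M \<ge> 0" using m(2)[of 0] by linarith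
  define S where "S \<delta> = (\<Sum>k. min (4 * M / eigenval k) (4 * M * \<delta>))" for \<delta> :: real
  have "(S \<longlongrightarrow> (\<Sum>k. 0)) (at_right 0)"
    unfolding S_def
  proof (rule suminf_tendsto_dominated[OF _ _ summable_inverse_eigenval[of "4 * M"]])
    fix k
    have "((\<lambda>\<delta>. min (4 * M / eigenval k) (4 * M * \<delta>)) \<longlongrightarrow> min (4 * M / eigenval k) (4 * M * 0)) (at_right 0)"
      by (intro tendsto_intros)
    then show "((\<lambda>\<delta>. min (4 * M / eigenval k) (4 * M * \<delta>)) \<longlongrightarrow> 0) (at_right 0)"
      using M0 eigenval_pos[of k] by (subst (asm) (2) min_absorb2) (simp_all add: less_imp_le)
    show "\<forall>\<^sub>F \<delta> in at_right 0. \<forall>k. \<bar>min (4 * M / eigenval k) (4 * M * \<delta>)\<bar> \<le> 4 * M / eigenval k"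
      using eventually_at_right_less[of "0::real"]
      by eventually_elim (use M0 in \<open>auto simp: less_imp_le\<close>)
  qed
  then have "\<forall>\<^sub>F \<delta> in at_right 0. S \<delta> < \<epsilon>"
    using \<epsilon> by (intro order_tendstoD(2)[of S 0]) auto
  then have "\<forall>\<^sub>F \<delta> in at_right 0. S \<delta> < \<epsilon> \<and> \<delta> > 0"
    using eventually_at_right_less[of "0::real"] by eventually_elim auto
  then obtain \<delta> where \<delta>: "\<delta> > 0" "S \<delta> < \<epsilon>"
    using eventually_happens'[of "at_right (0::real)"] by auto
  show "\<exists>\<delta>>0. \<forall>D. finite D \<longrightarrow> (\<forall>(a, b)\<in>D. T1 \<le> a \<and> a < b \<and> b \<le> T2) \<longrightarrow>
        disjoint_family_on (\<lambda>(a, b). {a<..<b}) D \<longrightarrow> (\<Sum>(a, b)\<in>D. b - a) < \<delta> \<longrightarrow>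
        (\<Sum>(a, b)\<in>D. L2_dist (u b) (u a)) < \<epsilon>"
  proof (intro exI[of _ \<delta>] conjI \<delta>(1) allI impI)
    fix D :: "(real \<times> real) set"
    assume D: "finite D" "\<forall>(a, b)\<in>D. T1 \<le> a \<and> a < b \<and> b \<le> T2"
      "disjoint_family_on (\<lambda>(a, b). {a<..<b}) D" and small: "(\<Sum>(a, b)\<in>D. b - a) < \<delta>"
    define E where "E k = exp_conv (eigenval k) m" for k
    have "(\<Sum>(a, b)\<in>D. L2_dist (u b) (u a)) \<le> (\<Sum>(a, b)\<in>D. \<Sum>k. \<bar>heat_coeff g k b - heat_coeff g k a\<bar>)"
      by (intro sum_mono)
         (auto simp: u intro!: L2_dist_le heat_sol_increment_le suminf_nonneg heat_increment_summable)
    also have "\<dots> = (\<Sum>k. \<Sum>(a, b)\<in>D. \<bar>heat_coeff g k b - heat_coeff g k a\<bar>)"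
      unfolding case_prod_beta by (rule suminf_sum[symmetric]) (rule heat_increment_summable)
    also have "\<dots> \<le> S \<delta>"
      unfolding S_def
    proof (rule suminf_le)
      fix k
      have Em: "mono (E k)"
        unfolding E_def using m by (intro monoI exp_conv_mono[where B = M and C = M] variation_measurable) (auto intro: monoD)
      have Eb: "\<bar>E k t\<bar> \<le> M / eigenval k" for t
        unfolding E_def using m(2) by (intro exp_conv_bound variation_measurable) auto
      have EL: "E k b - E k a \<le> 2 * M * (b - a)" if "a < b" for a b
        using exp_conv_Lipschitz[of "eigenval k" m M b a] m(2) variation_measurable that by (simp add: E_def)
      have "(\<Sum>(a, b)\<in>D. \<bar>heat_coeff g k b - heat_coeff g k a\<bar>) \<le> (\<Sum>(a, b)\<in>D. 2 * (E k b - E k a))"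
      proof (intro sum_mono, clarify)
        fix a b assume "(a, b) \<in> D"
        then have "a \<le> b" using D(2) by fastforce
        then show "\<bar>heat_coeff g k b - heat_coeff g k a\<bar> \<le> 2 * (E k b - E k a)"
          unfolding E_def by (rule heat_coeff_increment)
      qed
      also have "\<dots> = 2 * (\<Sum>(a, b)\<in>D. E k b - E k a)"
        by (simp add: sum_distrib_left case_prod_beta)
      finally have le: "(\<Sum>(a, b)\<in>D. \<bar>heat_coeff g k b - heat_coeff g k a\<bar>) \<le> 2 * (\<Sum>(a, b)\<in>D. E k b - E k a)" .
      have "(\<Sum>(a, b)\<in>D. E k b - E k a) \<le> E k T2 - E k T1"
        using D T by (intro sum_disjoint_increments_le[OF Em]) auto
      also have "\<dots> \<le> 2 * M / eigenval k"
        using Eb[of T1] Eb[of T2] by linarith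
      finally have 1: "(\<Sum>(a, b)\<in>D. E k b - E k a) \<le> 2 * M / eigenval k" .
      have "(\<Sum>(a, b)\<in>D. E k b - E k a) \<le> (\<Sum>(a, b)\<in>D. 2 * M * (b - a))"
        using D(2) EL by (intro sum_mono) auto
      also have "\<dots> = 2 * M * (\<Sum>(a, b)\<in>D. b - a)" by (simp add: sum_distrib_left case_prod_beta)
      also have "\<dots> \<le> 2 * M * \<delta>" using small M0 by (intro mult_left_mono) auto
      finally show "(\<Sum>(a, b)\<in>D. \<bar>heat_coeff g k b - heat_coeff g k a\<bar>) \<le> min (4 * M / eigenval k) (4 * M * \<delta>)"
        using le 1 by (simp add: min_def)
    next
      show "summable (\<lambda>k. \<Sum>(a, b)\<in>D. \<bar>heat_coeff g k b - heat_coeff g k a\<bar>)"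
        unfolding case_prod_beta by (intro summable_sum heat_increment_summable)
      show "summable (\<lambda>k. min (4 * M / eigenval k) (4 * M * \<delta>))"
        by (rule summable_comparison_test'[OF summable_inverse_eigenval[of "4 * M"]])
           (use M0 \<delta>(1) in \<open>auto simp: less_imp_le\<close>)
    qed
    also note \<delta>(2)
    finally show "(\<Sum>(a, b)\<in>D. L2_dist (u b) (u a)) < \<epsilon>" .
  qed
qed

text \<open>Hoelder exponent \<open>3/4\<close> bounds the coefficients of \<open>u\<^sub>t\<close> by a multiple of
  \<open>eigenval k powr - (3/4)\<close>, which is summable; any exponent above \<open>1/2\<close> would do.\<close>

lemma heat_sol_time_derivative:
  assumes H: "\<And>s. \<bar>m s - m t\<bar> \<le> C * \<bar>s - t\<bar> powr (3/4)"
  defines "a \<equiv> \<lambda>k. sine_coeff (g t) k - eigenval k * heat_coeff g k t"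
  shows "summable (\<lambda>k. \<bar>a k\<bar>)"
    and "((\<lambda>s. \<Sum>k. \<bar>(heat_coeff g k s - heat_coeff g k t) / (s - t) - a k\<bar>) \<longlongrightarrow> 0) (at t)"
    and "s \<noteq> t \<Longrightarrow> \<bar>(heat_sol g s x - heat_sol g t x) / (s - t) - (\<Sum>k. a k * sine k x)\<bar> \<le>
       (\<Sum>k. \<bar>(heat_coeff g k s - heat_coeff g k t) / (s - t) - a k\<bar>)"
    and "s \<noteq> t \<Longrightarrow> summable (\<lambda>k. \<bar>(heat_coeff g k s - heat_coeff g k t) / (s - t) - a k\<bar>)"
proof -
  define \<eta> where "\<eta> k s = sine_coeff (g s) k - sine_coeff (g t) k" for k s
  note [measurable] = source_coeff_measurable[OF g]
  have \<eta>m: "\<eta> k \<in> borel_measurable borel" for k unfolding \<eta>_def by measurable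
  have \<eta>b: "\<bar>\<eta> k s\<bar> \<le> 4 * B" for k s
    using source_coeff_bound[OF g, of s k] source_coeff_bound[OF g, of t k] by (simp add: \<eta>_def)
  have \<eta>H: "\<bar>\<eta> k s\<bar> \<le> 2 * C * \<bar>s - t\<bar> powr (3/4)" for k s
    using source_coeff_increment[of s k t] H[of s] by (simp add: \<eta>_def)
  have C0: "C \<ge> 0" using H[of "t + 1"] by simp
  have hc: "exp_conv (eigenval k) (\<eta> k) s = heat_coeff g k s - sine_coeff (g t) k / eigenval k" for k s
    unfolding \<eta>_def heat_coeff_def
    by (subst exp_conv_diff[where B = "2 * B" and C = "\<bar>sine_coeff (g t) k\<bar>"])
       (auto simp: exp_conv_const source_coeff_bound[OF g])
  have a: "a k = - eigenval k * exp_conv (eigenval k) (\<eta> k) t" for k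
    unfolding hc a_def using eigenval_pos[of k] by (simp add: right_diff_distrib)
  have diff: "heat_coeff g k s - heat_coeff g k t = exp_conv (eigenval k) (\<eta> k) s - exp_conv (eigenval k) (\<eta> k) t" for k s
    unfolding hc by simp
  have ab: "\<bar>a k\<bar> \<le> 16 * C * eigenval k powr - (3/4)" for k
    using mult_left_mono[OF exp_conv_Hoelder_bound[OF eigenval_pos[of k] \<eta>m[of k] \<eta>b \<eta>H, of t], of "eigenval k"] eigenval_pos[of k]
    by (simp add: a abs_mult abs_of_pos[OF eigenval_pos] field_simps)
  have qb: "\<bar>(heat_coeff g k s - heat_coeff g k t) / (s - t)\<bar> \<le> 40 * C * eigenval k powr - (3/4)" if "s \<noteq> t" for k s
    using exp_conv_Hoelder_quotient(1)[OF eigenval_pos[of k] \<eta>m[of k] \<eta>b \<eta>H that] by (simp add: diff)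
  have b: "\<bar>(heat_coeff g k s - heat_coeff g k t) / (s - t) - a k\<bar> \<le> 56 * C * eigenval k powr - (3/4)" if "s \<noteq> t" for k s
    using ab[of k] qb[OF that, of k] by linarith
  show sa: "summable (\<lambda>k. \<bar>a k\<bar>)"
    by (rule summable_comparison_test'[OF summable_eigenval_powr[of "16 * C"]]) (use ab in auto)
  have sq: "summable (\<lambda>k. \<bar>(heat_coeff g k s - heat_coeff g k t) / (s - t) - a k\<bar>)" if "s \<noteq> t" for s
    by (rule summable_comparison_test'[OF summable_eigenval_powr[of "56 * C"]]) (use b[OF that] in auto)
  then show "s \<noteq> t \<Longrightarrow> summable (\<lambda>k. \<bar>(heat_coeff g k s - heat_coeff g k t) / (s - t) - a k\<bar>)" .
  have "((\<lambda>s. \<Sum>k. \<bar>(heat_coeff g k s - heat_coeff g k t) / (s - t) - a k\<bar>) \<longlongrightarrow> (\<Sum>k. 0)) (at t)"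
  proof (rule suminf_tendsto_dominated[OF _ _ summable_eigenval_powr[of "56 * C"]])
    fix k
    have "((\<lambda>s. (heat_coeff g k s - heat_coeff g k t) / (s - t)) \<longlongrightarrow> a k) (at t)"
      using exp_conv_Hoelder_quotient(2)[OF eigenval_pos[of k] \<eta>m[of k] \<eta>b \<eta>H] by (simp add: diff a)
    then have "((\<lambda>s. \<bar>(heat_coeff g k s - heat_coeff g k t) / (s - t) - a k\<bar>) \<longlongrightarrow> \<bar>a k - a k\<bar>) (at t)"
      by (intro tendsto_intros)
    then show "((\<lambda>s. \<bar>(heat_coeff g k s - heat_coeff g k t) / (s - t) - a k\<bar>) \<longlongrightarrow> 0) (at t)" by simp
    show "\<forall>\<^sub>F s in at t. \<forall>k. \<bar>\<bar>(heat_coeff g k s - heat_coeff g k t) / (s - t) - a k\<bar>\<bar> \<le> 56 * C * eigenval k powr - (3/4)"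
      using b by (auto simp: eventually_at_filter)
  qed
  then show "((\<lambda>s. \<Sum>k. \<bar>(heat_coeff g k s - heat_coeff g k t) / (s - t) - a k\<bar>) \<longlongrightarrow> 0) (at t)" by simp
  assume st: "s \<noteq> t"
  have s1: "summable (\<lambda>k. (heat_coeff g k s - heat_coeff g k t) * sine k x)"
    by (intro sine_series_summable heat_increment_summable)
  have "(heat_sol g s x - heat_sol g t x) / (s - t) = (\<Sum>k. (heat_coeff g k s - heat_coeff g k t) * sine k x / (s - t))"
    unfolding suminf_divide[OF s1] unfolding heat_sol_def left_diff_distrib
    by (subst suminf_diff) (auto intro!: sine_series_summable heat_coeff_summable[OF g])
  then have "(heat_sol g s x - heat_sol g t x) / (s - t) - (\<Sum>k. a k * sine k x) =
     (\<Sum>k. ((heat_coeff g k s - heat_coeff g k t) / (s - t) - a k) * sine k x)"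
    using suminf_diff[OF summable_divide[OF s1, of "s - t"] sine_series_summable[OF sa, of x]]
    by (simp add: left_diff_distrib diff_divide_distrib)
  then show "\<bar>(heat_sol g s x - heat_sol g t x) / (s - t) - (\<Sum>k. a k * sine k x)\<bar> \<le>
       (\<Sum>k. \<bar>(heat_coeff g k s - heat_coeff g k t) / (s - t) - a k\<bar>)"
    using sine_series_bound[OF sq[OF st], of x] by simp
qed

lemma source_L2: "g t \<in> L2"
  using source_slice_I01[OF g] source_bound[OF g] by (intro L2_bounded[of _ B]) auto

text \<open>Boundedness trades one factor of the squared difference for \<open>2 * B\<close>, so
  variation in L1 controls the squared distance in L2.\<close>

lemma source_L2_dist: "(L2_dist (g s) (g t))\<^sup>2 \<le> 2 * B * \<bar>m s - m t\<bar>"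
proof -
  have [measurable]: "g r \<in> borel_measurable I01" for r by (rule source_slice_I01[OF g])
  have b: "\<bar>g s x - g t x\<bar> \<le> 2 * B" for x
    using source_bound[OF g, of s x] source_bound[OF g, of t x] by linarith
  have int: "integrable I01 (\<lambda>x. \<bar>g s x - g t x\<bar>)"
    using source_integrable[OF g] by simp
  have "(LINT x|I01. (g s x - g t x)\<^sup>2) \<le> (LINT x|I01. 2 * B * \<bar>g s x - g t x\<bar>)"
  proof (rule integral_mono_AE')
    have "(g s x - g t x)\<^sup>2 \<le> 2 * B * \<bar>g s x - g t x\<bar>" for x
      using mult_right_mono[OF b[of x], of "\<bar>g s x - g t x\<bar>"] by (simp add: power2_eq_square flip: abs_mult)
    then show "AE x in I01. (g s x - g t x)\<^sup>2 \<le> 2 * B * \<bar>g s x - g t x\<bar>" by simp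
  qed (use int source_nonneg[OF g] in auto)
  also have "\<dots> \<le> 2 * B * \<bar>m s - m t\<bar>"
    using bv[of s t] source_nonneg[OF g] by (simp add: mult_left_mono)
  finally show ?thesis by (simp add: L2_dist_def L2_norm_def)
qed

text \<open>Sampling \<open>g\<close> at the dyadic time just below \<open>t\<close> takes finitely
  many values on a bounded interval. The samples converge in L2 wherever \<open>m\<close> is
  continuous, and a monotone function has only countably many discontinuities.\<close>

lemma source_Bochner: "g \<in> L2_Bochner {0<..<T}"
proof -
  have sm: "L2_strongly_measurable_on {0<..<T} g"
    unfolding L2_strongly_measurable_on_def
  proof (intro exI[of _ "\<lambda>n t. g (real_of_int \<lfloor>2 ^ n * t\<rfloor> / 2 ^ n)"] conjI allI ballI)
    fix n :: nat
    have "simple_function (lebesgue_on {0<..<T}) (\<lambda>t. \<lfloor>2 ^ n * t\<rfloor>)"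
      unfolding simple_function_def
    proof (intro conjI ballI)
      have "(\<lambda>t. \<lfloor>2 ^ n * t\<rfloor>) ` {0<..<T} \<subseteq> {0..\<lfloor>2 ^ n * T\<rfloor>}"
        by (auto intro!: floor_mono)
      then show "finite ((\<lambda>t. \<lfloor>2 ^ n * t\<rfloor>) ` space (lebesgue_on {0<..<T}))"
        by (simp add: finite_subset[OF _ finite_atLeastAtMost_int])
      fix i :: int
      have "(\<lambda>t. \<lfloor>2 ^ n * t\<rfloor>) -` {i} \<inter> {0<..<T} = {real_of_int i / 2 ^ n..<(real_of_int i + 1) / 2 ^ n} \<inter> {0<..<T}"
        by (auto simp: floor_eq_iff pos_divide_le_eq pos_less_divide_eq mult.commute)
      then show "(\<lambda>t. \<lfloor>2 ^ n * t\<rfloor>) -` {i} \<inter> space (lebesgue_on {0<..<T}) \<in> sets (lebesgue_on {0<..<T})"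
        by (simp add: sets_restrict_space_iff)
    qed
    from simple_function_compose[OF this, of "\<lambda>i. g (real_of_int i / 2 ^ n)"]
    show "simple_function (lebesgue_on {0<..<T}) (\<lambda>t. g (real_of_int \<lfloor>2 ^ n * t\<rfloor> / 2 ^ n))"
      by (simp add: comp_def)
    show "g (real_of_int \<lfloor>2 ^ n * t\<rfloor> / 2 ^ n) \<in> L2" for t by (rule source_L2)
  next
    have conv: "(\<lambda>n. L2_dist (g (real_of_int \<lfloor>2 ^ n * t\<rfloor> / 2 ^ n)) (g t)) \<longlonglongrightarrow> 0" if t: "isCont m t" for t
    proof -
      define r where "r n = real_of_int \<lfloor>2 ^ n * t\<rfloor> / 2 ^ n" for n :: nat
      have "r \<longlonglongrightarrow> t"
      proof (rule Lim_null[THEN iffD2], rule Lim_null_comparison[OF always_eventually])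
        show "\<forall>n. norm (r n - t) \<le> (1/2) ^ n"
        proof
          fix n
          have "\<bar>real_of_int \<lfloor>2 ^ n * t\<rfloor> - 2 ^ n * t\<bar> \<le> 1" by linarith
          moreover have "r n - t = (real_of_int \<lfloor>2 ^ n * t\<rfloor> - 2 ^ n * t) / 2 ^ n"
            by (simp add: r_def diff_divide_distrib)
          ultimately show "norm (r n - t) \<le> (1/2) ^ n"
            by (simp add: power_divide divide_right_mono)
        qed
        show "(\<lambda>n. (1/2::real) ^ n) \<longlonglongrightarrow> 0" by (rule LIMSEQ_power_zero) simp
      qed
      then have "(\<lambda>n. m (r n)) \<longlonglongrightarrow> m t" by (rule isCont_tendsto_compose[OF t])
      then have "(\<lambda>n. sqrt (2 * B * \<bar>m (r n) - m t\<bar>)) \<longlonglongrightarrow> sqrt (2 * B * \<bar>m t - m t\<bar>)"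
        by (intro tendsto_intros)
      then have lim: "(\<lambda>n. sqrt (2 * B * \<bar>m (r n) - m t\<bar>)) \<longlonglongrightarrow> 0" by simp
      have "(\<lambda>n. L2_dist (g (r n)) (g t)) \<longlonglongrightarrow> 0"
        by (rule Lim_null_comparison[OF always_eventually lim])
           (auto simp: L2_dist_nonneg intro!: real_le_rsqrt source_L2_dist)
      then show ?thesis by (simp add: r_def)
    qed
    have "negligible {t. \<not> isCont m t}"
      using countable_imp_null_set_lborel[OF mono_ctble_discont[OF m(1)]]
      by (simp add: negligible_iff_null_sets null_sets_completionI)
    then have "AE t in lebesgue. t \<notin> {t. \<not> isCont m t}"
      by (intro AE_not_in) (simp add: negligible_iff_null_sets)
    then show "AE t in lebesgue_on {0<..<T}. (\<lambda>n. L2_dist (g (real_of_int \<lfloor>2 ^ n * t\<rfloor> / 2 ^ n)) (g t)) \<longlonglongrightarrow> 0"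
      by (subst AE_restrict_space_iff) (auto elim!: eventually_mono intro: conv)
  qed
  have norm_sq: "(L2_norm (g t))\<^sup>2 = (LINT x|I01. (g t x)\<^sup>2)" for t
    by (simp add: L2_norm_def)
  have [measurable]: "(\<lambda>t. LINT x|I01. (g t x)\<^sup>2) \<in> borel_measurable borel"
  proof (rule I01.borel_measurable_lebesgue_integral)
    have "(\<lambda>(t, x). g t x) \<circ> (\<lambda>z. (fst z, snd z)) \<in> borel_measurable (borel \<Otimes>\<^sub>M I01)"
    proof (rule measurable_comp[OF _ source_measurable[OF g]])
      show "(\<lambda>z. (fst z, snd z)) \<in> borel \<Otimes>\<^sub>M I01 \<rightarrow>\<^sub>M borel \<Otimes>\<^sub>M borel"
        using measurable_compose[OF measurable_snd measurable_ident_I01] by (intro measurable_Pair) auto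
    qed
    then have [measurable]: "(\<lambda>z. g (fst z) (snd z)) \<in> borel_measurable (borel \<Otimes>\<^sub>M I01)"
      by (simp add: comp_def case_prod_beta)
    show "(\<lambda>(t, x). (g t x)\<^sup>2) \<in> borel_measurable (borel \<Otimes>\<^sub>M I01)"
      unfolding case_prod_beta by measurable
  qed
  interpret fin: finite_measure "lebesgue_on {0<..<T}"
    by standard (cases "0 \<le> T"; simp add: emeasure_restrict_space)
  have "integrable (lebesgue_on {0<..<T}) (\<lambda>t. (L2_norm (g t))\<^sup>2)"
    unfolding norm_sq
  proof (rule fin.integrable_const_bound[of _ "B\<^sup>2"])
    have "L2_norm (g t) \<le> B" for t
      using source_bound[OF g] source_nonneg[OF g] by (intro L2_norm_le) auto
    then have "(L2_norm (g t))\<^sup>2 \<le> B\<^sup>2" for t by (intro power_mono L2_norm_nonneg)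
    then show "AE t in lebesgue_on {0<..<T}. norm (LINT x|I01. (g t x)\<^sup>2) \<le> B\<^sup>2"
      by (simp add: norm_sq)
    show "(\<lambda>t. LINT x|I01. (g t x)\<^sup>2) \<in> borel_measurable (lebesgue_on {0<..<T})"
      by (intro measurable_restrict_space1 measurable_completion) measurable
  qed
  then show ?thesis using sm source_L2 by (simp add: L2_Bochner_def)
qed

end

section \<open>Weak derivatives and boundary values\<close>

text \<open>Truncating the integrand, with the domain of integration kept fixed, prepares the use of
  Fubini on the product of \<open>I01\<close> with itself; the value at 0 is 0.\<close>

definition primitive :: "(real \<Rightarrow> real) \<Rightarrow> real \<Rightarrow> real" where
  "primitive h x = (LINT y|I01. (if y < x then h y else 0))"

lemma measurable_truncation:
  fixes h :: "real \<Rightarrow> real"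
  assumes "h \<in> borel_measurable I01"
  shows "(\<lambda>y. if y < x then h y else 0) \<in> borel_measurable I01"
  using assms measurable_ident_I01 by measurable

lemma integrable_truncation:
  fixes h :: "real \<Rightarrow> real"
  assumes "h \<in> borel_measurable I01" "\<And>y. y \<in> {0<..<1} \<Longrightarrow> \<bar>h y\<bar> \<le> B"
  shows "integrable I01 (\<lambda>y. if y < x then h y else 0)"
proof (rule integrable_I01_bounded[OF measurable_truncation[OF assms(1)], of _ "\<bar>B\<bar>"])
  show "\<bar>if y < x then h y else 0\<bar> \<le> \<bar>B\<bar>" if "y \<in> {0<..<1}" for y
    using assms(2)[OF that] by auto
qed

lemma DERIV_cong_open:
  assumes "(g has_real_derivative D) (at x)" "open S" "x \<in> S" "\<And>y. y \<in> S \<Longrightarrow> f y = g y"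
  shows "(f has_real_derivative D) (at x)"
  using has_field_derivative_transform_within_open[OF assms(1-3)] assms(4) by metis

lemma primitive_eq:
  assumes P: "\<And>x. x \<in> {0<..<1} \<Longrightarrow> (P has_real_derivative p x) (at x)"
    and c: "continuous_on {0..1} P" "continuous_on {0..1} p" and x: "x \<in> {0..1}"
  shows "primitive p x = P x - P 0"
proof -
  \<comment> \<open>Truncating \<open>p\<close> at \<open>x\<close> amounts to freezing
    \<open>P\<close> beyond \<open>x\<close>; the kink at \<open>x\<close> is the exceptional point
    of the fundamental theorem.\<close>
  have "primitive p x = P (min x 1) - P (min x 0)"
    unfolding primitive_def
  proof (rule integral_I01_FTC[of "{x}"])
    show "continuous_on {0..1} (\<lambda>y. P (min x y))"
      by (rule continuous_on_compose2[OF c(1)]) (use x in \<open>auto intro!: continuous_intros\<close>)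
    obtain B where "\<And>y. y \<in> {0..1} \<Longrightarrow> \<bar>p y\<bar> \<le> B"
      using compact_imp_bounded[OF compact_continuous_image[OF c(2)]] by (force simp: bounded_iff)
    then show "integrable I01 (\<lambda>y. if y < x then p y else 0)"
      by (intro integrable_truncation[of _ B] continuous_on_imp_I01 continuous_on_subset[OF c(2)]) auto
    fix y assume y: "y \<in> {0<..<1} - {x}"
    show "((\<lambda>y. P (min x y)) has_real_derivative (if y < x then p y else 0)) (at y)"
    proof (cases "y < x")
      case True
      then show ?thesis using P[of y] y by - (rule DERIV_cong_open[of P _ _ "{..<x}"], auto)
    next
      case False
      then show ?thesis using y by - (rule DERIV_cong_open[of "\<lambda>_. P x" _ _ "{x<..}"], auto)
    qed
  qed simp
  moreover have "min x 1 = x" "min x 0 = 0" using x by auto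
  ultimately show ?thesis by simp
qed

lemma integral_I01_window:
  assumes "0 \<le> a" "a \<le> b" "b \<le> 1"
  shows "(LINT y|I01. (if a \<le> y \<and> y < b then 1 else 0)) = b - (a::real)"
proof -
  have p: "primitive (\<lambda>_. 1) x = x" if "x \<in> {0..1}" for x
    using primitive_eq[of "\<lambda>x. x" "\<lambda>_. 1" x] that by simp
  have i: "integrable I01 (\<lambda>y. if y < x then 1 else 0 :: real)" for x
    by (rule integrable_truncation[of "\<lambda>_. 1" 1]) auto
  have "(LINT y|I01. (if a \<le> y \<and> y < b then 1 else 0)) =
      (LINT y|I01. (if y < b then 1 else 0) - (if y < a then 1 else 0 :: real))"
    using assms by (intro Bochner_Integration.integral_cong) auto
  also have "\<dots> = b - a"
    using i p[of a] p[of b] assms by (simp add: primitive_def)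
  finally show ?thesis .
qed

lemma primitive_diff_le:
  assumes h: "h \<in> borel_measurable I01" "\<And>y. y \<in> {0<..<1} \<Longrightarrow> \<bar>h y\<bar> \<le> B"
    and f: "f \<in> borel_measurable I01" "\<And>y. y \<in> {0<..<1} \<Longrightarrow> \<bar>f y\<bar> \<le> C"
    and e: "\<And>y. y \<in> {0<..<1} \<Longrightarrow> \<bar>h y - f y\<bar> \<le> e"
  shows "\<bar>primitive h x - primitive f x\<bar> \<le> e"
proof -
  have e0: "e \<ge> 0" using e[of "1/2"] by force
  note i = integrable_truncation[OF h] integrable_truncation[OF f]
  have "\<bar>LINT y|I01. (if y < x then h y else 0) - (if y < x then f y else 0)\<bar> \<le> (LINT y|I01. e)"
  proof (rule integral_abs_bound[THEN order_trans], rule integral_mono_AE)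
    show "AE y in I01. \<bar>(if y < x then h y else 0) - (if y < x then f y else 0)\<bar> \<le> e"
      using e e0 by (intro AE_I2) auto
  qed (use i in auto)
  then show ?thesis unfolding primitive_def using i by simp
qed

context
  fixes h :: "real \<Rightarrow> real" and B :: real
  assumes h: "h \<in> borel_measurable I01" "\<And>y. y \<in> {0<..<1} \<Longrightarrow> \<bar>h y\<bar> \<le> B"
begin

lemma primitive_bound: "\<bar>primitive h x\<bar> \<le> B"
  using primitive_diff_le[OF h, of "\<lambda>_. 0" 0 B x] h(2) by (simp add: primitive_def)

lemma primitive_Lipschitz:
  assumes "0 \<le> a" "a \<le> b" "b \<le> 1"
  shows "\<bar>primitive h b - primitive h a\<bar> \<le> B * (b - a)"
proof -
  note i = integrable_truncation[OF h]
  have "\<bar>LINT y|I01. (if y < b then h y else 0) - (if y < a then h y else 0)\<bar> \<le>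
     (LINT y|I01. B * (if a \<le> y \<and> y < b then 1 else 0))"
  proof (rule integral_abs_bound[THEN order_trans], rule integral_mono_AE)
    show "integrable I01 (\<lambda>y. \<bar>(if y < b then h y else 0) - (if y < a then h y else 0)\<bar>)"
      using i by auto
    show "integrable I01 (\<lambda>y. B * (if a \<le> y \<and> y < b then 1 else 0))"
      using measurable_ident_I01 by (intro integrable_mult_right integrable_I01_bounded[of _ 1]) (measurable, auto)
    show "AE y in I01. \<bar>(if y < b then h y else 0) - (if y < a then h y else 0)\<bar> \<le> B * (if a \<le> y \<and> y < b then 1 else 0)"
      using h(2) assms by (intro AE_I2) auto
  qed
  also have "\<dots> = B * (b - a)" using integral_I01_window[OF assms] by simp
  finally show ?thesis unfolding primitive_def using i by simp
qed

lemma primitive_continuous: "continuous_on {0..1} (primitive h)"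
proof -
  have "B-lipschitz_on {0..1} (primitive h)"
  proof (rule lipschitz_onI)
    show "B \<ge> 0" using h(2)[of "1/2"] by force
    fix x y :: real assume "x \<in> {0..1}" "y \<in> {0..1}"
    then show "dist (primitive h x) (primitive h y) \<le> B * dist x y"
      using primitive_Lipschitz[of x y] primitive_Lipschitz[of y x]
      by (cases "x \<le> y") (auto simp: dist_real_def abs_minus_commute)
  qed
  then show ?thesis by (rule lipschitz_on_continuous_on)
qed

lemma primitive_measurable: "primitive h \<in> borel_measurable I01"
  by (intro continuous_on_imp_I01 continuous_on_subset[OF primitive_continuous]) auto

text \<open>Since \<open>h\<close> is merely bounded and measurable, \<open>primitive h\<close> need
  not be differentiable everywhere; integration by parts is obtained by exchanging the integrals
  over the triangle \<open>y < x\<close>.\<close>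

lemma integral_primitive_by_parts:
  assumes \<phi>: "\<And>x. (\<phi> has_real_derivative \<phi>' x) (at x)" and c: "continuous_on UNIV \<phi>'"
  shows "(LINT x|I01. primitive h x * \<phi>' x) = \<phi> 1 * (LINT x|I01. h x) - (LINT x|I01. h x * \<phi> x)"
proof -
  have c\<phi>: "continuous_on A \<phi>" for A
    using \<phi> by (meson DERIV_isCont continuous_at_imp_continuous_on)
  obtain K where K: "\<And>y. y \<in> {0..1} \<Longrightarrow> \<bar>\<phi>' y\<bar> \<le> K"
    using compact_imp_bounded[OF compact_continuous_image[OF continuous_on_subset[OF c, of "{0..1}"]]] by (force simp: bounded_iff)
  have [measurable]: "\<phi>' \<in> borel_measurable borel" using c by (rule borel_measurable_continuous_onI)
  have [measurable]: "\<phi>' \<in> borel_measurable I01" by (rule borel_imp_I01) measurable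
  interpret pair_sigma_finite I01 I01 ..
  interpret P: finite_measure "I01 \<Otimes>\<^sub>M I01"
    by (rule finite_measure_pair_measure) (rule I01.finite_measure_axioms)+
  define f where "f y x = (if y < x then h y * \<phi>' x else 0)" for y x
  have int: "integrable (I01 \<Otimes>\<^sub>M I01) (case_prod f)"
  proof (rule P.integrable_const_bound[of _ "B * K"])
    have B0: "B \<ge> 0" using h(2)[of "1/2"] by force
    have "\<bar>f y x\<bar> \<le> B * K" if "y \<in> {0<..<1}" "x \<in> {0<..<1}" for x y
    proof -
      have "\<bar>h y\<bar> * \<bar>\<phi>' x\<bar> \<le> B * K" using h(2)[of y] K[of x] that B0 by (intro mult_mono) auto
      moreover have "0 \<le> \<bar>h y\<bar> * \<bar>\<phi>' x\<bar>" by simp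
      ultimately have "\<bar>h y\<bar> * \<bar>\<phi>' x\<bar> \<le> B * K" "0 \<le> B * K" by linarith+
      then show ?thesis unfolding f_def by (auto simp: abs_mult)
    qed
    then show "AE z in I01 \<Otimes>\<^sub>M I01. norm (case z of (y, x) \<Rightarrow> f y x) \<le> B * K"
      by (intro AE_I2) (auto simp: space_pair_measure)
    note [measurable] = h(1) measurable_compose[OF measurable_fst measurable_ident_I01] measurable_compose[OF measurable_snd measurable_ident_I01]
    show "case_prod f \<in> borel_measurable (I01 \<Otimes>\<^sub>M I01)"
      unfolding f_def case_prod_beta by measurable
  qed
  have inner: "(LINT x|I01. f y x) = h y * (\<phi> 1 - \<phi> y)" if y: "y \<in> {0<..<1}" for y
  proof -
    have "(LINT x|I01. (if y < x then \<phi>' x else 0)) = \<phi> (max y 1) - \<phi> (max y 0)"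
    proof (rule integral_I01_FTC[of "{y}"])
      show "continuous_on {0..1} (\<lambda>x. \<phi> (max y x))"
        by (rule continuous_on_compose2[OF c\<phi>[of UNIV]]) (auto intro!: continuous_intros)
      show "integrable I01 (\<lambda>x. if y < x then \<phi>' x else 0)"
      proof (rule integrable_I01_bounded[of _ K])
        show "(\<lambda>x. if y < x then \<phi>' x else 0) \<in> borel_measurable I01"
          using measurable_ident_I01 by measurable
        show "\<bar>if y < x then \<phi>' x else 0\<bar> \<le> K" if "x \<in> {0<..<1}" for x
          using K[of x] that by auto
      qed
      fix x assume x: "x \<in> {0<..<1} - {y}"
      show "((\<lambda>x. \<phi> (max y x)) has_real_derivative (if y < x then \<phi>' x else 0)) (at x)"
      proof (cases "y < x")
        case True
        then show ?thesis using \<phi>[of x] by - (rule DERIV_cong_open[of \<phi> _ _ "{y<..}"], auto)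
      next
        case False
        then show ?thesis using x by - (rule DERIV_cong_open[of "\<lambda>_. \<phi> y" _ _ "{..<y}"], auto)
      qed
    qed simp
    then have "(LINT x|I01. (if y < x then \<phi>' x else 0)) = \<phi> 1 - \<phi> y" using y by (simp add: max_def)
    moreover have "(LINT x|I01. f y x) = (LINT x|I01. h y * (if y < x then \<phi>' x else 0))"
      by (intro Bochner_Integration.integral_cong) (auto simp: f_def)
    ultimately show ?thesis by simp
  qed
  have ih: "integrable I01 h" using h by (rule integrable_I01_bounded)
  have ih\<phi>: "integrable I01 (\<lambda>x. h x * \<phi> x)"
  proof -
    obtain L where L: "\<And>y. y \<in> {0..1} \<Longrightarrow> \<bar>\<phi> y\<bar> \<le> L"
      using compact_imp_bounded[OF compact_continuous_image[OF c\<phi>[of "{0..1}"]]] by (force simp: bounded_iff)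
    note [measurable] = h(1) continuous_on_imp_I01[OF c\<phi>]
    show ?thesis
    proof (rule integrable_I01_bounded[of _ "B * L"])
      show "(\<lambda>x. h x * \<phi> x) \<in> borel_measurable I01" by measurable
      show "\<bar>h x * \<phi> x\<bar> \<le> B * L" if "x \<in> {0<..<1}" for x
        unfolding abs_mult using h(2)[OF that] L[of x] that by (intro mult_mono) auto
    qed
  qed
  have "(LINT x|I01. primitive h x * \<phi>' x) = (LINT x|I01. LINT y|I01. f y x)"
  proof (intro Bochner_Integration.integral_cong refl)
    fix x
    have "primitive h x * \<phi>' x = (LINT y|I01. (if y < x then h y else 0) * \<phi>' x)"
      unfolding primitive_def by simp
    also have "\<dots> = (LINT y|I01. f y x)"
      by (intro Bochner_Integration.integral_cong) (auto simp: f_def)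
    finally show "primitive h x * \<phi>' x = (LINT y|I01. f y x)" .
  qed
  also have "\<dots> = (LINT y|I01. LINT x|I01. f y x)"
    by (rule Fubini_integral[OF int])
  also have "\<dots> = (LINT y|I01. h y * (\<phi> 1 - \<phi> y))"
    by (intro Bochner_Integration.integral_cong) (auto simp: inner)
  also have "\<dots> = (LINT y|I01. \<phi> 1 * h y - h y * \<phi> y)" by (simp add: algebra_simps)
  also have "\<dots> = \<phi> 1 * (LINT x|I01. h x) - (LINT x|I01. h x * \<phi> x)"
    using ih ih\<phi> by simp
  finally show ?thesis .
qed

end

section \<open>Smooth functions\<close>

definition smooth :: "(real \<Rightarrow> real) \<Rightarrow> bool" where
  "smooth f \<longleftrightarrow> (\<forall>k x. (deriv ^^ k) f differentiable at x)"

text \<open>A class of differentiable functions closed under \<open>deriv\<close> consists of smooth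
  functions; this spares formulas for higher derivatives.\<close>

lemma smooth_coinduct:
  assumes "X f" "\<And>f. X f \<Longrightarrow> (\<forall>x. f differentiable at x) \<and> X (deriv f)"
  shows "smooth f"
proof -
  have "X ((deriv ^^ k) f)" for k by (induction k) (auto simp: assms)
  then show ?thesis unfolding smooth_def using assms(2) by blast
qed

lemma smooth_DERIV: "smooth f \<Longrightarrow> (f has_real_derivative deriv f x) (at x)"
  unfolding smooth_def DERIV_deriv_iff_real_differentiable by (metis funpow_0)

lemma smooth_deriv: "smooth f \<Longrightarrow> smooth (deriv f)"
  unfolding smooth_def by (metis comp_apply funpow_Suc_right)

lemma smooth_continuous: "smooth f \<Longrightarrow> continuous_on A f"
  using smooth_DERIV by (meson DERIV_isCont continuous_at_imp_continuous_on)

lemma smooth_coinduct_DERIV: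
  assumes "X f" "\<And>f. X f \<Longrightarrow> \<exists>f'. (\<forall>x. (f has_real_derivative f' x) (at x)) \<and> X f'"
  shows "smooth f"
proof (rule smooth_coinduct[of X, OF assms(1)])
  fix f assume "X f"
  then obtain f' where f': "\<And>x. (f has_real_derivative f' x) (at x)" "X f'" using assms(2) by blast
  then have "deriv f = f'" by (auto intro: DERIV_imp_deriv)
  then show "(\<forall>x. f differentiable at x) \<and> X (deriv f)"
    using f' by (auto simp: real_differentiable_def)
qed

lemma smooth_const: "smooth (\<lambda>_. c)"
  by (rule smooth_coinduct_DERIV[of "\<lambda>f. \<exists>c. f = (\<lambda>_. c)"]) (auto intro!: exI[of _ "\<lambda>_. 0"])

lemma smooth_add:
  assumes "smooth f" "smooth g" shows "smooth (\<lambda>x. f x + g x)"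
proof (rule smooth_coinduct_DERIV[of "\<lambda>u. \<exists>f g. smooth f \<and> smooth g \<and> u = (\<lambda>x. f x + g x)"])
  fix u :: "real \<Rightarrow> real" assume "\<exists>f g. smooth f \<and> smooth g \<and> u = (\<lambda>x. f x + g x)"
  then obtain f g where "smooth f" "smooth g" "u = (\<lambda>x. f x + g x)" by blast
  then show "\<exists>u'. (\<forall>x. (u has_real_derivative u' x) (at x)) \<and> (\<exists>f g. smooth f \<and> smooth g \<and> u' = (\<lambda>x. f x + g x))"
    by (intro exI[of _ "\<lambda>x. deriv f x + deriv g x"]) (auto intro: DERIV_add smooth_DERIV smooth_deriv)
qed (use assms in blast)

lemma smooth_sum: "finite A \<Longrightarrow> (\<And>i. i \<in> A \<Longrightarrow> smooth (f i)) \<Longrightarrow> smooth (\<lambda>x. \<Sum>i\<in>A. f i x)"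
  by (induction rule: finite_induct) (auto intro: smooth_const smooth_add)

text \<open>Leibniz' rule leads out of the products but not out of their sums, so this is the class
  to which coinduction is applied.\<close>

inductive sum_of_smooth_products :: "(real \<Rightarrow> real) \<Rightarrow> bool" where
  prod: "smooth f \<Longrightarrow> smooth g \<Longrightarrow> sum_of_smooth_products (\<lambda>x. f x * g x)"
| add: "sum_of_smooth_products u \<Longrightarrow> sum_of_smooth_products v \<Longrightarrow> sum_of_smooth_products (\<lambda>x. u x + v x)"

lemma smooth_mult:
  assumes "smooth f" "smooth g" shows "smooth (\<lambda>x. f x * g x)"
proof (rule smooth_coinduct_DERIV[of sum_of_smooth_products])
  fix u assume "sum_of_smooth_products u"
  then show "\<exists>u'. (\<forall>x. (u has_real_derivative u' x) (at x)) \<and> sum_of_smooth_products u'"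
  proof induction
    case (prod f g)
    then show ?case
      by (intro exI[of _ "\<lambda>x. deriv f x * g x + deriv g x * f x"] conjI allI)
         (auto intro!: DERIV_mult smooth_DERIV smooth_deriv sum_of_smooth_products.intros)
  next
    case (add u v)
    then obtain u' v' where "\<And>x. (u has_real_derivative u' x) (at x)" "sum_of_smooth_products u'"
      "\<And>x. (v has_real_derivative v' x) (at x)" "sum_of_smooth_products v'" by blast
    then show ?case
      by (intro exI[of _ "\<lambda>x. u' x + v' x"]) (auto intro: DERIV_add sum_of_smooth_products.intros)
  qed
qed (use assms in \<open>auto intro: sum_of_smooth_products.intros\<close>)

lemma smooth_affine:
  assumes "smooth f" shows "smooth (\<lambda>x. f (a * x + b))"
proof (rule smooth_coinduct_DERIV[of "\<lambda>u. \<exists>f c. smooth f \<and> u = (\<lambda>x. c * f (a * x + b))"])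
  show "\<exists>f' c. smooth f' \<and> (\<lambda>x. f (a * x + b)) = (\<lambda>x. c * f' (a * x + b))"
    using assms by (intro exI[of _ f] exI[of _ 1]) auto
  fix u :: "real \<Rightarrow> real" assume "\<exists>f c. smooth f \<and> u = (\<lambda>x. c * f (a * x + b))"
  then obtain f c where f: "smooth f" "u = (\<lambda>x. c * f (a * x + b))" by blast
  have "(u has_real_derivative (c * a) * deriv f (a * x + b)) (at x)" for x
    unfolding f(2) by (auto intro!: derivative_eq_intros DERIV_chain2[OF smooth_DERIV[OF f(1)]])
  then show "\<exists>u'. (\<forall>x. (u has_real_derivative u' x) (at x)) \<and> (\<exists>f c. smooth f \<and> u' = (\<lambda>x. c * f (a * x + b)))"
    using smooth_deriv[OF f(1)] by (intro exI[of _ "\<lambda>x. (c * a) * deriv f (a * x + b)"]) blast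
qed

lemma smooth_ident: "smooth (\<lambda>x. x)"
proof (rule smooth_coinduct_DERIV[of "\<lambda>u. u = (\<lambda>x. x) \<or> smooth u"])
  fix u :: "real \<Rightarrow> real" assume "u = (\<lambda>x. x) \<or> smooth u"
  then show "\<exists>u'. (\<forall>x. (u has_real_derivative u' x) (at x)) \<and> (u' = (\<lambda>x. x) \<or> smooth u')"
  proof
    assume "u = (\<lambda>x. x)"
    then show ?thesis using smooth_const[of 1] by (intro exI[of _ "\<lambda>_. 1"]) auto
  next
    assume "smooth u"
    then show ?thesis using smooth_DERIV smooth_deriv by (intro exI[of _ "deriv u"]) auto
  qed
qed simp

lemma smooth_power: "smooth (\<lambda>x. x ^ n)"
  by (induction n) (auto intro: smooth_const smooth_mult smooth_ident)

text \<open>For \<open>j = 0\<close> the classical smooth function that vanishes to infinite order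
  at 0; the powers of \<open>inverse x\<close> are included so that derivatives are combinations of
  members of the family.\<close>

definition flat :: "nat \<Rightarrow> real \<Rightarrow> real" where
  "flat j x = (if x > 0 then inverse x ^ j * exp (- inverse x) else 0)"

lemma DERIV_flat: "(flat j has_real_derivative flat (j + 2) x - real j * flat (j + 1) x) (at x)"
proof -
  consider "x > 0" | "x < 0" | "x = 0" by linarith
  then show ?thesis
  proof cases
    case 1
    then have "((\<lambda>y. inverse y ^ j * exp (- inverse y)) has_real_derivative flat (j + 2) x - real j * flat (j + 1) x) (at x)"
    proof -
      have "((\<lambda>y. inverse y ^ j * exp (- inverse y)) has_real_derivative
          real j * inverse x ^ (j - 1) * (- (inverse x)\<^sup>2) * exp (- inverse x) +
          inverse x ^ j * (exp (- inverse x) * (inverse x)\<^sup>2)) (at x)"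
        using 1 by (auto intro!: derivative_eq_intros simp: power2_eq_square)
      moreover have "real j * inverse x ^ (j - 1) * (- (inverse x)\<^sup>2) * exp (- inverse x) +
          inverse x ^ j * (exp (- inverse x) * (inverse x)\<^sup>2) = flat (j + 2) x - real j * flat (j + 1) x"
        using 1 by (cases j) (simp_all add: flat_def algebra_simps power2_eq_square)
      ultimately show ?thesis by simp
    qed
    then show ?thesis using 1 by - (rule DERIV_cong_open[of _ _ _ "{0<..}"], auto simp: flat_def)
  next
    case 2
    then show ?thesis by - (rule DERIV_cong_open[of "\<lambda>_. 0" _ _ "{..<0}"], auto simp: flat_def)
  next
    case 3
    \<comment> \<open>From the right, the substitution \<open>z = inverse y\<close> turns the
      difference quotient at 0 into \<open>z ^ Suc j / exp z\<close> at infinity.\<close>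
    have "((\<lambda>y. flat j y / y) \<longlongrightarrow> 0) (at 0)"
    proof (rule filterlim_split_at)
      have "\<forall>\<^sub>F y in at_left 0. (0::real) = flat j y / y"
        using eventually_at_left_real[of "-1" "0::real"] by (auto elim!: eventually_mono simp: flat_def)
      then show "((\<lambda>y. flat j y / y) \<longlongrightarrow> 0) (at_left 0)" by (rule tendsto_eventually[OF eventually_mono]) auto
      have "((\<lambda>z. z ^ Suc j / exp z) \<longlongrightarrow> (0::real)) at_top" by (rule tendsto_power_div_exp_0)
      then have "((\<lambda>y. inverse y ^ Suc j / exp (inverse y)) \<longlongrightarrow> (0::real)) (at_right 0)"
        by (rule filterlim_compose[OF _ filterlim_inverse_at_top_right])
      moreover have "\<forall>\<^sub>F y in at_right 0. inverse y ^ Suc j / exp (inverse y) = flat j y / y"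
        using eventually_at_right_less[of "0::real"]
        by eventually_elim (simp add: flat_def exp_minus field_simps)
      ultimately show "((\<lambda>y. flat j y / y) \<longlongrightarrow> 0) (at_right 0)"
        by (rule Lim_transform_eventually)
    qed
    then show ?thesis unfolding 3 has_field_derivative_iff by (simp add: flat_def)
  qed
qed

inductive flat_span :: "(real \<Rightarrow> real) \<Rightarrow> bool" where
  flat: "flat_span (flat j)"
| comb: "flat_span u \<Longrightarrow> flat_span v \<Longrightarrow> flat_span (\<lambda>x. u x - c * v x)"

lemma smooth_flat: "smooth (flat j)"
proof (rule smooth_coinduct_DERIV[of flat_span])
  fix u assume "flat_span u"
  then show "\<exists>u'. (\<forall>x. (u has_real_derivative u' x) (at x)) \<and> flat_span u'"
  proof induction
    case (flat j)
    show ?case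
      by (intro exI[of _ "\<lambda>x. flat (j + 2) x - real j * flat (j + 1) x"] conjI allI DERIV_flat flat_span.intros)
  next
    case (comb u v c)
    then obtain u' v' where "\<And>x. (u has_real_derivative u' x) (at x)" "flat_span u'"
      "\<And>x. (v has_real_derivative v' x) (at x)" "flat_span v'" by blast
    then show ?case
      by (intro exI[of _ "\<lambda>x. u' x - c * v' x"]) (auto intro!: derivative_eq_intros flat_span.intros)
  qed
qed (rule flat_span.flat)

section \<open>Test functions, weak derivatives of primitives, and approximation in H1\<close>

lemma test_functions_iff:
  "\<phi> \<in> test_functions \<longleftrightarrow> smooth \<phi> \<and> compact (closure {x. \<phi> x \<noteq> 0}) \<and> closure {x. \<phi> x \<noteq> 0} \<subseteq> {0<..<1}"
  by (simp add: test_functions_def smooth_def)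

lemma test_function_boundary:
  assumes "\<phi> \<in> test_functions" shows "\<phi> 0 = 0" "\<phi> 1 = 0"
proof -
  have "x \<in> {0<..<1}" if "\<phi> x \<noteq> 0" for x
    using assms that closure_subset[of "{x. \<phi> x \<noteq> 0}"] unfolding test_functions_iff by blast
  from this[of 0] this[of 1] show "\<phi> 0 = 0" "\<phi> 1 = 0" by auto
qed

lemma smooth_I01: "smooth f \<Longrightarrow> f \<in> borel_measurable I01"
  by (intro continuous_on_imp_I01 smooth_continuous)

lemma smooth_bounded:
  assumes "smooth f"
  obtains K where "\<And>x. x \<in> {0..1} \<Longrightarrow> \<bar>f x\<bar> \<le> K" "K \<ge> 0"
proof -
  obtain K where K: "\<And>x. x \<in> {0..1} \<Longrightarrow> \<bar>f x\<bar> \<le> K"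
    using compact_imp_bounded[OF compact_continuous_image[OF smooth_continuous[OF assms, of "{0..1}"]]]
    by (force simp: bounded_iff)
  then show ?thesis using that[of K] K[of 0] by force
qed

text \<open>The constant \<open>c\<close> drops out because the derivative of a test function has
  integral 0; the boundary term of the integration by parts drops out because test functions vanish
  at 1.\<close>

lemma weak_deriv_primitive:
  assumes h: "h \<in> borel_measurable I01" "\<And>y. y \<in> {0<..<1} \<Longrightarrow> \<bar>h y\<bar> \<le> B"
  shows "weak_deriv (\<lambda>x. primitive h x - c) h"
  unfolding weak_deriv_def
proof (intro conjI ballI)
  show "h \<in> L2" using h by (rule L2_bounded)
  show "(\<lambda>x. primitive h x - c) \<in> L2"
  proof (rule L2_bounded[of _ "B + \<bar>c\<bar>"])
    show "(\<lambda>x. primitive h x - c) \<in> borel_measurable I01" using primitive_measurable[OF h] by measurable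
    show "\<bar>primitive h x - c\<bar> \<le> B + \<bar>c\<bar>" for x using primitive_bound[OF h, of x] by linarith
  qed
  fix \<phi> assume \<phi>: "\<phi> \<in> test_functions"
  then have s: "smooth \<phi>" by (simp add: test_functions_iff)
  have cd: "continuous_on A (deriv \<phi>)" for A by (intro smooth_continuous smooth_deriv s)
  have i: "integrable I01 (deriv \<phi>)" by (intro integrable_I01_continuous cd)
  have "(LINT x|I01. deriv \<phi> x) = \<phi> 1 - \<phi> 0"
    by (rule integral_I01_FTC[of "{}"]) (auto intro: smooth_DERIV s i smooth_continuous)
  moreover have "integrable I01 (\<lambda>x. primitive h x * deriv \<phi> x)"
    by (intro integrable_I01_continuous continuous_intros primitive_continuous[OF h] cd)
  ultimately have "(LINT x|I01. (primitive h x - c) * deriv \<phi> x) = (LINT x|I01. primitive h x * deriv \<phi> x)"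
    using i test_function_boundary[OF \<phi>] by (simp add: left_diff_distrib)
  also have "\<dots> = - (LINT x|I01. h x * \<phi> x)"
    using integral_primitive_by_parts[OF h smooth_DERIV[OF s] cd] test_function_boundary[OF \<phi>] by simp
  finally show "(LINT x|I01. (primitive h x - c) * deriv \<phi> x) = - (LINT x|I01. h x * \<phi> x)" .
qed

lemma weak_deriv_cong_AE:
  assumes w: "weak_deriv f f'" and F: "F \<in> borel_measurable I01" "AE x in I01. f x = F x"
  shows "weak_deriv F f'"
proof -
  note [measurable] = F(1)
  have f: "f \<in> L2" using w by (simp add: weak_deriv_def)
  have [measurable]: "f \<in> borel_measurable I01" using f by (simp add: L2_def)
  have "integrable I01 (\<lambda>x. (f x)\<^sup>2) = integrable I01 (\<lambda>x. (F x)\<^sup>2)"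
    using F(2) by (intro integrable_cong_AE) auto
  then have "F \<in> L2" using f F by (simp add: L2_def)
  moreover have "(LINT x|I01. F x * deriv \<phi> x) = (LINT x|I01. f x * deriv \<phi> x)" if "\<phi> \<in> test_functions" for \<phi>
  proof -
    have [measurable]: "deriv \<phi> \<in> borel_measurable I01"
      using that by (intro smooth_I01 smooth_deriv) (simp add: test_functions_iff)
    show ?thesis using F(2) by (intro integral_cong_AE) auto
  qed
  ultimately show ?thesis using w by (simp add: weak_deriv_def)
qed

lemma L2_dist_cong_AE:
  assumes [measurable]: "k \<in> borel_measurable I01" "f \<in> borel_measurable I01" "F \<in> borel_measurable I01"
    and "AE x in I01. f x = F x"
  shows "L2_dist k f = L2_dist k F"
  unfolding L2_dist_def L2_norm_def using assms(4)
  by (intro arg_cong[where f = sqrt] integral_cong_AE) auto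

lemma L2_dist_dominated:
  assumes f: "\<And>n. f n \<in> borel_measurable I01" and F: "F \<in> borel_measurable I01"
    and K: "\<And>n x. x \<in> {0<..<1} \<Longrightarrow> \<bar>f n x - F x\<bar> \<le> K"
    and lim: "\<And>x. x \<in> {0<..<1} \<Longrightarrow> (\<lambda>n. f n x) \<longlonglongrightarrow> F x"
  shows "(\<lambda>n. L2_dist (f n) F) \<longlonglongrightarrow> 0"
proof -
  note [measurable] = f F
  have "(\<lambda>n. LINT x|I01. (f n x - F x)\<^sup>2) \<longlonglongrightarrow> (LINT x|I01. 0)"
  proof (rule integral_I01_tendsto[where w = "\<lambda>_. K\<^sup>2"])
    have "(\<lambda>n. (f n x - F x)\<^sup>2) \<longlonglongrightarrow> (F x - F x)\<^sup>2" if "x \<in> {0<..<1}" for x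
      by (intro tendsto_intros lim that)
    then show "AE x in I01. (\<lambda>n. (f n x - F x)\<^sup>2) \<longlonglongrightarrow> 0" by (intro AE_I2) auto
    show "\<bar>(f n x - F x)\<^sup>2\<bar> \<le> K\<^sup>2" if "x \<in> {0<..<1}" for n x
      using power_mono[OF K[OF that, of n], of 2] by simp
  qed auto
  then have "(\<lambda>n. sqrt (LINT x|I01. (f n x - F x)\<^sup>2)) \<longlonglongrightarrow> sqrt 0"
    by (intro tendsto_intros) simp
  then show ?thesis by (simp add: L2_dist_def L2_norm_def)
qed

lemma L2_dist_triangle_sq:
  assumes "f \<in> borel_measurable I01" "h \<in> borel_measurable I01" "k \<in> borel_measurable I01"
    and b: "\<And>x. x \<in> {0<..<1} \<Longrightarrow> \<bar>f x - h x\<bar> \<le> B" "\<And>x. x \<in> {0<..<1} \<Longrightarrow> \<bar>h x - k x\<bar> \<le> C"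
  shows "(L2_dist f k)\<^sup>2 \<le> 2 * (L2_dist f h)\<^sup>2 + 2 * (L2_dist h k)\<^sup>2"
proof -
  note [measurable] = assms(1-3)
  have i1: "integrable I01 (\<lambda>x. (f x - h x)\<^sup>2)"
    using L2_bounded[of "\<lambda>x. f x - h x" B] b by (simp add: L2_def)
  have i2: "integrable I01 (\<lambda>x. (h x - k x)\<^sup>2)"
    using L2_bounded[of "\<lambda>x. h x - k x" C] b by (simp add: L2_def)
  have "(LINT x|I01. (f x - k x)\<^sup>2) \<le> (LINT x|I01. 2 * (f x - h x)\<^sup>2 + 2 * (h x - k x)\<^sup>2)"
  proof (rule integral_mono_AE')
    have "(f x - k x)\<^sup>2 \<le> 2 * (f x - h x)\<^sup>2 + 2 * (h x - k x)\<^sup>2" for x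
      using sum_squares_ge_zero[of "(f x - h x) - (h x - k x)" 0] by (simp add: power2_eq_square algebra_simps)
    then show "AE x in I01. (f x - k x)\<^sup>2 \<le> 2 * (f x - h x)\<^sup>2 + 2 * (h x - k x)\<^sup>2" by simp
  qed (use i1 i2 in auto)
  also have "\<dots> = 2 * (LINT x|I01. (f x - h x)\<^sup>2) + 2 * (LINT x|I01. (h x - k x)\<^sup>2)"
    using i1 i2 by simp
  finally show ?thesis by (simp add: L2_dist_def L2_norm_def)
qed

lemma flat_0_bounds: "0 \<le> flat 0 y" "flat 0 y \<le> 1"
  by (auto simp: flat_def)

lemma flat_nonneg: "0 \<le> flat j y"
  by (auto simp: flat_def)

text \<open>With \<open>y = N * x - 1\<close> the factor \<open>y + 1\<close> is
  \<open>N * x\<close>: the size \<open>N\<close> of the derivative of a cut-off times the linear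
  decay of the function that is cut off. In \<open>z = inverse y\<close> the product is
  \<open>(z + z^2) / exp z\<close>.\<close>

lemma flat_2_weighted_bound: "\<bar>(y + 1) * flat 2 y\<bar> \<le> 3"
proof (cases "y > 0")
  case True
  define z where "z = inverse y"
  have z: "z > 0" using True by (simp add: z_def)
  have "1 + z + z\<^sup>2 / 2 \<le> exp z" using z by (intro exp_lower_Taylor_quadratic) simp
  then have "z + z\<^sup>2 \<le> 3 * exp z" using z zero_le_power2[of z] by linarith
  moreover have "(y + 1) * flat 2 y = (z + z\<^sup>2) / exp z"
  proof -
    have "y * z = 1" using True by (simp add: z_def)
    then have "(y + 1) * z\<^sup>2 = z + z\<^sup>2"
      by (metis distrib_right mult.assoc mult_1 power2_eq_square)
    moreover have "flat 2 y = z\<^sup>2 * inverse (exp z)" using True by (simp add: flat_def z_def exp_minus)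
    ultimately show ?thesis by (metis divide_inverse mult.assoc)
  qed
  ultimately show ?thesis using z by (simp add: divide_le_eq)
qed (simp add: flat_def)

lemma flat_0_at_top: "(flat 0 \<longlongrightarrow> 1) at_top"
proof -
  have "((\<lambda>y::real. exp (- inverse y)) \<longlongrightarrow> exp (- 0)) at_top"
    by (intro tendsto_intros tendsto_inverse_0_at_top filterlim_ident)
  moreover have "\<forall>\<^sub>F y in at_top. exp (- inverse y) = flat 0 y"
    using eventually_gt_at_top[of 0] by eventually_elim (simp add: flat_def)
  ultimately show ?thesis by (simp add: Lim_transform_eventually)
qed

lemma flat_2_at_top: "((\<lambda>y. (y + 1) * flat 2 y) \<longlongrightarrow> 0) at_top"
proof -
  have "((\<lambda>y::real. (inverse y + (inverse y)\<^sup>2) * exp (- inverse y)) \<longlongrightarrow> (0 + 0\<^sup>2) * exp (- 0)) at_top"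
    by (intro tendsto_intros tendsto_inverse_0_at_top filterlim_ident)
  moreover have "\<forall>\<^sub>F y in at_top. (inverse y + (inverse y)\<^sup>2) * exp (- inverse y) = (y + 1) * flat 2 y"
    using eventually_gt_at_top[of 0] by eventually_elim (simp add: flat_def field_simps power2_eq_square)
  ultimately show ?thesis by (simp add: Lim_transform_eventually)
qed

lemma Lipschitz_at_boundary:
  assumes P: "\<And>x. (P has_real_derivative p x) (at x)" "\<And>x. x \<in> {0..1} \<Longrightarrow> \<bar>p x\<bar> \<le> L"
    and "x \<in> {0..1}" "y \<in> {0..1}" 
  shows "\<bar>P x - P y\<bar> \<le> L * \<bar>x - y\<bar>"
  using field_differentiable_bound[of "{0..1}" P p L x y] assms
  by (auto simp: has_field_derivative_at_within)

text \<open>A smooth function vanishing at both end points is cut off with the factors \<open>flat 0 (N x - 1)\<close> and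
  \<open>flat 0 (N (1 - x) - 1)\<close>; the derivative of the cut-off, of size \<open>N\<close> near the end points, is
  compensated by the linear decay of the function there.\<close>

lemma smooth_cutoff:
  assumes P: "smooth P" "P 0 = 0" "P 1 = 0"
  obtains \<phi> where "\<And>n::nat. \<phi> n \<in> test_functions" "(\<lambda>n. L2_dist (\<phi> n) P) \<longlonglongrightarrow> 0"
    "(\<lambda>n. L2_dist (deriv (\<phi> n)) (deriv P)) \<longlonglongrightarrow> 0"
proof -
  obtain K where K: "\<And>x. x \<in> {0..1} \<Longrightarrow> \<bar>P x\<bar> \<le> K" "K \<ge> 0" using smooth_bounded[OF P(1)] by blast
  obtain L where L: "\<And>x. x \<in> {0..1} \<Longrightarrow> \<bar>deriv P x\<bar> \<le> L" "L \<ge> 0"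
    using smooth_bounded[OF smooth_deriv[OF P(1)]] by blast
  have PL: "\<bar>P x\<bar> \<le> L * x" "\<bar>P x\<bar> \<le> L * (1 - x)" if "x \<in> {0..1}" for x
    using Lipschitz_at_boundary[OF smooth_DERIV[OF P(1)] L(1), of x 0]
      Lipschitz_at_boundary[OF smooth_DERIV[OF P(1)] L(1), of x 1] that P by auto
  define N where "N n = real n + 1" for n
  have N: "N n > 0" for n by (simp add: N_def)
  define y1 where "y1 n x = N n * x + (-1)" for n x
  define y2 where "y2 n x = (- N n) * x + (N n - 1)" for n x
  define \<beta> where "\<beta> n x = flat 0 (y1 n x) * flat 0 (y2 n x)" for n x
  define \<phi> where "\<phi> n x = P x * \<beta> n x" for n x
  have sm: "smooth (\<phi> n)" for n
    unfolding \<phi>_def \<beta>_def y1_def y2_def by (intro smooth_mult smooth_affine smooth_flat P)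
  have test: "\<phi> n \<in> test_functions" for n
  proof -
    have sub0: "{x. \<phi> n x \<noteq> 0} \<subseteq> {1 / N n .. 1 - 1 / N n}"
    proof
      fix x assume "x \<in> {x. \<phi> n x \<noteq> 0}"
      then have "y1 n x > 0" "y2 n x > 0" by (auto simp: \<phi>_def \<beta>_def flat_def split: if_splits)
      then show "x \<in> {1 / N n .. 1 - 1 / N n}"
        using N[of n] by (auto simp: y1_def y2_def field_simps)
    qed
    from sub0 have sub: "closure {x. \<phi> n x \<noteq> 0} \<subseteq> {1 / N n .. 1 - 1 / N n}"
      by (rule closure_minimal) simp
    moreover have "{1 / N n .. 1 - 1 / N n} \<subseteq> {0<..<1}"
    proof -
      have "1 / N n > 0" using N[of n] by simp
      then show ?thesis unfolding atLeastAtMost_iff greaterThanLessThan_iff subset_iff by (intro allI impI conjI) linarith+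
    qed
    moreover have "compact (closure {x. \<phi> n x \<noteq> 0})"
      using bounded_subset[OF bounded_closed_interval sub0] by simp
    ultimately show ?thesis using sm unfolding test_functions_iff by blast
  qed
  have b1: "\<bar>\<beta> n x\<bar> \<le> 1" "\<bar>\<beta> n x - 1\<bar> \<le> 1" for n x
  proof -
    have "0 \<le> \<beta> n x" "\<beta> n x \<le> 1" unfolding \<beta>_def using flat_0_bounds by (auto intro: mult_le_one)
    then show "\<bar>\<beta> n x\<bar> \<le> 1" "\<bar>\<beta> n x - 1\<bar> \<le> 1" by auto
  qed
  have Ntop: "filterlim N at_top sequentially"
    by (rule filterlim_at_top_mono[OF filterlim_real_sequentially]) (simp add: N_def)
  have y1top: "filterlim (\<lambda>n. y1 n x) at_top sequentially" if "x \<in> {0<..<1}" for x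
  proof -
    have "filterlim (\<lambda>n. x * N n) at_top sequentially"
      using that by (intro filterlim_tendsto_pos_mult_at_top[OF tendsto_const _ Ntop]) auto
    then show ?thesis unfolding y1_def
      using filterlim_tendsto_add_at_top[OF tendsto_const[of "-1"], of "\<lambda>n. x * N n"] by (simp add: algebra_simps)
  qed
  have y2top: "filterlim (\<lambda>n. y2 n x) at_top sequentially" if "x \<in> {0<..<1}" for x
  proof -
    have "filterlim (\<lambda>n. (1 - x) * N n) at_top sequentially"
      using that by (intro filterlim_tendsto_pos_mult_at_top[OF tendsto_const _ Ntop]) auto
    then show ?thesis unfolding y2_def
      using filterlim_tendsto_add_at_top[OF tendsto_const[of "-1"], of "\<lambda>n. (1 - x) * N n"] by (simp add: algebra_simps)
  qed
  have \<beta>lim: "(\<lambda>n. \<beta> n x) \<longlonglongrightarrow> 1" if "x \<in> {0<..<1}" for x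
    using tendsto_mult[OF filterlim_compose[OF flat_0_at_top y1top[OF that]] filterlim_compose[OF flat_0_at_top y2top[OF that]]]
    by (simp add: \<beta>_def)
  have d1: "(\<lambda>n. L2_dist (\<phi> n) P) \<longlonglongrightarrow> 0"
  proof (rule L2_dist_dominated[where K = K])
    show "\<phi> n \<in> borel_measurable I01" for n by (intro smooth_I01 sm)
    show "P \<in> borel_measurable I01" by (intro smooth_I01 P)
    show "\<bar>\<phi> n x - P x\<bar> \<le> K" if "x \<in> {0<..<1}" for n x
    proof -
      have "\<phi> n x - P x = P x * (\<beta> n x - 1)" by (simp add: \<phi>_def algebra_simps)
      then have "\<bar>\<phi> n x - P x\<bar> \<le> K * 1"
        unfolding abs_mult using K(1)[of x] K(2) b1(2)[of n x] that by (simp only: abs_mult) (intro mult_mono, auto)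
      then show ?thesis by simp
    qed
    show "(\<lambda>n. \<phi> n x) \<longlonglongrightarrow> P x" if "x \<in> {0<..<1}" for x
      using tendsto_mult[OF tendsto_const[of "P x"] \<beta>lim[OF that]] by (simp add: \<phi>_def)
  qed
  \<comment> \<open>These are the two parts of \<open>P x\<close> times the derivative of the
    cut-off. Since \<open>N n * x = y1 n x + 1\<close> and
    \<open>N n * (1 - x) = y2 n x + 1\<close>, the linear decay of \<open>P\<close> at the
    respective end point reduces both to \<open>flat_2_weighted_bound\<close>.\<close>
  define e1 where "e1 n x = P x * N n * flat 2 (y1 n x) * flat 0 (y2 n x)" for n x
  define e2 where "e2 n x = P x * N n * flat 2 (y2 n x) * flat 0 (y1 n x)" for n x
  have der: "deriv (\<phi> n) x = deriv P x * \<beta> n x + e1 n x - e2 n x" for n x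
  proof -
    have f0: "(flat 0 has_real_derivative flat 2 z) (at z)" for z using DERIV_flat[of 0 z] by (simp add: numeral_2_eq_2)
    have "((\<lambda>x. flat 0 (y1 n x)) has_real_derivative flat 2 (y1 n x) * N n) (at x)"
      unfolding y1_def by (rule DERIV_chain2[OF f0]) (auto intro!: derivative_eq_intros)
    moreover have "((\<lambda>x. flat 0 (y2 n x)) has_real_derivative flat 2 (y2 n x) * (- N n)) (at x)"
      unfolding y2_def by (rule DERIV_chain2[OF f0]) (auto intro!: derivative_eq_intros)
    ultimately have "(\<beta> n has_real_derivative flat 2 (y1 n x) * N n * flat 0 (y2 n x) + flat 2 (y2 n x) * (- N n) * flat 0 (y1 n x)) (at x)"
      unfolding \<beta>_def by (rule DERIV_mult)
    from DERIV_mult[OF smooth_DERIV[OF P(1)] this]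
    have "(\<phi> n has_real_derivative deriv P x * \<beta> n x + (flat 2 (y1 n x) * N n * flat 0 (y2 n x) + flat 2 (y2 n x) * (- N n) * flat 0 (y1 n x)) * P x) (at x)"
      by (simp add: \<phi>_def[abs_def])
    from DERIV_imp_deriv[OF this] show ?thesis by (simp add: e1_def e2_def algebra_simps)
  qed
  have e1b: "\<bar>e1 n x\<bar> \<le> L * \<bar>(y1 n x + 1) * flat 2 (y1 n x)\<bar>"
    and e2b: "\<bar>e2 n x\<bar> \<le> L * \<bar>(y2 n x + 1) * flat 2 (y2 n x)\<bar>" if x: "x \<in> {0<..<1}" for n x
  proof -
    have "\<bar>P x\<bar> * N n * flat 2 (y1 n x) * flat 0 (y2 n x) \<le> (L * x) * N n * flat 2 (y1 n x) * 1"
      using PL(1)[of x] x N[of n] flat_nonneg flat_0_bounds L(2) by (intro mult_mono mult_nonneg_nonneg) (auto simp: less_imp_le)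
    also have "\<dots> = L * ((y1 n x + 1) * flat 2 (y1 n x))" by (simp add: y1_def algebra_simps)
    also have "\<dots> \<le> L * \<bar>(y1 n x + 1) * flat 2 (y1 n x)\<bar>" using L(2) by (intro mult_left_mono) auto
    finally show "\<bar>e1 n x\<bar> \<le> L * \<bar>(y1 n x + 1) * flat 2 (y1 n x)\<bar>"
      using N[of n] flat_nonneg by (simp add: e1_def abs_mult)
    have "\<bar>P x\<bar> * N n * flat 2 (y2 n x) * flat 0 (y1 n x) \<le> (L * (1 - x)) * N n * flat 2 (y2 n x) * 1"
      using PL(2)[of x] x N[of n] flat_nonneg flat_0_bounds L(2) by (intro mult_mono mult_nonneg_nonneg) (auto simp: less_imp_le)
    also have "\<dots> = L * ((y2 n x + 1) * flat 2 (y2 n x))" by (simp add: y2_def algebra_simps)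
    also have "\<dots> \<le> L * \<bar>(y2 n x + 1) * flat 2 (y2 n x)\<bar>" using L(2) by (intro mult_left_mono) auto
    finally show "\<bar>e2 n x\<bar> \<le> L * \<bar>(y2 n x + 1) * flat 2 (y2 n x)\<bar>"
      using N[of n] flat_nonneg by (simp add: e2_def abs_mult)
  qed
  have d2: "(\<lambda>n. L2_dist (deriv (\<phi> n)) (deriv P)) \<longlonglongrightarrow> 0"
  proof (rule L2_dist_dominated[where K = "L + 6 * L"])
    show "deriv (\<phi> n) \<in> borel_measurable I01" for n by (intro smooth_I01 smooth_deriv sm)
    show "deriv P \<in> borel_measurable I01" by (intro smooth_I01 smooth_deriv P)
    fix x :: real assume x: "x \<in> {0<..<1}"
    show "\<bar>deriv (\<phi> n) x - deriv P x\<bar> \<le> L + 6 * L" for n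
    proof -
      have "\<bar>deriv P x * (\<beta> n x - 1)\<bar> \<le> L * 1"
        unfolding abs_mult using L(1)[of x] L(2) b1(2)[of n x] x by (intro mult_mono) auto
      moreover have "\<bar>e1 n x\<bar> \<le> L * 3"
        using e1b[OF x, of n] mult_left_mono[OF flat_2_weighted_bound[of "y1 n x"] L(2)] by linarith
      moreover have "\<bar>e2 n x\<bar> \<le> L * 3"
        using e2b[OF x, of n] mult_left_mono[OF flat_2_weighted_bound[of "y2 n x"] L(2)] by linarith
      moreover have "deriv (\<phi> n) x - deriv P x = deriv P x * (\<beta> n x - 1) + e1 n x - e2 n x"
        by (simp add: der algebra_simps)
      ultimately show ?thesis by linarith
    qed
    have z: "(\<lambda>n. L * \<bar>(y1 n x + 1) * flat 2 (y1 n x)\<bar>) \<longlonglongrightarrow> L * \<bar>0\<bar>" "(\<lambda>n. L * \<bar>(y2 n x + 1) * flat 2 (y2 n x)\<bar>) \<longlonglongrightarrow> L * \<bar>0\<bar>"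
      by (intro tendsto_intros filterlim_compose[OF flat_2_at_top y1top[OF x]] filterlim_compose[OF flat_2_at_top y2top[OF x]])+
    have "(\<lambda>n. e1 n x) \<longlonglongrightarrow> 0"
      by (rule Lim_null_comparison[OF always_eventually z(1)[simplified]]) (use e1b[OF x] in \<open>simp add: abs_mult\<close>)
    moreover have "(\<lambda>n. e2 n x) \<longlonglongrightarrow> 0"
      by (rule Lim_null_comparison[OF always_eventually z(2)[simplified]]) (use e2b[OF x] in \<open>simp add: abs_mult\<close>)
    ultimately have "(\<lambda>n. deriv P x * \<beta> n x + e1 n x - e2 n x) \<longlonglongrightarrow> deriv P x * 1 + 0 - 0"
      by (intro tendsto_intros \<beta>lim[OF x])
    then show "(\<lambda>n. deriv (\<phi> n) x) \<longlonglongrightarrow> deriv P x" by (simp add: der)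
  qed
  show ?thesis using that[of \<phi>] test d1 d2 by blast
qed

text \<open>A polynomial \<open>q\<close> close to \<open>p\<close> has a primitive \<open>Q\<close>
  that may miss the value 0 at 1. As \<open>p\<close> has mean zero, \<open>Q 1\<close> is at most
  \<open>e / 2\<close> in absolute value, so subtracting \<open>Q 1 * x\<close> restores the
  boundary value and changes the derivative only slightly.\<close>

lemma primitive_approx_polynomial:
  assumes p: "continuous_on {0..1} p" "(LINT x|I01. p x) = 0" and e: "e > 0"
  obtains P where "smooth P" "P 0 = 0" "P 1 = 0" 
    "\<And>x. x \<in> {0..1} \<Longrightarrow> \<bar>deriv P x - p x\<bar> \<le> e" "\<And>x. x \<in> {0..1} \<Longrightarrow> \<bar>P x - primitive p x\<bar> \<le> e"
proof -
  obtain q where q: "real_polynomial_function q" "\<And>x. x \<in> {0..1} \<Longrightarrow> \<bar>p x - q x\<bar> < e / 2"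
    using Stone_Weierstrass_real_polynomial_function[OF _ p(1), of "e / 2"] e by auto
  obtain a n where qa: "q = (\<lambda>x. \<Sum>i\<le>n. a i * x ^ i)"
    using q(1) real_polynomial_function_iff_sum by blast
  define Q where "Q x = (\<Sum>i\<le>n. (a i / real (Suc i)) * x ^ Suc i)" for x
  have sQ: "smooth Q" unfolding Q_def by (intro smooth_sum smooth_mult smooth_const smooth_power) auto
  have Q': "(Q has_real_derivative q x) (at x)" for x
    unfolding Q_def qa by (auto intro!: derivative_eq_intros sum.cong simp del: power_Suc of_nat_Suc)
  define P where "P x = Q x + (- Q 1) * x" for x
  have sP: "smooth P" unfolding P_def by (intro smooth_add smooth_mult smooth_const smooth_ident sQ)
  have P': "(P has_real_derivative q x - Q 1) (at x)" for x
    unfolding P_def by (auto intro!: derivative_eq_intros Q')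
  have P0: "P 0 = 0" "P 1 = 0" by (auto simp: P_def Q_def)
  have cq: "continuous_on A q" for A unfolding qa by (intro continuous_intros)
  have Q0: "Q 0 = 0" by (simp add: Q_def)
  have iq: "integrable I01 q" and ip: "integrable I01 p"
    by (intro integrable_I01_continuous cq p)+
  have "(LINT x|I01. q x) = Q 1 - Q 0"
    by (rule integral_I01_FTC[of "{}"]) (auto intro: Q' iq smooth_continuous sQ)
  then have "Q 1 = (LINT x|I01. q x - p x)" using p(2) iq ip Q0 by simp
  also have "\<bar>\<dots>\<bar> \<le> (LINT x|I01. e / 2)"
  proof (rule integral_abs_bound[THEN order_trans], rule integral_mono_AE)
    show "AE x in I01. \<bar>q x - p x\<bar> \<le> e / 2"
      using q(2) by (intro AE_I2) (auto simp: abs_minus_commute less_imp_le)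
  qed (use iq ip in auto)
  finally have Q1: "\<bar>Q 1\<bar> \<le> e / 2" by simp
  have dP: "deriv P x = q x - Q 1" for x using P' by (rule DERIV_imp_deriv)
  have close: "\<bar>deriv P x - p x\<bar> \<le> e" if "x \<in> {0..1}" for x
    using q(2)[OF that] Q1 unfolding dP by linarith
  obtain C where C: "\<And>y. y \<in> {0..1} \<Longrightarrow> \<bar>p y\<bar> \<le> C"
    using compact_imp_bounded[OF compact_continuous_image[OF p(1)]] by (force simp: bounded_iff)
  have "\<bar>P x - primitive p x\<bar> \<le> e" if x: "x \<in> {0..1}" for x
  proof -
    have "primitive (deriv P) x = P x - P 0"
      by (rule primitive_eq[OF smooth_DERIV[OF sP] _ _ x]) (auto intro: smooth_continuous smooth_deriv sP)
    moreover obtain L where L: "\<And>x. x \<in> {0..1} \<Longrightarrow> \<bar>deriv P x\<bar> \<le> L"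
      using smooth_bounded[OF smooth_deriv[OF sP]] by blast
    moreover have "\<bar>primitive (deriv P) x - primitive p x\<bar> \<le> e"
    proof (rule primitive_diff_le)
      show "\<bar>deriv P y\<bar> \<le> L" if "y \<in> {0<..<1}" for y using that L by auto
      show "deriv P \<in> borel_measurable I01" by (intro smooth_I01 smooth_deriv sP)
      show "p \<in> borel_measurable I01" using ip by (rule borel_measurable_integrable)
      show "\<bar>p y\<bar> \<le> C" if "y \<in> {0<..<1}" for y using that C by auto
      show "\<bar>deriv P y - p y\<bar> \<le> e" if "y \<in> {0<..<1}" for y using that close by auto
    qed
    ultimately show ?thesis using P0 by simp
  qed
  then show ?thesis using that sP P0 close by blast
qed

text \<open>The mean value zero of \<open>p\<close> is the boundary condition at 1. A smooth
  approximation with both boundary values zero is followed by a cut-off, and each of the two steps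
  costs at most \<open>e\<close> in the function and in its derivative.\<close>

lemma primitive_H10:
  assumes p: "continuous_on {0..1} p" "(LINT x|I01. p x) = 0"
    and u: "u \<in> borel_measurable I01" "AE x in I01. primitive p x = u x"
  shows "u \<in> H10"
proof -
  obtain C where C: "\<And>y. y \<in> {0..1} \<Longrightarrow> \<bar>p y\<bar> \<le> C"
    using compact_imp_bounded[OF compact_continuous_image[OF p(1)]] by (force simp: bounded_iff)
  have pm: "p \<in> borel_measurable I01"
    using integrable_I01_continuous[OF p(1)] by (rule borel_measurable_integrable)
  have Cb: "\<bar>p y\<bar> \<le> C" if "y \<in> {0<..<1}" for y using C that by auto
  note pr = pm Cb
  have Vm: "primitive p \<in> borel_measurable I01" using pr by (rule primitive_measurable)
  have "\<exists>\<phi>\<in>test_functions. L2_dist \<phi> (primitive p) \<le> 2 * e \<and> L2_dist (deriv \<phi>) p \<le> 2 * e" if e: "e > 0" for e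
  proof -
    obtain P where P: "smooth P" "P 0 = 0" "P 1 = 0" 
      "\<And>x. x \<in> {0..1} \<Longrightarrow> \<bar>deriv P x - p x\<bar> \<le> e" "\<And>x. x \<in> {0..1} \<Longrightarrow> \<bar>P x - primitive p x\<bar> \<le> e"
      using primitive_approx_polynomial[OF p e] by blast
    obtain \<phi> where \<phi>: "\<And>n::nat. \<phi> n \<in> test_functions" "(\<lambda>n. L2_dist (\<phi> n) P) \<longlonglongrightarrow> 0"
       "(\<lambda>n. L2_dist (deriv (\<phi> n)) (deriv P)) \<longlonglongrightarrow> 0"
      using smooth_cutoff[OF P(1-3)] by blast
    have "\<forall>\<^sub>F n in sequentially. L2_dist (\<phi> n) P < e \<and> L2_dist (deriv (\<phi> n)) (deriv P) < e"
      using order_tendstoD(2)[OF \<phi>(2) e] order_tendstoD(2)[OF \<phi>(3) e] by eventually_elim auto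
    then obtain n where n: "L2_dist (\<phi> n) P < e" "L2_dist (deriv (\<phi> n)) (deriv P) < e"
      by (auto simp: eventually_sequentially)
    have s: "smooth (\<phi> n)" using \<phi>(1) by (simp add: test_functions_iff)
    \<comment> \<open>Used for the functions and again for their derivatives; the bound comes from
      the squared triangle inequality, as \<open>2 * e^2 + 2 * e^2 = (2 * e)^2\<close>.\<close>
    have comb: "L2_dist f k \<le> 2 * e"
      if sf: "smooth f" and sh: "smooth h" and k: "k \<in> borel_measurable I01"
        and hk: "\<And>x. x \<in> {0..1} \<Longrightarrow> \<bar>h x - k x\<bar> \<le> e" and lt: "L2_dist f h < e" for f h k
    proof -
      obtain A where A: "\<And>x. x \<in> {0..1} \<Longrightarrow> \<bar>f x\<bar> \<le> A" using smooth_bounded[OF sf] by blast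
      obtain A' where A': "\<And>x. x \<in> {0..1} \<Longrightarrow> \<bar>h x\<bar> \<le> A'" using smooth_bounded[OF sh] by blast
      have fh: "\<bar>f x - h x\<bar> \<le> A + A'" if "x \<in> {0<..<1}" for x
        using abs_triangle_ineq4[of "f x" "h x"] A[of x] A'[of x] that by auto
      have "L2_dist h k \<le> e" using hk e by (intro L2_dist_le) auto
      then have "(L2_dist h k)\<^sup>2 \<le> e\<^sup>2" by (intro power_mono L2_dist_nonneg)
      moreover have "(L2_dist f h)\<^sup>2 \<le> e\<^sup>2" using lt by (intro power_mono L2_dist_nonneg) auto
      moreover have "(L2_dist f k)\<^sup>2 \<le> 2 * (L2_dist f h)\<^sup>2 + 2 * (L2_dist h k)\<^sup>2"
        by (rule L2_dist_triangle_sq[OF smooth_I01[OF sf] smooth_I01[OF sh] k fh, of e]) (use hk in auto)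
      ultimately have "(L2_dist f k)\<^sup>2 \<le> (2 * e)\<^sup>2" by (simp add: power_mult_distrib)
      then show ?thesis by (rule power2_le_imp_le) (use e in simp)
    qed
    have "L2_dist (\<phi> n) (primitive p) \<le> 2 * e" by (rule comb[OF s P(1) Vm P(5) n(1)])
    moreover have "L2_dist (deriv (\<phi> n)) p \<le> 2 * e"
      by (rule comb[OF smooth_deriv[OF s] smooth_deriv[OF P(1)] pm P(4) n(2)])
    ultimately show ?thesis using \<phi>(1) by blast
  qed
  then have "\<exists>\<phi>\<in>test_functions. L2_dist \<phi> (primitive p) \<le> 2 * inverse (real (Suc n)) \<and> L2_dist (deriv \<phi>) p \<le> 2 * inverse (real (Suc n))" for n
    by (metis inverse_positive_iff_positive of_nat_0_less_iff zero_less_Suc)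
  then obtain \<phi> where \<phi>: "\<And>n. \<phi> n \<in> test_functions" "\<And>n. L2_dist (\<phi> n) (primitive p) \<le> 2 * inverse (real (Suc n))"
     "\<And>n. L2_dist (deriv (\<phi> n)) p \<le> 2 * inverse (real (Suc n))" by metis
  have lim: "(\<lambda>n. 2 * inverse (real (Suc n))) \<longlonglongrightarrow> 0"
    using tendsto_mult[OF tendsto_const[of 2] LIMSEQ_inverse_real_of_nat] by simp
  have "(\<lambda>n. L2_dist (\<phi> n) u) \<longlonglongrightarrow> 0"
  proof (rule Lim_null_comparison[OF always_eventually lim], rule allI)
    fix n
    have "L2_dist (\<phi> n) u = L2_dist (\<phi> n) (primitive p)"
    proof (rule L2_dist_cong_AE[symmetric, OF _ Vm u])
      show "\<phi> n \<in> borel_measurable I01" using \<phi>(1)[of n] by (intro smooth_I01) (simp add: test_functions_iff)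
    qed
    then show "norm (L2_dist (\<phi> n) u) \<le> 2 * inverse (real (Suc n))" using \<phi>(2)[of n] by (simp only: real_norm_def abs_of_nonneg[OF L2_dist_nonneg])
  qed
  moreover have "(\<lambda>n. L2_dist (deriv (\<phi> n)) p) \<longlonglongrightarrow> 0"
    by (rule Lim_null_comparison[OF always_eventually lim], rule allI)
       (use \<phi>(3) in \<open>simp only: real_norm_def abs_of_nonneg[OF L2_dist_nonneg]\<close>)
  moreover have "weak_deriv u p"
    using weak_deriv_cong_AE[OF weak_deriv_primitive[OF pr, of 0, simplified] u] by simp
  ultimately show ?thesis using \<phi>(1) unfolding H10_def by blast
qed

text \<open>Uniqueness of sine coefficients identifies \<open>u\<close> almost everywhere with an
  explicit double primitive of \<open>h\<close>, from which weak derivatives and boundary values are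
  inherited.\<close>

lemma
  assumes h: "h \<in> borel_measurable I01" "\<And>y. y \<in> {0<..<1} \<Longrightarrow> \<bar>h y\<bar> \<le> B"
    and u: "integrable I01 u" "\<And>k. sine_coeff u k = - sine_coeff h k / eigenval k"
  shows double_primitive_weak_deriv2: "weak_deriv2 u h" and double_primitive_H10: "u \<in> H10"
proof -
  \<comment> \<open>Removing the mean from the first primitive makes the second one vanish at 1 as
    well as at 0.\<close>
  define c where "c = (LINT x|I01. primitive h x)"
  define p where "p x = primitive h x - c" for x
  have cp: "continuous_on {0..1} p" unfolding p_def by (intro continuous_intros primitive_continuous[OF h])
  have ip: "integrable I01 p" by (intro integrable_I01_continuous cp)
  have ih: "integrable I01 (primitive h)" by (intro integrable_I01_continuous primitive_continuous[OF h])
  have p0: "(LINT x|I01. p x) = 0" unfolding p_def using ih by (simp add: c_def)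
  have pm: "p \<in> borel_measurable I01" using ip by (rule borel_measurable_integrable)
  have pb: "\<bar>p y\<bar> \<le> B + \<bar>c\<bar>" for y using primitive_bound[OF h, of y] by (simp add: p_def)
  have coeff: "sine_coeff (primitive p) k = - sine_coeff h k / eigenval k" for k
  proof -
    define w where "w = pi * (real k + 1)"
    have w: "w > 0" by (simp add: w_def)
    have s1: "sin w = 0" using sine_1[of k] by (simp add: sine_def w_def)
    have "(LINT x|I01. primitive p x * sin (w * x)) = (- cos (w * 1) / w) * (LINT x|I01. p x) - (LINT x|I01. p x * (- cos (w * x) / w))"
      by (rule integral_primitive_by_parts[OF pm pb])
         (use w in \<open>auto intro!: derivative_eq_intros continuous_intros\<close>)
    also have "\<dots> = (LINT x|I01. p x * cos (w * x)) / w" using p0 by simp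
    also have "(LINT x|I01. p x * cos (w * x)) = (LINT x|I01. primitive h x * cos (w * x)) - c * (LINT x|I01. cos (w * x))"
    proof -
      have "integrable I01 (\<lambda>x. primitive h x * cos (w * x))"
        by (intro integrable_I01_continuous continuous_intros primitive_continuous[OF h])
      moreover have "integrable I01 (\<lambda>x. cos (w * x))"
        by (intro integrable_I01_continuous continuous_intros)
      ultimately show ?thesis by (simp add: p_def left_diff_distrib)
    qed
    also have "(LINT x|I01. cos (w * x)) = 0"
      using integral_I01_cos[of "int k + 1"] by (simp add: w_def)
    also have "(LINT x|I01. primitive h x * cos (w * x)) = (sin (w * 1) / w) * (LINT x|I01. h x) - (LINT x|I01. h x * (sin (w * x) / w))"
      by (rule integral_primitive_by_parts[OF h])
         (use w in \<open>auto intro!: derivative_eq_intros continuous_intros\<close>)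
    finally have "(LINT x|I01. primitive p x * sin (w * x)) = - (LINT x|I01. h x * sin (w * x)) / w\<^sup>2"
      using s1 by (simp add: power2_eq_square)
    then show ?thesis by (simp add: sine_coeff_def sine_def eigenval_def w_def)
  qed
  have ae: "AE x in I01. primitive p x = u x"
  proof (rule sine_coeff_unique_AE[OF _ u(1)])
    show "integrable I01 (primitive p)" by (intro integrable_I01_continuous primitive_continuous[OF pm pb])
  qed (simp add: coeff u(2))
  have um: "u \<in> borel_measurable I01" using u(1) by (rule borel_measurable_integrable)
  show "u \<in> H10" by (rule primitive_H10[OF cp p0 um ae])
  have "weak_deriv u p"
    using weak_deriv_cong_AE[OF weak_deriv_primitive[OF pm pb, of 0, simplified] um ae] by simp
  moreover have "weak_deriv p h" unfolding p_def by (rule weak_deriv_primitive[OF h])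
  ultimately show "weak_deriv2 u h" unfolding weak_deriv2_def by blast
qed

lemma AE_lebesgue_on:
  "AE t in lebesgue. P t \<Longrightarrow> S \<in> sets lebesgue \<Longrightarrow> AE t in lebesgue_on S. P t"
  by (subst AE_restrict_space_iff) (auto elim!: eventually_mono)

text \<open>Everything required at almost every time is proved at the times where \<open>m\<close>
  satisfies a Hoelder bound of exponent \<open>3/4\<close>; continuity, absolute continuity and
  measurability hold without such a restriction on the time.\<close>

theorem strong_solution_heat_sol:
  assumes g: "source B g" and m: "mono m" "\<And>t. \<bar>m t\<bar> \<le> M"
    and bv: "\<And>s t. (LINT x|I01. \<bar>g s x - g t x\<bar>) \<le> \<bar>m s - m t\<bar>"
    and u: "\<And>t x. x \<in> {0<..<1} \<Longrightarrow> u t x = heat_sol g t x"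
    and inc: "\<And>t x. t > 0 \<Longrightarrow> x \<in> {0<..<1} \<Longrightarrow> g t x \<in> H0 (u t x)"
  shows "strong_solution (u 0) u"
proof -
  note hyps = g m bv
  have good: "u t \<in> H2 \<inter> H10 \<and> (\<exists>ut uxx. has_L2_derivative_at u ut t \<and> weak_deriv2 (u t) uxx \<and>
           (AE x in I01. ut x - uxx x = g t x))"
    if H: "\<And>s. \<bar>m s - m t\<bar> \<le> C * \<bar>s - t\<bar> powr (3/4)" for t C
  proof -
    define a where "a k = sine_coeff (g t) k - eigenval k * heat_coeff g k t" for k
    define ut where "ut x = (\<Sum>k. a k * sine k x)" for x
    note D = heat_sol_time_derivative[OF hyps H, folded a_def]
    have sa: "summable (\<lambda>k. \<bar>a k\<bar>)" by (rule D(1))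
    have utm: "ut \<in> borel_measurable I01"
      unfolding ut_def by (intro continuous_on_imp_I01 sine_series_continuous sa)
    have utb: "\<bar>ut x\<bar> \<le> (\<Sum>k. \<bar>a k\<bar>)" for x unfolding ut_def by (rule sine_series_bound[OF sa])
    \<comment> \<open>The candidate for the second space derivative is read off from the equation.
      It is bounded, and its coefficients are \<open>- eigenval k\<close> times those of
      \<open>u t\<close>, so \<open>u t\<close> is its double primitive.\<close>
    define h where "h x = ut x - g t x" for x
    have hm: "h \<in> borel_measurable I01" unfolding h_def using utm source_slice_I01[OF g] by measurable
    have hb: "\<bar>h x\<bar> \<le> (\<Sum>k. \<bar>a k\<bar>) + B" for x
      using utb[of x] source_bound[OF g, of t x] by (simp add: h_def)
    have iut: "integrable I01 ut" using utm utb by (rule integrable_I01_bounded)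
    have um: "u t \<in> borel_measurable I01"
      using heat_sol_L2[OF hyps u] by (simp add: L2_def)
    have iu: "integrable I01 (u t)"
    proof (rule integrable_I01_bounded[OF um])
      show "\<bar>u t x\<bar> \<le> (\<Sum>k. 2 * B / eigenval k)" if "x \<in> {0<..<1}" for x
        using u[OF that] heat_sol_bound[OF g] by simp
    qed
    have "sine_coeff (u t) k = heat_coeff g k t" for k
      using sine_coeff_cong[of "u t" "heat_sol g t" k] u heat_sol_coeff[OF g] by simp
    moreover have "sine_coeff h k = - eigenval k * heat_coeff g k t" for k
    proof -
      have "sine_coeff ut k = a k" unfolding ut_def by (rule sine_series_coeff[OF sa])
      then show ?thesis unfolding h_def using iut source_integrable[OF g] by (simp add: sine_coeff_diff a_def)
    qed
    ultimately have coeff: "sine_coeff (u t) k = - sine_coeff h k / eigenval k" for k by simp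
    have wd: "weak_deriv2 (u t) h" by (rule double_primitive_weak_deriv2[OF hm hb iu coeff])
    have h10: "u t \<in> H10" by (rule double_primitive_H10[OF hm hb iu coeff])
    have "has_L2_derivative_at u ut t"
      unfolding has_L2_derivative_at_def
    proof
      show "ut \<in> L2" using utm utb by (rule L2_bounded)
      show "((\<lambda>s. L2_dist (\<lambda>x. (u s x - u t x) / (s - t)) ut) \<longlongrightarrow> 0) (at t)"
      proof (rule L2_dist_tendsto_0[OF _ D(2)])
        show "\<forall>\<^sub>F s in at t. \<forall>x\<in>{0<..<1}. \<bar>(u s x - u t x) / (s - t) - ut x\<bar> \<le>
           (\<Sum>k. \<bar>(heat_coeff g k s - heat_coeff g k t) / (s - t) - a k\<bar>)"
          unfolding eventually_at_filter using D(3) by (intro always_eventually allI impI ballI) (simp add: u ut_def)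
        show "\<forall>\<^sub>F s in at t. 0 \<le> (\<Sum>k. \<bar>(heat_coeff g k s - heat_coeff g k t) / (s - t) - a k\<bar>)"
          unfolding eventually_at_filter by (intro always_eventually allI impI suminf_nonneg D(4)) auto
      qed
    qed
    moreover have "AE x in I01. ut x - h x = g t x" by (simp add: h_def)
    ultimately show ?thesis using wd h10 by (auto simp: H2_def)
  qed
  have "AE t in lebesgue. \<exists>C. \<forall>s. \<bar>m s - m t\<bar> \<le> C * \<bar>s - t\<bar> powr (3/4)"
    using m by (rule mono_AE_Hoelder)
  then have "AE t in lebesgue. u t \<in> H2 \<inter> H10 \<and> (\<exists>ut uxx. has_L2_derivative_at u ut t \<and> weak_deriv2 (u t) uxx \<and>
           (AE x in I01. ut x - uxx x = g t x))"
    by eventually_elim (use good in blast)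
  then have ae: "AE t in lebesgue_on {0<..}. u t \<in> H2 \<inter> H10 \<and> (\<exists>ut uxx. has_L2_derivative_at u ut t \<and> weak_deriv2 (u t) uxx \<and>
           (AE x in I01. ut x - uxx x = g t x))"
    by (rule AE_lebesgue_on) simp
  have incAE: "AE t in lebesgue_on {0<..}. AE x in I01. g t x \<in> H0 (u t x)"
    using inc by (intro AE_I2) auto
  show ?thesis
    unfolding strong_solution_def
  proof (intro conjI exI[of _ g] allI impI)
    show "u 0 \<in> L2" using hyps u by (rule heat_sol_L2)
    show "L2_continuous_on {0..} u" using hyps u by (rule heat_sol_L2_continuous)
    show "AE x in I01. u 0 x = u 0 x" by simp
    show "L2_absolutely_continuous_on T1 T2 u" if "0 < T1 \<and> T1 \<le> T2" for T1 T2
      using hyps u that by (intro heat_sol_L2_absolutely_continuous) auto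
    show "g \<in> L2_Bochner {0<..<T}" for T using hyps by (rule source_Bochner)
    show "AE t in lebesgue_on {0<..}. u t \<in> H2 \<inter> H10" using ae by eventually_elim blast
    show "AE t in lebesgue_on {0<..}. \<exists>ut uxx. has_L2_derivative_at u ut t \<and> weak_deriv2 (u t) uxx \<and>
           (AE x in I01. ut x - uxx x = g t x)" using ae by eventually_elim blast
  qed (rule incAE)
qed

section \<open>The stationary profiles and their strict subsolutions\<close>

text \<open>Green's identity: the Wronskian \<open>W\<close> of \<open>F\<close> and
  \<open>sine k\<close> vanishes at both ends, and its derivative off \<open>S\<close> is
  \<open>eigenval k * (F x * sine k x) - p x * sine k x\<close>. The finite set \<open>S\<close>
  admits the jumps of the piecewise constant sources.\<close>

lemma sine_coeff_second_derivative:
  assumes S: "finite S" and F: "continuous_on {0..1} F" "F 0 = 0" "F 1 = 0" and F1: "continuous_on {0..1} F1"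
    and d: "\<And>x. x \<in> {0<..<1} - S \<Longrightarrow> (F has_real_derivative F1 x) (at x)"
      "\<And>x. x \<in> {0<..<1} - S \<Longrightarrow> (F1 has_real_derivative - p x) (at x)"
    and p: "integrable I01 p"
  shows "sine_coeff F k = sine_coeff p k / eigenval k"
proof -
  define w where "w = pi * (real k + 1)"
  define W where "W x = F1 x * sine k x - F x * (w * cos (w * x))" for x
  have ds: "(sine k has_real_derivative w * cos (w * x)) (at x)" for x
    unfolding sine_def[abs_def] w_def[symmetric] by (auto intro!: derivative_eq_intros)
  have iF: "integrable I01 (\<lambda>x. F x * sine k x)" "integrable I01 (\<lambda>x. p x * sine k x)"
    by (intro integrable_times_sine p integrable_I01_continuous F)+
  have "(LINT x|I01. eigenval k * (F x * sine k x) - p x * sine k x) = W 1 - W 0"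
  proof (rule integral_I01_FTC[OF S])
    show "continuous_on {0..1} W" unfolding W_def by (intro continuous_intros F F1)
    show "integrable I01 (\<lambda>x. eigenval k * (F x * sine k x) - p x * sine k x)" using iF by simp
    fix x assume x: "x \<in> {0<..<1} - S"
    have "(W has_real_derivative (- p x * sine k x + w * cos (w * x) * F1 x) -
        (F1 x * (w * cos (w * x)) + (w * (- sin (w * x) * w)) * F x)) (at x)"
      unfolding W_def
      by (intro DERIV_diff DERIV_mult d x ds) (auto intro!: derivative_eq_intros)
    then show "(W has_real_derivative eigenval k * (F x * sine k x) - p x * sine k x) (at x)"
      by (simp add: eigenval_def sine_def w_def power2_eq_square algebra_simps)
  qed
  then have "eigenval k * (LINT x|I01. F x * sine k x) = (LINT x|I01. p x * sine k x)"
    using iF by (simp add: W_def F)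
  then show ?thesis by (simp add: sine_coeff_def field_simps)
qed

text \<open>The left-continuous selection of \<open>H0\<close>; left continuity lets it pass to limits of increasing sequences.\<close>

definition lsgn :: "real \<Rightarrow> real" where
  "lsgn r = (if r > 0 then 1 else -1)"

lemma lsgn_H0: "lsgn r \<in> H0 r" and lsgn_H0_uminus: "- lsgn r \<in> H0 (- r)"
  by (auto simp: lsgn_def H0_def)

lemma lsgn_mono: "r \<le> s \<Longrightarrow> lsgn r \<le> lsgn s"
  by (auto simp: lsgn_def)

lemma lsgn_bound: "\<bar>lsgn r\<bar> \<le> 1"
  by (auto simp: lsgn_def)

lemma lsgn_measurable [measurable]: "lsgn \<in> borel_measurable borel"
  unfolding lsgn_def by measurable

lemma lsgn_left_limit:
  assumes "incseq s" "s \<longlonglongrightarrow> r" shows "(\<lambda>j::nat. lsgn (s j)) \<longlonglongrightarrow> lsgn r"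
proof (cases "r > 0")
  case True
  then have "\<forall>\<^sub>F j in sequentially. 0 < s j" by (rule order_tendstoD(1)[OF assms(2)])
  then have "\<forall>\<^sub>F j in sequentially. lsgn (s j) = lsgn r"
    by eventually_elim (use True in \<open>simp add: lsgn_def\<close>)
  then show ?thesis by (rule tendsto_eventually)
next
  case False
  have "s j \<le> r" for j using assms by (rule incseq_le)
  then have "lsgn (s j) = lsgn r" for j using False order_trans[of "s j" r 0] by (auto simp: lsgn_def not_less)
  then show ?thesis by simp
qed

text \<open>The antiperiodic repetition of \<open>q\<close> from the first cell, common to the
  profile and its slope. The condition \<open>q (1 / real n) = - q 0\<close> in the lemmas below is
  the matching of neighbouring cells.\<close>

definition glue :: "nat \<Rightarrow> (real \<Rightarrow> real) \<Rightarrow> real \<Rightarrow> real" where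
  "glue n q x = (let k = nat \<lfloor>real n * x\<rfloor> in (-1) ^ k * q (x - real k / real n))"

definition v_slope :: "nat \<Rightarrow> real \<Rightarrow> real" where
  "v_slope n = glue n (\<lambda>y. - y + 1 / (2 * real n))"

lemma v_plus_glue: "v_plus n = glue n (\<lambda>y. - y\<^sup>2 / 2 + y / (2 * real n))"
  by (simp add: v_plus_def glue_def fun_eq_iff Let_def)

context
  fixes n :: nat
  assumes n: "n \<ge> 1"
begin

lemma glue_piece:
  assumes q: "q (1 / real n) = - q 0" and x: "x \<in> {real k / real n .. real (Suc k) / real n}"
  shows "glue n q x = (-1) ^ k * q (x - real k / real n)"
proof (cases "x = real (Suc k) / real n")
  case True
  have "real n * x = real (Suc k)" using True n by simp
  then have fl: "nat \<lfloor>real n * x\<rfloor> = Suc k" by (metis floor_of_nat nat_int)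
  have "x - real k / real n = 1 / real n" using True by (simp add: add_divide_distrib)
  then show ?thesis unfolding glue_def Let_def fl using True q by simp
next
  case False
  have "real k \<le> real n * x" "real n * x < real k + 1"
    using x False n by (auto simp: field_simps)
  then have "\<lfloor>real n * x\<rfloor> = int k" by (intro floor_unique) auto
  then have fl: "nat \<lfloor>real n * x\<rfloor> = k" by simp
  show ?thesis unfolding glue_def Let_def fl ..
qed

lemma glue_continuous:
  assumes q: "q (1 / real n) = - q 0" and c: "continuous_on UNIV q"
  shows "continuous_on {0..1} (glue n q)"
proof -
  have "continuous_on (\<Union>k\<in>{..<n}. {real k / real n .. real (Suc k) / real n}) (glue n q)"
  proof (rule continuous_on_closed_Union)
    fix k
    have "continuous_on {real k / real n .. real (Suc k) / real n} (\<lambda>x. (-1) ^ k * q (x - real k / real n))"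
      by (intro continuous_intros continuous_on_compose2[OF c]) auto
    then show "continuous_on {real k / real n .. real (Suc k) / real n} (glue n q)"
      using glue_piece[OF q] by (subst continuous_on_cong[OF refl]) auto
  qed auto
  moreover have "{0..1} \<subseteq> (\<Union>k\<in>{..<n}. {real k / real n .. real (Suc k) / real n})"
  proof
    fix x :: real assume x: "x \<in> {0..1}"
    show "x \<in> (\<Union>k\<in>{..<n}. {real k / real n .. real (Suc k) / real n})"
    proof (cases "x = 1")
      case True
      then have "x \<in> {real (n - 1) / real n .. real (Suc (n - 1)) / real n}" using n by (simp add: field_simps)
      then show ?thesis using n by (intro UN_I[of "n - 1"]) auto
    next
      case False
      define k where "k = nat \<lfloor>real n * x\<rfloor>"
      have "0 \<le> real n * x" using x by simp
      then have "real k \<le> real n * x" "real n * x < real k + 1" unfolding k_def by linarith+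
      moreover have "k < n"
      proof -
        have "real n * x < real n" using x False n by auto
        then show ?thesis using \<open>real k \<le> real n * x\<close> by linarith
      qed
      ultimately have "k \<in> {..<n}" "x \<in> {real k / real n .. real (Suc k) / real n}"
        using n by (auto simp: field_simps)
      then show ?thesis by blast
    qed
  qed
  ultimately show ?thesis by (rule continuous_on_subset)
qed

definition nodes :: "real set" where "nodes = (\<lambda>k. real k / real n) ` {..n}"

lemma finite_nodes: "finite nodes"
  by (simp add: nodes_def)

lemma off_nodes:
  assumes "x \<in> {0<..<1} - nodes"
  obtains k where "x \<in> {real k / real n <..< real (Suc k) / real n}"
proof -
  define k where "k = nat \<lfloor>real n * x\<rfloor>"
  have x: "0 < x" "x < 1" using assms by auto
  have "0 \<le> real n * x" using x by simp
  then have k: "real k \<le> real n * x" "real n * x < real k + 1" unfolding k_def by linarith+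
  have "real n * x < real n" using x n by auto
  then have "k \<le> n" using k by linarith
  then have "x \<noteq> real k / real n" using assms by (auto simp: nodes_def)
  then have "real k \<noteq> real n * x" using n by (auto simp: field_simps)
  then have "x \<in> {real k / real n <..< real (Suc k) / real n}" using k n by (auto simp: field_simps)
  then show ?thesis by (rule that)
qed

lemma glue_DERIV:
  assumes q: "\<And>y. (q has_real_derivative q' y) (at y)" and b: "q (1 / real n) = - q 0"
    and x: "x \<in> {real k / real n <..< real (Suc k) / real n}"
  shows "(glue n q has_real_derivative (-1) ^ k * q' (x - real k / real n)) (at x)"
proof (rule DERIV_cong_open[OF _ _ x])
  have "((\<lambda>y. (-1) ^ k * q (y - real k / real n)) has_real_derivative (-1) ^ k * (q' (x - real k / real n) * 1)) (at x)"
    by (intro DERIV_cmult DERIV_chain2[OF q]) (auto intro!: derivative_eq_intros)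
  then show "((\<lambda>y. (-1) ^ k * q (y - real k / real n)) has_real_derivative (-1) ^ k * q' (x - real k / real n)) (at x)"
    by simp
qed (auto intro!: glue_piece b)

lemma v_plus_continuous: "continuous_on {0..1} (v_plus n)"
  unfolding v_plus_glue using n by (intro glue_continuous continuous_intros) (auto simp: power2_eq_square)

lemma v_slope_continuous: "continuous_on {0..1} (v_slope n)"
  unfolding v_slope_def using n by (intro glue_continuous continuous_intros) (auto simp: field_simps)

lemma v_plus_0: "v_plus n 0 = 0" and v_plus_1: "v_plus n 1 = 0"
  using n by (simp_all add: v_plus_def Let_def)

lemma v_plus_DERIV:
  assumes "x \<in> {0<..<1} - nodes" shows "(v_plus n has_real_derivative v_slope n x) (at x)"
proof -
  obtain k where k: "x \<in> {real k / real n <..< real (Suc k) / real n}" using off_nodes[OF assms] .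
  have "(v_plus n has_real_derivative (-1) ^ k * (- (x - real k / real n) + 1 / (2 * real n))) (at x)"
    unfolding v_plus_glue using n
    by (intro glue_DERIV k) (auto intro!: derivative_eq_intros simp: power2_eq_square)
  moreover have "v_slope n x = (-1) ^ k * (- (x - real k / real n) + 1 / (2 * real n))"
    unfolding v_slope_def using n k by (intro glue_piece) (auto simp: field_simps)
  ultimately show ?thesis by simp
qed

lemma v_slope_DERIV:
  assumes "x \<in> {0<..<1} - nodes" shows "(v_slope n has_real_derivative - lsgn (v_plus n x)) (at x)"
proof -
  obtain k where k: "x \<in> {real k / real n <..< real (Suc k) / real n}" using off_nodes[OF assms] .
  have d: "(v_slope n has_real_derivative (-1) ^ k * (-1)) (at x)"
    unfolding v_slope_def using n by (intro glue_DERIV k) (auto intro!: derivative_eq_intros simp: field_simps)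
  define y where "y = x - real k / real n"
  have y: "0 < y" "y < 1 / real n" using k by (auto simp: y_def add_divide_distrib)
  have "v_plus n x = (-1) ^ k * (- y\<^sup>2 / 2 + y / (2 * real n))"
    unfolding v_plus_glue y_def using n k by (intro glue_piece) (auto simp: power2_eq_square)
  moreover have "- y\<^sup>2 / 2 + y / (2 * real n) = y * (1 / real n - y) / 2" using n by (simp add: field_simps power2_eq_square)
  moreover have "y * (1 / real n - y) / 2 > 0" using y by simp
  ultimately have "lsgn (v_plus n x) = (-1) ^ k" by (cases "even k") (auto simp: lsgn_def)
  then show ?thesis using d by simp
qed

lemma v_plus_measurable [measurable]: "v_plus n \<in> borel_measurable borel"
  unfolding v_plus_def Let_def by measurable

end

text \<open>The solution of \<open>- b'' = 2\<close> on \<open>(a, a + D)\<close>, \<open>b'' = 0\<close> elsewhere, with zero boundary values.\<close>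

definition bump :: "real \<Rightarrow> real \<Rightarrow> real \<Rightarrow> real" where
  "bump a D x = x * D * (2 - 2 * a - D) - (max 0 (x - a))\<^sup>2 + (max 0 (x - a - D))\<^sup>2"

lemma DERIV_max_0_sq: "((\<lambda>x. (max 0 (x - c))\<^sup>2) has_real_derivative 2 * max 0 (x - c)) (at (x::real))"
proof -
  consider "x < c" | "x > c" | "x = c" by linarith
  then show ?thesis
  proof cases
    case 1
    then show ?thesis by - (rule DERIV_cong_open[of "\<lambda>_. 0" _ _ "{..<c}"], auto)
  next
    case 2
    then show ?thesis
      by - (rule DERIV_cong_open[of "\<lambda>y. (y - c)\<^sup>2" _ _ "{c<..}"], auto intro!: derivative_eq_intros)
  next
    case 3
    have lim: "((\<lambda>y. \<bar>y - c\<bar>) \<longlongrightarrow> 0) (at c)"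
      using tendsto_rabs[OF tendsto_diff[OF tendsto_ident_at[of c UNIV] tendsto_const[of c]]] by simp
    have "\<bar>(max 0 (y - c))\<^sup>2 / (y - c)\<bar> \<le> \<bar>y - c\<bar>" for y
      by (auto simp: max_def power2_eq_square)
    then have "((\<lambda>y. (max 0 (y - c))\<^sup>2 / (y - c)) \<longlongrightarrow> 0) (at c)"
      by (intro Lim_null_comparison[OF always_eventually lim]) auto
    then show ?thesis unfolding 3 has_field_derivative_iff by simp
  qed
qed

lemma DERIV_max_0: "x \<noteq> c \<Longrightarrow> ((\<lambda>x. max 0 (x - c)) has_real_derivative (if x > c then 1 else 0)) (at (x::real))"
proof -
  assume "x \<noteq> c"
  then consider "x < c" | "x > c" by linarith
  then show ?thesis
  proof cases
    case 1
    then show ?thesis by - (rule DERIV_cong_open[of "\<lambda>_. 0" _ _ "{..<c}"], auto)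
  next
    case 2
    then show ?thesis
      by - (rule DERIV_cong_open[of "\<lambda>y. y - c" _ _ "{c<..}"], auto intro!: derivative_eq_intros)
  qed
qed

text \<open>The first eigenfunction dominates a linear function vanishing at 0, up to
  \<open>3/4\<close>; reflected at \<open>1/2\<close>, the estimate serves the other end point as
  well.\<close>

lemma half_le_sin:
  fixes x :: real
  assumes "0 \<le> x" "x \<le> 3/4" shows "x / 2 \<le> sin (pi * x)"
proof (cases "x \<le> 1/3")
  case True
  have "sin (pi * 0) - 0 / 2 \<le> sin (pi * x) - x / 2"
  proof (rule DERIV_nonneg_imp_nondecreasing[OF assms(1)])
    fix y :: real assume y: "0 \<le> y" "y \<le> x"
    have "cos (pi / 3) \<le> cos (pi * y)" using y True by (intro cos_monotone_0_pi_le) auto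
    then have "1 / 2 \<le> cos (pi * y)" by (simp add: cos_60)
    then have "1 * (1 / 2) \<le> pi * cos (pi * y)" using pi_gt3 by (intro mult_mono) auto
    moreover have "((\<lambda>x. sin (pi * x) - x / 2) has_real_derivative pi * cos (pi * y) - 1 / 2) (at y)"
      by (auto intro!: derivative_eq_intros)
    ultimately show "\<exists>z. ((\<lambda>x. sin (pi * x) - x / 2) has_real_derivative z) (at y) \<and> 0 \<le> z" by force
  qed
  then show ?thesis by simp
next
  case False
  have "sin (pi / 4) \<le> sin (pi * x)"
  proof (cases "x \<le> 1/2")
    case True
    have "pi * (1/4) \<le> pi * x" "pi * x \<le> pi * (1/2)" using True False by (intro mult_left_mono; simp)+
    then show ?thesis using pi_gt_zero by (intro sin_monotone_2pi_le) (simp_all, linarith?)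
  next
    case False
    have "pi * (1/4) \<le> pi * (1 - x)" "pi * (1 - x) \<le> pi * (1/2)" using assms False by (intro mult_left_mono; simp)+
    then have "sin (pi / 4) \<le> sin (pi * (1 - x))" using pi_gt_zero by (intro sin_monotone_2pi_le) (simp_all, linarith?)
    then show ?thesis by (simp add: right_diff_distrib)
  qed
  moreover have "1 \<le> sqrt 2" by simp
  ultimately show ?thesis using assms unfolding sin_45 by linarith
qed

text \<open>\<open>subsol n D\<close> solves the stationary problem with the sign change of \<open>v_plus n\<close> at the first node
  shifted to the right by \<open>D\<close>, up to the last term. That term makes it a strict subsolution, with a
  margin proportional to \<open>D\<close>, so that \<open>D\<close> may grow exponentially below an actual solution.\<close>

definition subsol :: "nat \<Rightarrow> real \<Rightarrow> real \<Rightarrow> real" where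
  "subsol n D x = v_plus n x + bump (1 / real n) D x - (1 / real n) / 4 * D * sin (pi * x) / pi\<^sup>2"

text \<open>For small positive \<open>D\<close> the profile is negative on the added strip, so the
  summand 2 flips the source there from -1 to 1.\<close>

definition subsol_source :: "nat \<Rightarrow> real \<Rightarrow> real \<Rightarrow> real" where
  "subsol_source n D x = lsgn (v_plus n x) + (if 1 / real n < x \<and> x \<le> 1 / real n + D then 2 else 0)"

context
  fixes n :: nat and a :: real
  assumes n: "n \<ge> 2" and a: "a = 1 / real n"
begin

lemma node_bounds: "0 < a" "a \<le> 1/2"
  using n by (auto simp: a field_simps)

lemma n_ge_1: "n \<ge> 1" using n by simp

lemma subsol_eq: "subsol n D x = v_plus n x + bump a D x - a / 4 * D * sin (pi * x) / pi\<^sup>2"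
  by (simp add: subsol_def a)

lemma subsol_source_eq: "subsol_source n D x = lsgn (v_plus n x) + (if a < x \<and> x \<le> a + D then 2 else 0)"
  by (simp add: subsol_source_def a)

lemma subsol_continuous: "continuous_on {0..1} (subsol n D)"
  unfolding subsol_eq[abs_def] bump_def by (intro continuous_intros v_plus_continuous n_ge_1) simp

lemma subsol_source_measurable [measurable]: "subsol_source n D \<in> borel_measurable borel"
  using v_plus_measurable[OF n_ge_1] unfolding subsol_source_eq[abs_def] by measurable

lemma subsol_source_bound: "\<bar>subsol_source n D x\<bar> \<le> 3"
  using lsgn_bound[of "v_plus n x"] by (auto simp: subsol_source_eq)

lemma subsol_source_source: "source 3 (\<lambda>_. subsol_source n D)"
  unfolding source_def using subsol_source_bound by (auto simp: case_prod_beta)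

text \<open>The subtracted term of \<open>subsol\<close> is the stationary response to
  \<open>a / 4 * D * sine 0\<close>; its denominator \<open>pi^2\<close> is
  \<open>eigenval 0\<close>, so only the coefficient with \<open>k = 0\<close> is affected.\<close>

lemma subsol_coeff:
  assumes D: "0 < D" "D \<le> a / 8"
  shows "sine_coeff (subsol n D) k = (sine_coeff (subsol_source n D) k - a / 4 * D * (if k = 0 then 1 else 0)) / eigenval k"
proof -
  define p where "p x = subsol_source n D x - a / 4 * D * sine 0 x" for x
  define z1 where "z1 x = v_slope n x +
     (D * (2 - 2 * a - D) - 2 * max 0 (x - a) + 2 * max 0 (x - (a + D))) - a / 4 * D * cos (pi * x) / pi" for x
  have aD: "a + D \<le> 1" using node_bounds D by linarith
  have ip: "integrable I01 (subsol_source n D)" by (rule source_integrable[OF subsol_source_source])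
  have isine: "integrable I01 (\<lambda>x. a / 4 * D * sine 0 x)" by (intro integrable_I01_continuous continuous_intros)
  have bump: "bump a D = (\<lambda>x. x * D * (2 - 2 * a - D) - (max 0 (x - a))\<^sup>2 + (max 0 (x - (a + D)))\<^sup>2)"
    by (simp add: bump_def fun_eq_iff diff_diff_eq)
  have "sine_coeff (subsol n D) k = sine_coeff p k / eigenval k"
  proof (rule sine_coeff_second_derivative[of "nodes n \<union> {a, a + D}" _ z1])
    show "finite (nodes n \<union> {a, a + D})" using finite_nodes[OF n_ge_1] by simp
    show "continuous_on {0..1} (subsol n D)" by (rule subsol_continuous)
    show "subsol n D 0 = 0" using node_bounds D by (simp add: subsol_eq bump_def v_plus_0[OF n_ge_1])
    show "subsol n D 1 = 0" using node_bounds aD by (simp add: subsol_eq bump_def v_plus_1[OF n_ge_1] power2_eq_square algebra_simps)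
    show "continuous_on {0..1} z1" unfolding z1_def by (intro continuous_intros v_slope_continuous n_ge_1) simp
    show "integrable I01 p" unfolding p_def using ip isine by simp
    fix x assume x: "x \<in> {0<..<1} - (nodes n \<union> {a, a + D})"
    then have xn: "x \<in> {0<..<1} - nodes n" by blast
    have "((\<lambda>x. x * D * (2 - 2 * a - D)) has_real_derivative D * (2 - 2 * a - D)) (at x)"
      by (auto intro!: derivative_eq_intros)
    moreover have "((\<lambda>x. a / 4 * D * sin (pi * x) / pi\<^sup>2) has_real_derivative a / 4 * D * cos (pi * x) / pi) (at x)"
      by (auto intro!: derivative_eq_intros simp: power2_eq_square)
    ultimately show "(subsol n D has_real_derivative z1 x) (at x)"
      unfolding subsol_eq[abs_def] z1_def bump
      by (intro DERIV_diff DERIV_add v_plus_DERIV[OF n_ge_1 xn] DERIV_max_0_sq)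
    have "((\<lambda>x. D * (2 - 2 * a - D) - 2 * max 0 (x - a) + 2 * max 0 (x - (a + D))) has_real_derivative
       0 - 2 * (if x > a then 1 else 0) + 2 * (if x > a + D then 1 else 0)) (at x)"
      using x by (intro DERIV_diff DERIV_add DERIV_cmult DERIV_max_0 DERIV_const) auto
    moreover have "((\<lambda>x. a / 4 * D * cos (pi * x) / pi) has_real_derivative - (a / 4 * D * sin (pi * x))) (at x)"
      by (auto intro!: derivative_eq_intros)
    note d2 = DERIV_diff[OF DERIV_add[OF v_slope_DERIV[OF n_ge_1 xn] calculation] this]
    have "(z1 has_real_derivative - lsgn (v_plus n x) + (0 - 2 * (if x > a then 1 else 0) + 2 * (if x > a + D then 1 else 0)) - (- (a / 4 * D * sin (pi * x)))) (at x)"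
      unfolding z1_def by (rule d2)
    moreover have "- lsgn (v_plus n x) + (0 - 2 * (if x > a then 1 else 0) + 2 * (if x > a + D then 1 else 0)) - (- (a / 4 * D * sin (pi * x))) = - p x"
      using D by (auto simp: p_def subsol_source_eq sine_def)
    ultimately show "(z1 has_real_derivative - p x) (at x)" by simp
  qed
  also have "sine_coeff p k = sine_coeff (subsol_source n D) k - a / 4 * D * (if k = 0 then 1 else 0)"
    unfolding p_def sine_coeff_diff[OF ip isine] sine_coeff_cmult sine_coeff_sine by auto
  finally show ?thesis .
qed

text \<open>Linear bounds from both end points, because \<open>bump\<close> is linear near each of
  them and has to absorb this term there.\<close>

lemma sine_term_bounds:
  assumes D: "0 < D" and x: "x \<in> {0..1}"
  shows "0 \<le> a / 4 * D * sin (pi * x) / pi\<^sup>2" "a / 4 * D * sin (pi * x) / pi\<^sup>2 \<le> a / 4 * D * x"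
    "a / 4 * D * sin (pi * x) / pi\<^sup>2 \<le> a / 4 * D * (1 - x)"
proof -
  have c: "0 \<le> a / 4 * D" using node_bounds D by simp
  have s0: "0 \<le> sin (pi * x)" using x by (intro sin_ge_zero) auto
  then show "0 \<le> a / 4 * D * sin (pi * x) / pi\<^sup>2" using c by simp
  have key: "sin (pi * y) / pi\<^sup>2 \<le> y" if "y \<in> {0..1}" for y
  proof -
    have "sin (pi * y) \<le> pi * y" using that by (intro sin_x_le_x) auto
    also have "\<dots> \<le> pi\<^sup>2 * y" using that pi_gt3 by (intro mult_right_mono) (auto simp: power2_eq_square)
    finally show ?thesis by (simp add: divide_le_eq mult.commute)
  qed
  show "a / 4 * D * sin (pi * x) / pi\<^sup>2 \<le> a / 4 * D * x"
    using mult_left_mono[OF key[OF x] c] by simp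
  have "sin (pi * (1 - x)) = sin (pi * x)" by (simp add: right_diff_distrib)
  then have "sin (pi * x) / pi\<^sup>2 \<le> 1 - x" using key[of "1 - x"] x by simp
  then show "a / 4 * D * sin (pi * x) / pi\<^sup>2 \<le> a / 4 * D * (1 - x)"
    using mult_left_mono[OF _ c, of "sin (pi * x) / pi\<^sup>2" "1 - x"] by simp
qed

lemma bump_left: "0 < D \<Longrightarrow> x \<le> a \<Longrightarrow> bump a D x = x * D * (2 - 2 * a - D)"
  by (simp add: bump_def)

lemma bump_right: "0 < D \<Longrightarrow> a + D \<le> x \<Longrightarrow> bump a D x = (1 - x) * D * (2 * a + D)"
  by (simp add: bump_def power2_eq_square algebra_simps)

lemma v_second_piece:
  assumes "a \<le> x" "x \<le> 2 * a" shows "v_plus n x = (x - a)\<^sup>2 / 2 - (x - a) * a / 2"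
proof -
  have "v_plus n x = (-1) ^ 1 * (- (x - real 1 / real n)\<^sup>2 / 2 + (x - real 1 / real n) / (2 * real n))"
    using assms n by (intro v_plus_piece) (auto simp: a field_simps)
  then show ?thesis using n by (simp add: a field_simps)
qed

text \<open>The decisive competition: to the right of the node the profile loses at most
  \<open>a * D / 2\<close>, while the shifted source lifts it by almost
  \<open>2 * a * (1 - a) * D\<close>.\<close>

lemma subsol_pos_middle:
  assumes D: "0 < D" "D \<le> a / 8" and x: "a < x" "x \<le> a + D"
  shows "subsol n D x > 0" "v_plus n x < 0"
proof -
  define y where "y = x - a"
  have y: "0 < y" "y \<le> D" using x by (auto simp: y_def)
  have x1: "x \<in> {0..1}" using x node_bounds D by auto
  have v: "v_plus n x = y\<^sup>2 / 2 - y * a / 2"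
    unfolding y_def using x D by (intro v_second_piece) auto
  then have "v_plus n x = y * (y - a) / 2" by (simp add: power2_eq_square algebra_simps diff_divide_distrib)
  moreover have "y * (y - a) < 0" using y D node_bounds by (intro mult_pos_neg) auto
  ultimately show "v_plus n x < 0" by simp
  have b: "bump a D x = x * D * (2 - 2 * a - D) - y\<^sup>2"
    using x D y by (simp add: bump_def y_def)
  have "subsol n D x \<ge> v_plus n x + bump a D x - a / 4 * D * x"
    using sine_term_bounds(2)[OF D(1) x1] by (simp add: subsol_eq)
  also have "v_plus n x + bump a D x - a / 4 * D * x = x * D * (2 - 2 * a - D - a / 4) - y\<^sup>2 / 2 - y * a / 2"
    unfolding v b by (simp add: algebra_simps)
  finally have 1: "subsol n D x \<ge> x * D * (2 - 2 * a - D - a / 4) - y\<^sup>2 / 2 - y * a / 2" .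
  \<comment> \<open>From \<open>a \<le> 1/2\<close> and \<open>D \<le> a / 8 \<le> 1/16\<close>. Of
    the resulting \<open>13/16\<close> multiples of \<open>a * D\<close>, the two negative terms
    consume at most \<open>1/16\<close> and \<open>1/2\<close>, so \<open>1/4\<close> is
    left.\<close>
  have "13/16 \<le> 2 - 2 * a - D - a / 4" using node_bounds D by linarith
  then have "a * D * (13/16) \<le> x * D * (2 - 2 * a - D - a / 4)"
    using x node_bounds D by (intro mult_mono) auto
  moreover have "y\<^sup>2 \<le> D * (a / 8)" unfolding power2_eq_square using y D by (intro mult_mono) auto
  moreover have "y * a \<le> D * a" using y node_bounds by (intro mult_right_mono) auto
  moreover have "0 < a * D" using node_bounds D by simp
  ultimately show "subsol n D x > 0" using 1 by (simp add: mult.commute[of D a])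
qed

lemma subsol_ge_v:
  assumes D: "0 < D" "D \<le> a / 8" and x: "x \<in> {0..1}"
  shows "v_plus n x \<le> subsol n D x"
proof -
  consider "x \<le> a" | "a < x" "x \<le> a + D" | "a + D < x" by linarith
  then show ?thesis
  proof cases
    case 1
    have "x * D * (a / 4) \<le> x * D * (2 - 2 * a - D)" using x D node_bounds by (intro mult_left_mono) auto
    moreover have "a / 4 * D * x = x * D * (a / 4)" by simp
    ultimately show ?thesis
      using sine_term_bounds(2)[OF D(1) x] bump_left[OF D(1) 1] unfolding subsol_eq by linarith
  next
    case 2
    then show ?thesis using subsol_pos_middle[OF D 2] by linarith
  next
    case 3
    have "(1 - x) * D * (a / 4) \<le> (1 - x) * D * (2 * a + D)" using x D node_bounds by (intro mult_left_mono) auto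
    moreover have "a / 4 * D * (1 - x) = (1 - x) * D * (a / 4)" by simp
    ultimately show ?thesis
      using sine_term_bounds(3)[OF D(1) x] bump_right[OF D(1), of x] 3 unfolding subsol_eq by linarith
  qed
qed

text \<open>The subsolution property in the form used for comparison: on the strip, positivity of
  \<open>subsol\<close> forces \<open>lsgn y = 1\<close>; elsewhere \<open>subsol\<close> dominates
  the profile and \<open>lsgn\<close> is monotone.\<close>

lemma subsol_source_le:
  assumes D: "0 < D" "D \<le> a / 8" and x: "x \<in> {0..1}" and y: "subsol n D x \<le> y"
  shows "subsol_source n D x \<le> lsgn y"
proof (cases "a < x \<and> x \<le> a + D")
  case True
  then have "subsol n D x > 0" "v_plus n x < 0" using subsol_pos_middle[OF D] by auto
  then show ?thesis using True y by (simp add: subsol_source_eq lsgn_def)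
next
  case False
  then show ?thesis using lsgn_mono[of "v_plus n x" y] subsol_ge_v[OF D x] y by (auto simp: subsol_source_eq)
qed

text \<open>A gap proportional to \<open>D\<close> on a fixed window, from which the final
  separation in L2 is computed.\<close>

lemma subsol_minus_v_lower:
  assumes D: "0 < D" "D \<le> a / 8" and x: "a / 2 \<le> x" "x < a"
  shows "a * D / 4 \<le> subsol n D x - v_plus n x"
proof -
  have x1: "x \<in> {0..1}" using x node_bounds by auto
  have "1/2 \<le> 2 - 2 * a - D - a / 4" using node_bounds D by linarith
  then have "(a / 2) * D * (1/2) \<le> x * D * (2 - 2 * a - D - a / 4)"
    using x D node_bounds by (intro mult_mono) auto
  also have "\<dots> = bump a D x - a / 4 * D * x" using bump_left[OF D(1), of x] x by (simp add: algebra_simps)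
  also have "\<dots> \<le> subsol n D x - v_plus n x" using sine_term_bounds(2)[OF D(1) x1] by (simp add: subsol_eq)
  finally show ?thesis by simp
qed

lemma subsol_minus_v_upper:
  assumes D: "0 < D" "D \<le> a / 8" and x: "x \<in> {0..1}"
  shows "subsol n D x - v_plus n x \<le> 4 * D"
proof -
  have "bump a D x \<le> 2 * D"
  proof -
    have "(max 0 (x - a - D))\<^sup>2 \<le> (max 0 (x - a))\<^sup>2" using D by (intro power_mono) auto
    moreover have "x * D * (2 - 2 * a - D) \<le> 1 * D * 2" using x D node_bounds by (intro mult_mono) auto
    ultimately show ?thesis unfolding bump_def by linarith
  qed
  then show ?thesis using sine_term_bounds(1)[OF D(1) x] D unfolding subsol_eq by linarith
qed

text \<open>The rise caused by enlarging \<open>D\<close> is bounded by a multiple of the first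
  eigenfunction, including the linear decay at both end points, so it can be paid for by the strict
  margin, which has the same shape.\<close>

lemma subsol_increase:
  assumes D: "0 < D" "D \<le> D'" "D' \<le> a / 8" and x: "x \<in> {0..1}"
  shows "subsol n D' x \<le> subsol n D x + 4 * (D' - D) * sin (pi * x)"
proof -
  have D': "0 < D'" using D by simp
  have s0: "0 \<le> sin (pi * x)" using x by (intro sin_ge_zero) auto
  have "a / 4 * D * sin (pi * x) / pi\<^sup>2 \<le> a / 4 * D' * sin (pi * x) / pi\<^sup>2"
    using D node_bounds s0 by (intro divide_right_mono mult_right_mono mult_left_mono) auto
  \<comment> \<open>The point \<open>3/4\<close> lies to the right of \<open>a + D'\<close>, so
    beyond it both bumps are linear in \<open>1 - x\<close>.\<close>
  moreover have "bump a D' x - bump a D x \<le> 4 * (D' - D) * sin (pi * x)"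
  proof (cases "x \<le> 3/4")
    case True
    have "(max 0 (x - a - D'))\<^sup>2 \<le> (max 0 (x - a - D))\<^sup>2" using D by (intro power_mono) auto
    then have "bump a D' x - bump a D x \<le> x * D' * (2 - 2 * a - D') - x * D * (2 - 2 * a - D)"
      by (simp add: bump_def)
    also have "\<dots> = x * (D' - D) * (2 - 2 * a - D - D')" by (simp add: algebra_simps)
    also have "\<dots> \<le> x * (D' - D) * 2" using x D node_bounds by (intro mult_left_mono) auto
    also have "\<dots> = 4 * (D' - D) * (x / 2)" by simp
    also have "\<dots> \<le> 4 * (D' - D) * sin (pi * x)" using half_le_sin[of x] True x D by (intro mult_left_mono) auto
    finally show ?thesis .
  next
    case False
    then have "a + D' \<le> x" "a + D \<le> x" using D node_bounds by auto
    then have "bump a D' x - bump a D x = (1 - x) * D' * (2 * a + D') - (1 - x) * D * (2 * a + D)"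
      using D D' by (simp add: bump_right)
    also have "\<dots> = (1 - x) * (D' - D) * (2 * a + D + D')" by (simp add: algebra_simps)
    also have "\<dots> \<le> (1 - x) * (D' - D) * 2" using x D node_bounds by (intro mult_left_mono) auto
    also have "\<dots> = 4 * (D' - D) * ((1 - x) / 2)" by simp
    also have "\<dots> \<le> 4 * (D' - D) * sin (pi * (1 - x))"
      using half_le_sin[of "1 - x"] False x D by (intro mult_left_mono) auto
    also have "sin (pi * (1 - x)) = sin (pi * x)" by (simp add: right_diff_distrib)
    finally show ?thesis .
  qed
  ultimately show ?thesis by (simp add: subsol_eq)
qed

end

section \<open>Monotone iteration and instability\<close>

lemma heat_sol_cmult:
  assumes "source B g"
  shows "heat_sol (\<lambda>t x. c * g t x) t x = c * heat_sol g t x"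
  unfolding heat_sol_def heat_coeff_def sine_coeff_cmult exp_conv_cmult mult.assoc
  by (intro suminf_mult) (use sine_series_summable[OF heat_coeff_summable[OF assms]] in \<open>simp add: heat_coeff_def\<close>)

text \<open>For a source nondecreasing in time the L1 distance of two time slices is exactly the
  difference of their integrals, so \<open>m t\<close> is taken to be the integral of
  \<open>g t\<close>. The sign \<open>\<sigma>\<close> lets one construction serve both profiles, as
  \<open>- lsgn r\<close> is a selection of \<open>H0 (- r)\<close>.\<close>

lemma strong_solution_lsgn:
  assumes g: "source B g" and mono: "\<And>s t x. s \<le> t \<Longrightarrow> g s x \<le> g t x"
    and eq: "\<And>t x. t > 0 \<Longrightarrow> x \<in> {0<..<1} \<Longrightarrow> g t x = lsgn (heat_sol g t x)"
    and \<sigma>: "\<sigma> = 1 \<or> \<sigma> = -1"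
    and u: "\<And>t x. x \<in> {0<..<1} \<Longrightarrow> u t x = \<sigma> * heat_sol g t x"
  shows "strong_solution (u 0) u"
proof (rule strong_solution_heat_sol[where g = "\<lambda>t x. \<sigma> * g t x" and m = "\<lambda>t. LINT x|I01. g t x"])
  note i = source_integrable[OF g]
  note [measurable] = source_measurable[OF g]
  have "(\<lambda>(t, x). \<sigma> * g t x) \<in> borel_measurable (borel \<Otimes>\<^sub>M borel)" by measurable
  moreover have "\<bar>\<sigma> * g t x\<bar> \<le> B" for t x using source_bound[OF g, of t x] \<sigma> by auto
  ultimately show "source B (\<lambda>t x. \<sigma> * g t x)" by (auto simp: source_def)
  show "mono (\<lambda>t. LINT x|I01. g t x)" by (intro monoI integral_mono i mono)
  show "\<bar>LINT x|I01. g t x\<bar> \<le> B" for t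
  proof -
    have "\<bar>LINT x|I01. g t x\<bar> \<le> (LINT x|I01. B)"
      by (rule integral_abs_bound[THEN order_trans], rule integral_mono) (use i source_bound[OF g] in auto)
    then show ?thesis by simp
  qed
  show "(LINT x|I01. \<bar>\<sigma> * g s x - \<sigma> * g t x\<bar>) \<le> \<bar>(LINT x|I01. g s x) - (LINT x|I01. g t x)\<bar>" for s t
  proof -
    have ordered: "(LINT x|I01. \<bar>g s x - g t x\<bar>) = (LINT x|I01. g t x) - (LINT x|I01. g s x)" if "s \<le> t" for s t
    proof -
      have "(LINT x|I01. \<bar>g s x - g t x\<bar>) = (LINT x|I01. g t x - g s x)"
        using mono[OF that] by (intro Bochner_Integration.integral_cong) auto
      then show ?thesis using i by simp
    qed
    have "(LINT x|I01. \<bar>\<sigma> * g s x - \<sigma> * g t x\<bar>) = (LINT x|I01. \<bar>g s x - g t x\<bar>)"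
      using \<sigma> by (intro Bochner_Integration.integral_cong) auto
    then show ?thesis
      using ordered[of s t] ordered[of t s] by (cases "s \<le> t") (auto simp: abs_minus_commute)
  qed
  show "u t x = heat_sol (\<lambda>t x. \<sigma> * g t x) t x" if "x \<in> {0<..<1}" for t x
    using u[OF that] by (simp add: heat_sol_cmult[OF g])
  show "\<sigma> * g t x \<in> H0 (u t x)" if "t > 0" "x \<in> {0<..<1}" for t x
    using \<sigma> u[OF that(2), of t] eq[OF that] lsgn_H0[of "heat_sol g t x"] lsgn_H0_uminus[of "heat_sol g t x"] by auto
qed

lemma v_plus_fixed_point:
  assumes n: "n \<ge> 1" and \<sigma>: "\<sigma> = 1 \<or> \<sigma> = -1"
  shows "fixed_point (\<lambda>x. \<sigma> * v_plus n x)"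
proof -
  note [measurable] = v_plus_measurable[OF n]
  define p where "p x = lsgn (v_plus n x)" for x
  have [measurable]: "p \<in> borel_measurable borel" unfolding p_def by measurable
  have s: "source 1 (\<lambda>_. p)" unfolding source_def using lsgn_bound by (auto simp: case_prod_beta p_def)
  have "heat_sol (\<lambda>_. p) t x = v_plus n x" if "x \<in> {0<..<1}" for t x
  proof (rule heat_sol_stationary[OF s v_plus_continuous[OF n] _ that])
    show "sine_coeff (v_plus n) k = sine_coeff p k / eigenval k" for k
    proof (rule sine_coeff_second_derivative[OF finite_nodes[OF n] v_plus_continuous[OF n] v_plus_0[OF n] v_plus_1[OF n] v_slope_continuous[OF n] v_plus_DERIV[OF n]])
      show "integrable I01 p" by (rule source_integrable[OF s])
      show "(v_slope n has_real_derivative - p x) (at x)" if "x \<in> {0<..<1} - nodes n" for x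
        unfolding p_def by (rule v_slope_DERIV[OF n that])
    qed
  qed
  then show ?thesis
    unfolding fixed_point_def by (intro strong_solution_lsgn[OF s _ _ \<sigma>]) (auto simp: p_def)
qed

section \<open>The growth mechanism and the increasing iterates of the source\<close>

definition start_source :: "nat \<Rightarrow> real \<Rightarrow> real \<Rightarrow> real" where
  "start_source n D x = (if 0 < x \<and> x < 1 then subsol_source n D x - (1 / real n) / 4 * D * sine 0 x else 0)"

text \<open>For \<open>t \<le> 0\<close> the source stays at \<open>start_source n D\<close>, which keeps the solution at \<open>subsol n D\<close>
  up to time \<open>0\<close>.\<close>

primrec iter_source :: "nat \<Rightarrow> real \<Rightarrow> nat \<Rightarrow> real \<Rightarrow> real \<Rightarrow> real" where
  "iter_source n D 0 = (\<lambda>t x. start_source n D x)"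
| "iter_source n D (Suc j) = (\<lambda>t x. if 0 < t \<and> 0 < x \<and> x < 1 then lsgn (heat_sol (iter_source n D j) t x) else start_source n D x)"

definition limit_source :: "nat \<Rightarrow> real \<Rightarrow> real \<Rightarrow> real \<Rightarrow> real" where
  "limit_source n D t x = lim (\<lambda>j. iter_source n D j t x)"

context
  fixes n :: nat and a :: real
  assumes n: "n \<ge> 2" and a: "a = 1 / real n"
begin

text \<open>The difference between the solution and \<open>subsol n D\<close> is driven by a
  nonnegative source plus the margin \<open>a / 4 * D * sine 0\<close>, whose response over one unit
  of time is \<open>\<kappa> * sine 0\<close>. The constant 32 is the product of the 4 in the
  margin, the 4 in \<open>subsol_increase\<close> and a 2 from
  \<open>1 - exp (- eigenval 0) \<ge> 1 / 2\<close>.\<close>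

lemma heat_growth_step:
  assumes G: "source B G" and eq: "\<And>t x. t > 0 \<Longrightarrow> x \<in> {0<..<1} \<Longrightarrow> G t x = lsgn (heat_sol G t x)"
    and D: "0 < D" and D': "D' = (1 + a / (32 * pi\<^sup>2)) * D" "D' \<le> a / 8" and T: "T \<ge> 0"
    and le: "\<And>t x. t \<ge> T \<Longrightarrow> x \<in> {0<..<1} \<Longrightarrow> subsol n D x \<le> heat_sol G t x"
    and t: "t \<ge> T + 1" and x: "x \<in> {0<..<1}"
  shows "subsol n D' x \<le> heat_sol G t x"
proof -
  note ab = node_bounds[OF n a]
  have DD': "D \<le> D'" using D ab by (simp add: D'(1))
  then have D8: "D \<le> a / 8" using D'(2) by simp
  note ps = subsol_source_source[OF n a]
  define \<kappa> where "\<kappa> = a / 4 * D * ((1 - exp (- eigenval 0)) / eigenval 0)"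
  define h where "h x = (heat_sol G t x - subsol n D x) - \<kappa> * sine 0 x" for x
  have iz: "integrable I01 (subsol n D)" by (intro integrable_I01_continuous subsol_continuous[OF n a])
  have isn: "integrable I01 (\<lambda>x. \<kappa> * sine 0 x)" by (intro integrable_I01_continuous continuous_intros)
  note iG = heat_sol_integrable[OF G]
  have ch: "continuous_on {0<..<1} h"
    unfolding h_def
    by (intro continuous_intros heat_sol_continuous[OF G] continuous_on_subset[OF subsol_continuous[OF n a]]) auto
  have "0 \<le> h x"
  proof (rule heat_nonneg[where ?h0.0 = "\<lambda>x. heat_sol G (t - 1) x - subsol n D x" and A = "{0..<1}" and \<tau> = 1
        and G = "\<lambda>r x. G (t + (-1) * r) x - subsol_source n D x" and x = x])
    show "integrable I01 h" unfolding h_def using iG iz isn by simp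
    show "integrable I01 (\<lambda>x. heat_sol G (t - 1) x - subsol n D x)" using iG iz by simp
    show "0 \<le> heat_sol G (t - 1) x - subsol n D x" if "x \<in> {0<..<1}" for x
      using le[of "t - 1" x] t that by simp
    show "source (B + 3) (\<lambda>r x. G (t + (-1) * r) x - subsol_source n D x)" by (rule source_diff[OF G ps])
    show "0 \<le> G (t + (-1) * r) x - subsol_source n D x" if "r \<in> {0..<1}" "x \<in> {0<..<1}" for r x
    proof -
      \<comment> \<open>The window \<open>{0..<1}\<close> is half-open so that \<open>t - r\<close>
        stays positive even for \<open>T = 0\<close> and \<open>t = 1\<close>; the identity
        \<open>eq\<close> holds only at positive times.\<close>
      have "T \<le> t - r" "0 < t - r" using that t T by auto
      then have "subsol_source n D x \<le> G (t - r) x"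
        using that by (subst eq) (auto intro!: subsol_source_le[OF n a D D8] le)
      then show ?thesis by simp
    qed
    fix k
    define l where "l = eigenval k"
    define E where "E = exp (- l)"
    define \<gamma> where "\<gamma> s = sine_coeff (G s) k" for s
    have l: "l > 0" by (simp add: l_def)
    have \<gamma>: "\<gamma> \<in> borel_measurable borel" "\<And>s. \<bar>\<gamma> s\<bar> \<le> 2 * B"
      unfolding \<gamma>_def using source_coeff_measurable[OF G] source_coeff_bound[OF G] by auto
    define X where "X = (LINT r|lborel. indicator {0..<1} r * exp (- l * r) * \<gamma> (t - r))"
    \<comment> \<open>The response over one unit of time to the constant 1, written as in
      \<open>exp_conv_restart\<close> at time 0 so that this formula, applied to a constant,
      evaluates it.\<close>
    define Y where "Y = (LINT r|lborel. indicator {0..<1} r * exp (- l * r) * (\<lambda>_. 1) (0 + 1 - r))"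
    have restart: "heat_coeff G k t = E * heat_coeff G k (t - 1) + X"
      using exp_conv_restart[OF l \<gamma>, of 1 "t - 1"]
      by (simp add: heat_coeff_def \<gamma>_def[abs_def] l_def E_def X_def)
    have Y: "Y = (1 - E) / l"
      using exp_conv_restart[OF l, of "\<lambda>_. 1" 1 1 0] l
      unfolding exp_conv_const[OF l] Y_def[symmetric] by (simp add: E_def field_simps)
    define p where "p = sine_coeff (subsol_source n D) k"
    have "(LINT r|lborel. indicator {0..<1} r * exp (- eigenval k * r) * sine_coeff (\<lambda>x. G (t + (-1) * r) x - subsol_source n D x) k) =
       (LINT r|lborel. indicator {0..<1} r * exp (- l * r) * \<gamma> (t - r) - p * (indicator {0..<1} r * exp (- l * r) * 1))"
      by (simp add: sine_coeff_diff source_integrable[OF G] source_integrable[OF ps] \<gamma>_def p_def l_def algebra_simps)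
    also have "\<dots> = X - p * Y"
    proof -
      have i1: "integrable lborel (\<lambda>r. indicator {0..<1} r * exp (- l * r) * \<gamma> (t - r))"
        by (rule integrable_exp_conv[OF l _ _ \<gamma>]) auto
      have i2: "integrable lborel (\<lambda>r. indicator {0..<1} r * exp (- l * r) * 1)"
        by (rule integrable_exp_conv[OF l, of _ "\<lambda>_. 1" 1]) auto
      show ?thesis unfolding X_def Y_def
        using Bochner_Integration.integral_diff[OF i1 integrable_mult_right[OF i2, of p]] by simp
    qed
    finally have int: "(LINT r|lborel. indicator {0..<1} r * exp (- eigenval k * r) * sine_coeff (\<lambda>x. G (t + (-1) * r) x - subsol_source n D x) k) = X - p * Y" .
    define e :: real where "e = (if k = 0 then 1 else 0)"
    define z where "z = sine_coeff (subsol n D) k"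
    have z: "z = (p - a / 4 * D * e) / l"
      unfolding z_def subsol_coeff[OF n a D D8] by (simp add: p_def e_def l_def)
    have "sine_coeff h k = heat_coeff G k t - z - \<kappa> * e"
    proof -
      have "integrable I01 (\<lambda>x. heat_sol G t x - subsol n D x)" using iG iz by simp
      then have "sine_coeff h k = sine_coeff (\<lambda>x. heat_sol G t x - subsol n D x) k - sine_coeff (\<lambda>x. \<kappa> * sine 0 x) k"
        unfolding h_def by (rule sine_coeff_diff[OF _ isn])
      also have "\<dots> = sine_coeff (heat_sol G t) k - z - \<kappa> * sine_coeff (sine 0) k"
        by (simp only: sine_coeff_diff[OF iG iz] sine_coeff_cmult z_def)
      finally have "sine_coeff h k = sine_coeff (heat_sol G t) k - z - \<kappa> * sine_coeff (sine 0) k" .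
      then show ?thesis by (simp add: heat_sol_coeff[OF G] sine_coeff_sine e_def)
    qed
    moreover have "\<kappa> * e = a / 4 * D * e * ((1 - E) / l)"
      by (auto simp: e_def \<kappa>_def E_def l_def)
    moreover have "z - E * z = p * Y - a / 4 * D * e * ((1 - E) / l)"
    proof -
      have "z - E * z = z * (1 - E)" by (simp add: algebra_simps)
      also have "\<dots> = p * Y - a / 4 * D * e * ((1 - E) / l)" unfolding z Y using l by (simp add: field_simps)
      finally show ?thesis .
    qed
    moreover have "E * sine_coeff (\<lambda>x. heat_sol G (t - 1) x - subsol n D x) k = E * heat_coeff G k (t - 1) - E * z"
      by (simp add: sine_coeff_diff iG iz heat_sol_coeff[OF G] z_def right_diff_distrib)
    ultimately have "sine_coeff h k = X - p * Y + E * sine_coeff (\<lambda>x. heat_sol G (t - 1) x - subsol n D x) k"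
      using restart by linarith
    then show "sine_coeff h k =
       (LINT r|lborel. indicator {0..<1} r * exp (- eigenval k * r) * sine_coeff (\<lambda>x. G (t + (-1) * r) x - subsol_source n D x) k) +
       exp (- eigenval k * 1) * sine_coeff (\<lambda>x. heat_sol G (t - 1) x - subsol n D x) k"
      unfolding int by (simp add: E_def l_def)
  qed (use ch x in auto)
  moreover have "4 * (D' - D) * sin (pi * x) \<le> \<kappa> * sine 0 x"
  proof -
    have s0: "0 \<le> sin (pi * x)" using x by (intro sin_ge_zero) auto
    have "exp (- eigenval 0) \<le> 1 / 2"
    proof -
      have "2 \<le> exp (eigenval 0)" using exp_ge_add_one_self[of "eigenval 0"] eigenval_ge_1[of 0] by linarith
      then show ?thesis by (simp add: exp_minus field_simps)
    qed
    then have "a / 4 * D * ((1/2) / eigenval 0) \<le> \<kappa>"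
      unfolding \<kappa>_def using ab D by (intro mult_left_mono divide_right_mono) (auto simp: less_imp_le)
    moreover have "4 * (D' - D) = a / 4 * D * ((1/2) / eigenval 0)"
      by (simp add: D'(1) eigenval_def field_simps)
    ultimately have "4 * (D' - D) \<le> \<kappa>" by linarith
    from mult_right_mono[OF this s0] show ?thesis by (simp add: sine_def)
  qed
  moreover have "subsol n D' x \<le> subsol n D x + 4 * (D' - D) * sin (pi * x)"
    using x by (intro subsol_increase[OF n a D DD' D'(2)]) auto
  ultimately show ?thesis unfolding h_def by linarith
qed

text \<open>The step is repeated up to the last power with \<open>\<mu> ^ j * D \<le> a / 8\<close>;
  as \<open>\<mu> \<le> 2\<close>, that power cannot fall below \<open>a / 16\<close>, whatever the
  initial \<open>D\<close>.\<close>

lemma heat_growth: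
  assumes G: "source B G" and eq: "\<And>t x. t > 0 \<Longrightarrow> x \<in> {0<..<1} \<Longrightarrow> G t x = lsgn (heat_sol G t x)"
    and D: "0 < D" "D \<le> a / 8"
    and le: "\<And>t x. t \<ge> 0 \<Longrightarrow> x \<in> {0<..<1} \<Longrightarrow> subsol n D x \<le> heat_sol G t x"
  obtains t E where "t \<ge> 0" "a / 16 \<le> E" "E \<le> a / 8" "\<And>x. x \<in> {0<..<1} \<Longrightarrow> subsol n E x \<le> heat_sol G t x"
proof -
  note ab = node_bounds[OF n a]
  define \<mu> where "\<mu> = 1 + a / (32 * pi\<^sup>2)"
  have \<mu>: "1 < \<mu>" using ab by (simp add: \<mu>_def)
  have \<mu>2: "\<mu> \<le> 2"
  proof -
    have "1 \<le> pi\<^sup>2" using pi_gt3 by (simp add: one_le_power)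
    then have "a \<le> 32 * pi\<^sup>2" using ab by linarith
    then show ?thesis by (simp add: \<mu>_def divide_le_eq)
  qed
  have step: "\<forall>t\<ge>real j. \<forall>x\<in>{0<..<1}. subsol n (\<mu> ^ j * D) x \<le> heat_sol G t x" if "\<mu> ^ j * D \<le> a / 8" for j
    using that
  proof (induction j)
    case 0
    then show ?case using le by simp
  next
    case (Suc j)
    have pos: "0 < \<mu> ^ j * D" using \<mu> D by simp
    have "1 * (\<mu> ^ j * D) \<le> \<mu> * (\<mu> ^ j * D)" using \<mu> pos by (intro mult_right_mono) auto
    then have "\<mu> ^ j * D \<le> a / 8" using Suc.prems by simp
    note IH = Suc.IH[OF this]
    show ?case
    proof (intro allI impI ballI)
      fix t x assume "real (Suc j) \<le> t" "x \<in> {0<..<1::real}"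
      moreover have "\<mu> ^ Suc j * D = (1 + a / (32 * pi\<^sup>2)) * (\<mu> ^ j * D)" by (simp add: \<mu>_def)
      ultimately show "subsol n (\<mu> ^ Suc j * D) x \<le> heat_sol G t x"
        by (intro heat_growth_step[where T = "real j", OF G eq pos _ Suc.prems _ IH[rule_format]]) simp_all
    qed
  qed
  have "\<exists>j. a / 8 < \<mu> ^ j * D"
  proof -
    obtain j where "a / 8 / D < \<mu> ^ j" using real_arch_pow[OF \<mu>] by blast
    then have "a / 8 < \<mu> ^ j * D" by (simp only: pos_divide_less_eq[OF D(1)])
    then show ?thesis by blast
  qed
  then obtain j0 where "a / 8 < \<mu> ^ j0 * D" by blast
  moreover have "\<not> a / 8 < \<mu> ^ 0 * D" using D by simp
  ultimately obtain j where j: "\<forall>i\<le>j. \<not> a / 8 < \<mu> ^ i * D" "a / 8 < \<mu> ^ Suc j * D"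
    using ex_least_nat_less[of "\<lambda>j. a / 8 < \<mu> ^ j * D" j0] by blast
  have pos: "0 < \<mu> ^ j * D" using \<mu> D by simp
  have up: "\<mu> ^ j * D \<le> a / 8" using j(1) by (simp add: not_less)
  have "\<mu> * (\<mu> ^ j * D) \<le> 2 * (\<mu> ^ j * D)" using \<mu>2 pos by (intro mult_right_mono) auto
  then have low: "a / 16 \<le> \<mu> ^ j * D" using j(2) by (simp add: mult.assoc)
  show ?thesis
    by (rule that[of "real j" "\<mu> ^ j * D"]) (use step[OF up] low up in auto)
qed

context
  fixes D :: real
  assumes D: "0 < D" "D \<le> a / 8"
begin

lemma start_source_source: "source 4 (\<lambda>_. start_source n D)"
proof -
  note ab = node_bounds[OF n a]
  note [measurable] = subsol_source_measurable[OF n a]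
  have "\<bar>start_source n D x\<bar> \<le> 4" for x
  proof -
    have "a * D \<le> 1 * 1" using ab D by (intro mult_mono) auto
    then have "\<bar>a / 4 * D\<bar> * \<bar>sine 0 x\<bar> \<le> 1 * 1" using ab D by (intro mult_mono) auto
    then have "\<bar>a / 4 * D * sine 0 x\<bar> \<le> 1" by (simp only: abs_mult mult_1)
    then show ?thesis using subsol_source_bound[OF n a, of D x] unfolding start_source_def a[symmetric] by auto
  qed
  moreover have "start_source n D \<in> borel_measurable borel" unfolding start_source_def by measurable
  ultimately show ?thesis by (auto simp: source_def case_prod_beta)
qed

lemma iter_source_source: "source 4 (iter_source n D j)"
proof (induction j)
  case 0
  then show ?case using start_source_source by simp
next
  case (Suc j)
  note [measurable] = heat_sol_measurable[OF Suc] source_slice[OF start_source_source]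
  have "(\<lambda>(t, x). iter_source n D (Suc j) t x) \<in> borel_measurable (borel \<Otimes>\<^sub>M borel)"
    by simp
  moreover have "\<bar>iter_source n D (Suc j) t x\<bar> \<le> 4" for t x
    using source_bound[OF start_source_source, of x] lsgn_bound[of "heat_sol (iter_source n D j) t x"] by auto
  ultimately show ?case unfolding source_def by blast
qed

lemma heat_sol_start_source:
  assumes "x \<in> {0<..<1}" shows "heat_sol (\<lambda>_. start_source n D) t x = subsol n D x"
proof (rule heat_sol_stationary[OF start_source_source subsol_continuous[OF n a] _ assms])
  fix k
  have ip: "integrable I01 (subsol_source n D)" by (rule source_integrable[OF subsol_source_source[OF n a]])
  have isine: "integrable I01 (\<lambda>x. a / 4 * D * sine 0 x)" by (intro integrable_I01_continuous continuous_intros)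
  have "sine_coeff (start_source n D) k = sine_coeff (\<lambda>x. subsol_source n D x - a / 4 * D * sine 0 x) k"
    by (intro sine_coeff_cong) (simp add: start_source_def a)
  also have "\<dots> = sine_coeff (subsol_source n D) k - a / 4 * D * (if k = 0 then 1 else 0)"
    unfolding sine_coeff_diff[OF ip isine] sine_coeff_cmult sine_coeff_sine by auto
  finally show "sine_coeff (subsol n D) k = sine_coeff (start_source n D) k / eigenval k"
    by (simp only: subsol_coeff[OF n a D])
qed

lemma start_source_le:
  assumes "x \<in> {0<..<1}" "subsol n D x \<le> y" shows "start_source n D x \<le> lsgn y"
proof -
  have "0 \<le> sin (pi * x)" using assms by (intro sin_ge_zero) auto
  then have "0 \<le> a / 4 * D * sine 0 x" using node_bounds[OF n a] D by (simp add: sine_def)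
  moreover have "subsol_source n D x \<le> lsgn y" using assms by (intro subsol_source_le[OF n a D]) auto
  ultimately show ?thesis using assms(1) unfolding start_source_def a[symmetric] by auto
qed

text \<open>The subsolution property starts the induction; comparison for \<open>heat_sol\<close>
  and monotonicity of \<open>lsgn\<close> continue it.\<close>

lemma iter_source_incseq: "incseq (\<lambda>j. iter_source n D j t x)"
proof (rule incseq_SucI)
  fix j
  show "iter_source n D j t x \<le> iter_source n D (Suc j) t x"
  proof (induction j arbitrary: t x)
    case 0
    show ?case using start_source_le[of x "heat_sol (\<lambda>_. start_source n D) t x"] heat_sol_start_source[of x t] by auto
  next
    case (Suc j)
    have "heat_sol (iter_source n D j) t x \<le> heat_sol (iter_source n D (Suc j)) t x" if "x \<in> {0<..<1}"
      using Suc that by (intro heat_sol_mono[OF iter_source_source iter_source_source])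
    then show ?case by (auto intro: lsgn_mono simp del: iter_source.simps simp: iter_source.simps(2)[of n D j] iter_source.simps(2)[of n D "Suc j"])
  qed
qed

lemma start_source_le_iter_source: "start_source n D x \<le> iter_source n D j t x"
  using incseqD[OF iter_source_incseq[of t x], of 0 j] by simp

lemma subsol_le_heat_sol:
  assumes "source C g" "\<And>s y. start_source n D y \<le> g s y" "x \<in> {0<..<1}"
  shows "subsol n D x \<le> heat_sol g t x"
  using heat_sol_mono[OF start_source_source assms(1) assms(2) assms(3), of t] heat_sol_start_source[OF assms(3)] by simp

text \<open>The solution is compared with its own translate by \<open>t - s\<close>. Across time 0
  the order persists because the source of the past lies below every later one, again by the
  subsolution property.\<close>

lemma iter_source_time_mono: "s \<le> t \<Longrightarrow> iter_source n D j s x \<le> iter_source n D j t x"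
proof (induction j arbitrary: s t x)
  case 0
  then show ?case by simp
next
  case (Suc j)
  have "heat_sol (iter_source n D j) s x \<le> heat_sol (iter_source n D j) t x" if "x \<in> {0<..<1}"
  proof -
    have "heat_sol (iter_source n D j) s x \<le> heat_sol (\<lambda>r. iter_source n D j (r + (t - s))) s x"
      using Suc that by (intro heat_sol_mono[OF iter_source_source source_shift[OF iter_source_source]]) auto
    then show ?thesis by (simp add: heat_sol_shift[OF iter_source_source])
  qed
  moreover have "start_source n D x \<le> lsgn (heat_sol (iter_source n D j) t x)" if "x \<in> {0<..<1}"
    using that by (intro start_source_le subsol_le_heat_sol[OF iter_source_source] start_source_le_iter_source)
  ultimately show ?case using Suc.prems by (auto intro: lsgn_mono)
qed

lemma limit_source_LIMSEQ: "(\<lambda>j. iter_source n D j t x) \<longlonglongrightarrow> limit_source n D t x"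
proof -
  have "iter_source n D j t x \<le> 4" for j using source_bound[OF iter_source_source, of j t x] by linarith
  then obtain L where "(\<lambda>j. iter_source n D j t x) \<longlonglongrightarrow> L"
    using incseq_convergent[OF iter_source_incseq[of t x], of 4] by blast
  then show ?thesis unfolding limit_source_def by (simp add: limI)
qed

lemma limit_source_source: "source 4 (limit_source n D)"
  unfolding source_def
proof (intro conjI allI)
  show "(\<lambda>(t, x). limit_source n D t x) \<in> borel_measurable (borel \<Otimes>\<^sub>M borel)"
  proof (rule borel_measurable_LIMSEQ_real)
    show "(\<lambda>j. case z of (t, x) \<Rightarrow> iter_source n D j t x) \<longlonglongrightarrow> (case z of (t, x) \<Rightarrow> limit_source n D t x)" for z
      using limit_source_LIMSEQ by (simp add: case_prod_beta)
  qed (rule source_measurable[OF iter_source_source])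
  show "\<bar>limit_source n D t x\<bar> \<le> 4" for t x
    by (rule LIMSEQ_le_const2[OF tendsto_rabs[OF limit_source_LIMSEQ]]) (use source_bound[OF iter_source_source] in auto)
qed

lemma limit_source_time_mono: "s \<le> t \<Longrightarrow> limit_source n D s x \<le> limit_source n D t x"
  by (rule LIMSEQ_le[OF limit_source_LIMSEQ limit_source_LIMSEQ]) (use iter_source_time_mono in auto)

lemma start_source_le_limit_source: "start_source n D x \<le> limit_source n D t x"
  by (rule LIMSEQ_le_const[OF limit_source_LIMSEQ]) (use start_source_le_iter_source in auto)

lemma limit_source_past: "t \<le> 0 \<Longrightarrow> limit_source n D t x = start_source n D x"
proof -
  assume "t \<le> 0"
  then have "iter_source n D j t x = start_source n D x" for j by (cases j) auto
  then show ?thesis using limit_source_LIMSEQ[of t x] LIMSEQ_unique[OF _ tendsto_const] by simp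
qed

lemma limit_source_fixpoint:
  assumes "t > 0" "x \<in> {0<..<1}"
  shows "limit_source n D t x = lsgn (heat_sol (limit_source n D) t x)"
proof -
  have "incseq (\<lambda>j. heat_sol (iter_source n D j) t x)"
    by (intro incseq_SucI heat_sol_mono[OF iter_source_source iter_source_source] assms incseq_SucD[OF iter_source_incseq])
  moreover have "(\<lambda>j. heat_sol (iter_source n D j) t x) \<longlonglongrightarrow> heat_sol (limit_source n D) t x"
    by (intro heat_sol_tendsto[OF iter_source_source limit_source_source] limit_source_LIMSEQ)
  ultimately have "(\<lambda>j. lsgn (heat_sol (iter_source n D j) t x)) \<longlonglongrightarrow> lsgn (heat_sol (limit_source n D) t x)"
    by (rule lsgn_left_limit)
  moreover have "(\<lambda>j. iter_source n D (Suc j) t x) \<longlonglongrightarrow> limit_source n D t x"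
    by (rule LIMSEQ_Suc[OF limit_source_LIMSEQ])
  moreover have "(\<lambda>j. iter_source n D (Suc j) t x) = (\<lambda>j. lsgn (heat_sol (iter_source n D j) t x))"
    using assms by auto
  ultimately show ?thesis by (metis LIMSEQ_unique)
qed

lemma heat_sol_limit_source_0:
  assumes "x \<in> {0<..<1}" shows "heat_sol (limit_source n D) 0 x = subsol n D x"
proof (rule antisym)
  have "heat_sol (limit_source n D) 0 x \<le> heat_sol (\<lambda>_. start_source n D) 0 x"
    by (intro heat_sol_mono[OF limit_source_source start_source_source] assms) (simp add: limit_source_past)
  then show "heat_sol (limit_source n D) 0 x \<le> subsol n D x" by (simp add: heat_sol_start_source[OF assms])
qed (intro subsol_le_heat_sol[OF limit_source_source] start_source_le_limit_source assms)

end

lemma v_plus_unstable: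
  assumes \<sigma>: "\<sigma> = 1 \<or> \<sigma> = -1"
  shows "unstable_L2 (\<lambda>x. \<sigma> * v_plus n x)"
proof -
  note ab = node_bounds[OF n a]
  have n_ge_1: "n \<ge> 1" using n by simp
  define w where "w x = \<sigma> * v_plus n x" for x
  \<comment> \<open>The L2 norm of the constant gap \<open>a * E / 4\<close> on a window of length
    \<open>a / 2\<close>, with \<open>E\<close> replaced by its guaranteed size
    \<open>a / 16\<close>.\<close>
  define \<epsilon> where "\<epsilon> = sqrt (a / 2) * (a * (a / 16) / 4)"
  have \<epsilon>: "\<epsilon> > 0" using ab by (simp add: \<epsilon>_def)
  have "\<not> stable_L2 w"
  proof
    assume "stable_L2 w"
    then obtain \<gamma> where \<gamma>: "\<gamma> > 0" and stable: "\<And>u0 u t. strong_solution u0 u \<Longrightarrow> L2_dist (u 0) w < \<gamma> \<Longrightarrow> t \<ge> 0 \<Longrightarrow> L2_dist (u t) w < \<epsilon>"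
      using \<epsilon> unfolding stable_L2_def by metis
    \<comment> \<open>The second entry makes the initial distance, at most \<open>4 * D\<close>,
      smaller than \<open>\<gamma>\<close>; the first is the range in which \<open>subsol\<close> is
      a subsolution.\<close>
    define D where "D = min (a / 8) (\<gamma> / 8)"
    have D: "0 < D" "D \<le> a / 8" using ab \<gamma> by (auto simp: D_def)
    define g where "g = limit_source n D"
    define u where "u t x = \<sigma> * heat_sol g t x" for t x
    have g: "source 4 g" unfolding g_def by (rule limit_source_source[OF D])
    have eq: "g t x = lsgn (heat_sol g t x)" if "t > 0" "x \<in> {0<..<1}" for t x
      unfolding g_def by (rule limit_source_fixpoint[OF D that])
    have sol: "strong_solution (u 0) u"
      by (rule strong_solution_lsgn[OF g _ eq \<sigma>]) (auto simp: g_def u_def intro: limit_source_time_mono[OF D])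
    have "L2_dist (u 0) w \<le> 4 * D"
    proof (rule L2_dist_le)
      fix x :: real assume x: "x \<in> {0<..<1}"
      have "\<bar>u 0 x - w x\<bar> = \<bar>subsol n D x - v_plus n x\<bar>"
        using \<sigma> heat_sol_limit_source_0[OF D x] by (auto simp: u_def w_def g_def abs_minus_commute)
      also have "\<dots> \<le> 4 * D"
        using subsol_ge_v[OF n a D, of x] subsol_minus_v_upper[OF n a D, of x] x by auto
      finally show "\<bar>u 0 x - w x\<bar> \<le> 4 * D" .
    qed (use D in simp)
    also have "4 * D < \<gamma>" using \<gamma> by (simp add: D_def min_def)
    finally have small: "L2_dist (u 0) w < \<gamma>" .
    obtain t E where t: "t \<ge> 0" and E: "a / 16 \<le> E" "E \<le> a / 8"
      and ge: "\<And>x. x \<in> {0<..<1} \<Longrightarrow> subsol n E x \<le> heat_sol g t x"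
      by (rule heat_growth[OF g eq D]) (auto simp: g_def intro!: subsol_le_heat_sol[OF D limit_source_source[OF D]] start_source_le_limit_source[OF D])
    have E0: "0 < E" using E ab by simp
    define d where "d x = heat_sol g t x - v_plus n x" for x
    have "(L2_dist (u t) w)\<^sup>2 = (LINT x|I01. (d x)\<^sup>2)"
    proof -
      have "(LINT x|I01. (u t x - w x)\<^sup>2) = (LINT x|I01. (d x)\<^sup>2)"
        using \<sigma> by (intro Bochner_Integration.integral_cong) (auto simp: u_def w_def d_def power2_commute)
      then show ?thesis by (simp add: L2_dist_def L2_norm_def)
    qed
    \<comment> \<open>On the window just left of the node the solution exceeds the profile by
      \<open>a * E / 4\<close>; outside it the square is estimated by 0.\<close>
    moreover have "(LINT x|I01. (a * E / 4)\<^sup>2 * (if a / 2 \<le> x \<and> x < a then 1 else 0)) \<le> (LINT x|I01. (d x)\<^sup>2)"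
    proof (rule integral_mono_AE)
      show "integrable I01 (\<lambda>x. (a * E / 4)\<^sup>2 * (if a / 2 \<le> x \<and> x < a then 1 else 0))"
        using measurable_ident_I01 by (intro integrable_mult_right integrable_I01_bounded[of _ 1]) (measurable, auto)
      show "integrable I01 (\<lambda>x. (d x)\<^sup>2)"
        unfolding d_def by (intro integrable_I01_continuous continuous_intros heat_sol_continuous[OF g] v_plus_continuous[OF n_ge_1])
      show "AE x in I01. (a * E / 4)\<^sup>2 * (if a / 2 \<le> x \<and> x < a then 1 else 0) \<le> (d x)\<^sup>2"
      proof (intro AE_I2)
        fix x assume x: "x \<in> space I01"
        show "(a * E / 4)\<^sup>2 * (if a / 2 \<le> x \<and> x < a then 1 else 0) \<le> (d x)\<^sup>2"
        proof (cases "a / 2 \<le> x \<and> x < a")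
          case True
          then have "a * E / 4 \<le> d x"
            using subsol_minus_v_lower[OF n a E0 E(2), of x] ge[of x] x by (auto simp: d_def)
          then have "(a * E / 4)\<^sup>2 \<le> (d x)\<^sup>2" using ab E0 by (intro power_mono) auto
          then show ?thesis using True by simp
        next
          case False
          then show ?thesis by (simp only: if_False) simp
        qed
      qed
    qed
    moreover have "(LINT x|I01. (a * E / 4)\<^sup>2 * (if a / 2 \<le> x \<and> x < a then 1 else 0)) = (a * E / 4)\<^sup>2 * (a / 2)"
      using integral_I01_window[of "a / 2" a] ab by simp
    moreover have "\<epsilon>\<^sup>2 \<le> (a * E / 4)\<^sup>2 * (a / 2)"
    proof -
      have "(a * (a / 16) / 4)\<^sup>2 \<le> (a * E / 4)\<^sup>2" using ab E by (intro power_mono divide_right_mono mult_left_mono) auto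
      then have "a / 2 * (a * (a / 16) / 4)\<^sup>2 \<le> a / 2 * (a * E / 4)\<^sup>2" using ab by (intro mult_left_mono) auto
      moreover have sq: "(sqrt (a / 2) * y)\<^sup>2 = a / 2 * y\<^sup>2" for y using ab by (simp add: power_mult_distrib)
      have "\<epsilon>\<^sup>2 = a / 2 * (a * (a / 16) / 4)\<^sup>2" unfolding \<epsilon>_def by (rule sq)
      moreover have "(a * E / 4)\<^sup>2 * (a / 2) = a / 2 * (a * E / 4)\<^sup>2" by (rule mult.commute)
      ultimately show ?thesis by linarith
    qed
    ultimately have "\<epsilon>\<^sup>2 \<le> (L2_dist (u t) w)\<^sup>2" by linarith
    then have "\<epsilon> \<le> L2_dist (u t) w" by (rule power2_le_imp_le) (rule L2_dist_nonneg)
    then show False using stable[OF sol small t] by simp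
  qed
  then show ?thesis
    unfolding unstable_L2_def using v_plus_fixed_point[OF n_ge_1 \<sigma>] by (simp add: w_def[abs_def])
qed

end

theorem theorem20:
  fixes n :: nat
  assumes "n \<ge> 2"
  shows "unstable_L2 (v_plus n) \<and> unstable_L2 (v_minus n)"
proof
  show "unstable_L2 (v_plus n)"
    using v_plus_unstable[OF assms refl, of 1] by simp
  have "(\<lambda>x. - 1 * v_plus n x) = v_minus n"
    by (simp add: v_minus_def fun_eq_iff)
  then show "unstable_L2 (v_minus n)"
    using v_plus_unstable[OF assms refl, of "-1"] by simp
qed

end
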